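(* Let $G$ be a mop of order $n \geq 4$ with exactly $n_2$ vertices of degree $2$. Then: - if $n_2<\frac n3$, then $\gamma(G)\le \frac{n+n_2}{4}<\frac n3$; - if $n_2=\frac n3$, then $\gamma(G)\le \frac{n+n_2}{4}=\frac{n-n_2+\mathbf{1}(n,n_2)}{2}=\frac n3$; - if $(n,n_2)=(6,3)$, then $\gamma(G)\le \frac{n-n_2+\mathbf{1}(n,n_2)}{2}=\frac n3$; - if $n_2>\frac n3$ and $(n,n_2)\neq(6,3)$, then $\gamma(G)\le \frac{n-n_2+\mathbf{1}(n,n_2)}{2}<\frac n3$. Moreover, the following assertions hold: (a) The bound is sharp: there are infinitely many values of $n$ for which there is an $n$-vertex mop, with exactly $n_2$ vertices of degree $2$, whose domination number equals $\frac{n+n_2}{4}$ if $n_2\le\frac n3$, and equals $\frac{n-n_2+\mathbf{1}(n,n_2)}{2}$ if $n_2>\frac n3$. (b) If $\gamma(G)=\frac n3$, then $G$ is $n_2$-special or $3$-extreme. (c) If $G$ is extra $n_2$-special, then $\gamma(G)=\frac n3$.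
   Context: All graphs are finite and simple. The order of $G$ is $|V(G)|$. A triangulated disc is a plane graph whose interior faces are triangles and whose exterior (unbounded) face is bounded by a simple cycle. A maximal outerplanar graph, or mop, is a triangulated disc $G$ such that the boundary of the exterior face of $G$ contains all the vertices of $G$. Every mop has a unique Hamiltonian cycle, namely the boundary of its exterior face. $\gamma(G)$ is the domination number of $G$: the minimum size of a set $S\subseteq V(G)$ such that every vertex of $V(G)\setminus S$ is adjacent to a vertex of $S$. $N_G(v)$ denotes the set of neighbors of $v$ in $G$; for a set $U$ of vertices, $N_G[U]$ is $U$ together with all neighbors of vertices of $U$; $d_M(x)$ is the degree of $x$ in $M$. For positive integers $a,b$, $\mathbf{1}(a,b)=1$ if $b$ is odd and $a=2b$, and $\mathbf{1}(a,b)=0$ otherwise. Extreme mops: a mop $G$ is called $t$-extreme, where $t\ge 3$, if $G$ contains a mop $M$ with unique Hamiltonian cycle $C = x_1x_2\dots x_tx_1$ and distinct vertices $y_1,\dots,y_t$ of $G$ lying in the exterior face of $M$ such that $N_G(y_i)=\{x_i,x_{i+1}\}$ for each $i\in\{1,\dots,t-1\}$, $N_G(y_t)=\{x_t,x_1\}$, $V(G)=V(M)\cup\{y_1,\dots,y_t\}$, and $E(G)=E(M)\cup\bigcup_{i=1}^{t}\{y_ix : x\in N_G(y_i)\}$. Special mops: a mop $G$ is called $t$-special, where $t\ge 2$, if $G$ contains a mop $M$ with unique Hamiltonian cycle $C=x_1x_2\dots x_{2t}x_1$ and distinct vertices $y_1,\dots,y_t$ of $G$ lying in the exterior face of $M$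 such that $N_G(y_1),\dots,N_G(y_t)$ are distinct edges of $C$ (an edge being identified with the set of its two end-vertices), $x_i\in N_G[\{y_1,\dots,y_t\}]$ for each $i\in\{1,\dots,2t\}$ with $d_M(x_i)=2$, $V(G)=V(M)\cup\{y_1,\dots,y_t\}$, and $E(G)=E(M)\cup\bigcup_{i=1}^{t}\{y_ix : x\in N_G(y_i)\}$. If in addition $N_G(y_1),\dots,N_G(y_t)$ partition $V(C)$ (their union is $V(C)$ and no two of them intersect), then $G$ is called extra $t$-special. *)

theory Defs
  imports "HOL-Analysis.Analysis"
begin

text \<open>
  Plane graphs in the topological sense: the vertices are points of the plane, an edge is the
  two-element set of its end-vertices, and \<open>curve\<close> sends each edge to the
  point set of the arc that draws it (its values outside \<open>edges\<close> are irrelevant).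
\<close>

record drawn_graph =
  verts :: "complex set"
  edges :: "complex set set"
  curve :: "complex set \<Rightarrow> complex set"

definition plane_graph :: "drawn_graph \<Rightarrow> bool" where
  "plane_graph G \<longleftrightarrow>
     finite (verts G) \<and>
     (\<forall>e\<in>edges G. e \<subseteq> verts G \<and> card e = 2) \<and>
     (\<forall>e\<in>edges G. \<exists>g. arc g \<and> path_image g = curve G e \<and> {pathstart g, pathfinish g} = e) \<and>
     (\<forall>e\<in>edges G. (curve G e - e) \<inter> (verts G \<union> \<Union> (curve G ` (edges G - {e}))) = {})"

definition plane_subgraph :: "drawn_graph \<Rightarrow> drawn_graph \<Rightarrow> bool" where
  "plane_subgraph M G \<longleftrightarrow>
     verts M \<subseteq> verts G \<and> edges M \<subseteq> edges G \<and> (\<forall>e\<in>edges M. curve M e = curve G e)"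


subsection \<open>Neighbourhoods, degrees and domination\<close>

definition nbrs :: "drawn_graph \<Rightarrow> complex \<Rightarrow> complex set" where
  "nbrs G v = {u. {v, u} \<in> edges G}"

definition closed_nbrs :: "drawn_graph \<Rightarrow> complex set \<Rightarrow> complex set" where
  "closed_nbrs G U = U \<union> \<Union> (nbrs G ` U)"

definition vertex_degree :: "drawn_graph \<Rightarrow> complex \<Rightarrow> nat" where
  "vertex_degree G v = card (nbrs G v)"

definition graph_order :: "drawn_graph \<Rightarrow> nat" where
  "graph_order G = card (verts G)"

definition num_deg2 :: "drawn_graph \<Rightarrow> nat" where
  "num_deg2 G = card {v \<in> verts G. vertex_degree G v = 2}"

definition dominating :: "drawn_graph \<Rightarrow> complex set \<Rightarrow> bool" where
  "dominating G S \<longleftrightarrow> S \<subseteq> verts G \<and> (\<forall>v \<in> verts G - S. \<exists>u\<in>S. {u, v} \<in> edges G)"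

definition domination_number :: "drawn_graph \<Rightarrow> nat" where
  "domination_number G = Min (card ` {S. dominating G S})"


subsection \<open>Cycles\<close>

definition cycle_edges :: "complex list \<Rightarrow> complex set set" where
  "cycle_edges xs = {{xs ! i, xs ! (Suc i mod length xs)} | i. i < length xs}"

definition is_cycle :: "drawn_graph \<Rightarrow> complex list \<Rightarrow> bool" where
  "is_cycle G xs \<longleftrightarrow>
     3 \<le> length xs \<and> distinct xs \<and> set xs \<subseteq> verts G \<and> cycle_edges xs \<subseteq> edges G"

definition hamiltonian_cycle :: "drawn_graph \<Rightarrow> complex list \<Rightarrow> bool" where
  "hamiltonian_cycle G xs \<longleftrightarrow> is_cycle G xs \<and> set xs = verts G"


subsection \<open>Faces and maximal outerplanar graphs\<close>

definition point_set :: "drawn_graph \<Rightarrow> complex set" where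
  "point_set G = verts G \<union> \<Union> (curve G ` edges G)"

definition faces :: "drawn_graph \<Rightarrow> complex set set" where
  "faces G = components (- point_set G)"

definition exterior_face :: "drawn_graph \<Rightarrow> complex set" where
  "exterior_face G = (THE F. F \<in> faces G \<and> \<not> bounded F)"

definition bounded_by_cycle :: "drawn_graph \<Rightarrow> complex set \<Rightarrow> complex list \<Rightarrow> bool" where
  "bounded_by_cycle G F xs \<longleftrightarrow>
     is_cycle G xs \<and> frontier F = \<Union> (curve G ` cycle_edges xs)"

definition triangulated_disc :: "drawn_graph \<Rightarrow> bool" where
  "triangulated_disc G \<longleftrightarrow>
     plane_graph G \<and>
     (\<forall>F \<in> faces G - {exterior_face G}. \<exists>xs. length xs = 3 \<and> bounded_by_cycle G F xs) \<and>
     (\<exists>xs. bounded_by_cycle G (exterior_face G) xs)"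

definition mop :: "drawn_graph \<Rightarrow> bool" where
  "mop G \<longleftrightarrow> triangulated_disc G \<and> verts G \<subseteq> frontier (exterior_face G)"

text \<open>The exterior face is well defined.\<close>

lemma compact_point_set:
  assumes "plane_graph G"
  shows "compact (point_set G)"
proof -
  have fin: "finite (verts G)" and sub: "edges G \<subseteq> Pow (verts G)"
    using assms by (auto simp: plane_graph_def)
  have "finite (edges G)"
    using finite_subset[OF sub] fin by simp
  moreover have "compact (curve G e)" if "e \<in> edges G" for e
  proof -
    have "\<forall>e\<in>edges G. \<exists>g. arc g \<and> path_image g = curve G e \<and> {pathstart g, pathfinish g} = e"
      using assms unfolding plane_graph_def by (elim conjE)
    from bspec[OF this that] obtain g where "arc g" and g: "path_image g = curve G e"
      by (elim exE conjE)
    then show ?thesis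
      using compact_path_image[OF arc_imp_path[of g]] by (simp only: g)
  qed
  ultimately show ?thesis
    unfolding point_set_def
    by (intro compact_Un compact_UN finite_imp_compact[OF fin])
qed

lemma unbounded_face_iff:
  assumes "plane_graph G"
  shows "F \<in> faces G \<and> \<not> bounded F \<longleftrightarrow> F = outside (point_set G)"
proof -
  let ?S = "point_set G"
  have b: "bounded ?S"
    by (rule compact_imp_bounded[OF compact_point_set[OF assms]])
  have conn: "connected (outside ?S)"
    using b by (intro connected_outside) simp_all
  have unb: "\<not> bounded (outside ?S)"
    by (rule unbounded_outside[OF b])
  have out: "outside ?S \<in> components (- ?S)"
    unfolding outside_in_components using conn unb bounded_empty by (intro conjI notI) simp_all
  have "F = outside ?S" if F: "F \<in> components (- ?S)" and nb: "\<not> bounded F"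
  proof -
    obtain x where x: "x \<in> - ?S" "F = connected_component_set (- ?S) x"
      using F by (auto simp: components_def)
    then have "x \<in> F" and "x \<in> outside ?S"
      using nb by (simp_all add: outside)
    then show ?thesis
      using components_eq[OF F out] by blast
  qed
  then show ?thesis
    using out unb by (auto simp: faces_def)
qed

lemma exterior_face_eq_outside:
  assumes "plane_graph G"
  shows "exterior_face G = outside (point_set G)"
  unfolding exterior_face_def unbounded_face_iff[OF assms] by simp


subsection \<open>Extreme and special mops\<close>

text \<open>
  Cycles and attached vertices are lists indexed from \<open>0\<close>. A mop has exactly
  one Hamiltonian cycle, and \<open>xs\<close> ranges over its cyclic listings.
\<close>

definition attached :: "drawn_graph \<Rightarrow> drawn_graph \<Rightarrow> complex list \<Rightarrow> complex list \<Rightarrow> bool" where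
  "attached G M xs ys \<longleftrightarrow>
     mop M \<and> plane_subgraph M G \<and> hamiltonian_cycle M xs \<and>
     distinct ys \<and> set ys \<subseteq> verts G \<inter> exterior_face M \<and>
     verts G = verts M \<union> set ys \<and>
     edges G = edges M \<union> {{y, x} | y x. y \<in> set ys \<and> x \<in> nbrs G y}"

definition extreme :: "nat \<Rightarrow> drawn_graph \<Rightarrow> bool" where
  "extreme t G \<longleftrightarrow>
     mop G \<and> 3 \<le> t \<and>
     (\<exists>M xs ys. attached G M xs ys \<and> length xs = t \<and> length ys = t \<and>
        (\<forall>i<t. nbrs G (ys ! i) = {xs ! i, xs ! (Suc i mod t)}))"

definition special_via ::
    "nat \<Rightarrow> drawn_graph \<Rightarrow> drawn_graph \<Rightarrow> complex list \<Rightarrow> complex list \<Rightarrow> bool" where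
  "special_via t G M xs ys \<longleftrightarrow>
     attached G M xs ys \<and> length xs = 2 * t \<and> length ys = t \<and>
     (\<forall>y\<in>set ys. nbrs G y \<in> cycle_edges xs) \<and> inj_on (nbrs G) (set ys) \<and>
     (\<forall>x\<in>set xs. vertex_degree M x = 2 \<longrightarrow> x \<in> closed_nbrs G (set ys))"

definition special :: "nat \<Rightarrow> drawn_graph \<Rightarrow> bool" where
  "special t G \<longleftrightarrow> mop G \<and> 2 \<le> t \<and> (\<exists>M xs ys. special_via t G M xs ys)"

definition extra_special :: "nat \<Rightarrow> drawn_graph \<Rightarrow> bool" where
  "extra_special t G \<longleftrightarrow>
     mop G \<and> 2 \<le> t \<and>
     (\<exists>M xs ys. special_via t G M xs ys \<and>
        \<Union> (nbrs G ` set ys) = set xs \<and>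
        (\<forall>y\<in>set ys. \<forall>z\<in>set ys. y \<noteq> z \<longrightarrow> nbrs G y \<inter> nbrs G z = {}))"

definition ind :: "nat \<Rightarrow> nat \<Rightarrow> real" where
  "ind a b = (if odd b \<and> a = 2 * b then 1 else 0)"

end

theory Submission imports Defs begin

text \<open>
  A mop is, combinatorially, a polygon cut into triangles by non-crossing chords, and both bounds on
  the domination number are short arguments about this object. The plane matters in two places: in
  extracting the triangulated polygon from a drawing, and in exhibiting the special, extreme and
  sharp mops as drawings.

  \<^bold>\<open>From the plane to triangulated polygons.\<close> A drawing whose outer face is bounded by a cycle through
  all the vertices is cut by any chord into two smaller drawings of the same kind: the cycle and the
  chord form a theta curve, and the Jordan curve theorem for theta curves splits the interior. The
  bounded faces of the whole are exactly the bounded faces of the two halves (\<open>chord_split\<close>).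
  Induction therefore shows that all bounded faces are triangles if and only if the edges form a
  combinatorial triangulation of the outer cycle (\<open>outerplane_triangulated\<close>,
  \<open>triangulated_triangular_faces\<close>). Applied to the chord that joins the two neighbours of a vertex
  of degree 2 (an ear), the splitting also shows that deleting ears from a mop leaves a mop
  (\<open>ears_removal\<close>).

  \<^bold>\<open>The bound \<open>(n + n2) / 4\<close>.\<close> A triangulated polygon has a proper four-colouring in which any two
  adjacent triangles carry all four colours, because the colours of one triangle determine the
  colour of the new vertex of the next (\<open>rainbow_colouring\<close>). A vertex of degree at least 3 then
  sees all four colours in its closed neighbourhood and an ear misses exactly one. Every colour
  class, enlarged by the ears that miss its colour, dominates; the four sets have total size
  \<open>n + n2\<close>, so one of them has at most a quarter of that.

  \<^bold>\<open>The bound \<open>(n - n2) / 2\<close>.\<close> Delete all ears. The rest is a mop on \<open>n - n2\<close> vertices, every ear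
  sits on its own edge of the outer cycle, and so every vertex cover of that cycle dominates. If some
  edge of the cycle carries no ear, it suffices to cover the path that is left when this edge is
  removed, which takes at most half of the vertices; otherwise \<open>n = 2 n2\<close>, and the cycle needs an extra
  half exactly when its length is odd (\<open>domination_number_le_cover\<close>).

  \<^bold>\<open>Equality.\<close> Both bounds together allow \<open>n / 3\<close> only for \<open>n = 3 n2\<close> and \<open>(n, n2) = (6, 3)\<close>. In the
  first case the mop is special with the ears as attached vertices: a degree-2 vertex of the rest
  that is adjacent to no ear would be an ear itself. In the second, three ears occupy the
  three edges of a triangle. Conversely the attached vertices of an extra special mop have
  disjoint closed neighbourhoods, so no fewer vertices dominate. Such a packing also gives the
  sharpness of both bounds, for explicit families that are drawn with straight edges on a parabola.
\<close>

section \<open>Paths and cycles as vertex lists\<close>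

fun path_edges :: "'a list \<Rightarrow> 'a set set" where
  "path_edges (x # y # zs) = insert {x, y} (path_edges (y # zs))"
| "path_edges _ = {}"

lemma path_edges_append:
  "path_edges (us @ v # ws) = path_edges (us @ [v]) \<union> path_edges (v # ws)"
  by (induction us rule: path_edges.induct) auto

lemma path_edges_snoc:
  "us \<noteq> [] \<Longrightarrow> path_edges (us @ [v]) = insert {last us, v} (path_edges us)"
  by (induction us rule: path_edges.induct) auto

lemma path_edges_conv_nth:
  "path_edges xs = {{xs ! i, xs ! Suc i} | i. Suc i < length xs}"
proof (induction xs rule: path_edges.induct)
  case (1 x y zs)
  have "{i. Suc i < length (x # y # zs)} = insert 0 (Suc ` {i. Suc i < length (y # zs)})"
    by (auto simp: image_iff gr0_conv_Suc less_Suc_eq_0_disj)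
  then show ?case using 1 by (simp add: setcompr_eq_image image_image)
qed auto

lemma path_edges_subset: "e \<in> path_edges xs \<Longrightarrow> e \<subseteq> set xs"
  by (induction xs rule: path_edges.induct) auto

lemma cycle_edges_conv:
  assumes "xs \<noteq> []"
  shows "cycle_edges xs = insert {last xs, hd xs} (path_edges xs)"
proof (intro equalityI subsetI)
  fix e assume "e \<in> cycle_edges xs"
  then obtain i where i: "i < length xs" "e = {xs ! i, xs ! (Suc i mod length xs)}"
    unfolding cycle_edges_def by blast
  show "e \<in> insert {last xs, hd xs} (path_edges xs)"
  proof (cases "Suc i = length xs")
    case True
    then have "xs ! i = last xs" using assms by (metis diff_Suc_1 last_conv_nth)
    then show ?thesis using True i assms by (simp add: hd_conv_nth)
  next
    case False
    then show ?thesis using i by (auto simp: path_edges_conv_nth)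
  qed
next
  fix e assume "e \<in> insert {last xs, hd xs} (path_edges xs)"
  then consider "e = {last xs, hd xs}" | i where "Suc i < length xs" "e = {xs ! i, xs ! Suc i}"
    by (auto simp: path_edges_conv_nth)
  then show "e \<in> cycle_edges xs"
  proof cases
    case 1
    then have "e = {xs ! (length xs - 1), xs ! (Suc (length xs - 1) mod length xs)}"
      using assms by (simp add: hd_conv_nth last_conv_nth)
    then show ?thesis using assms unfolding cycle_edges_def
      by (metis (mono_tags, lifting) diff_less length_greater_0_conv mem_Collect_eq zero_less_one)
  next
    case 2
    then have "e = {xs ! i, xs ! (Suc i mod length xs)}" by simp
    then show ?thesis using 2(1) unfolding cycle_edges_def
      by (intro CollectI exI[of _ i] conjI) simp_all
  qed
qed

lemma cycle_edges_append_commute: "cycle_edges (us @ vs) = cycle_edges (vs @ us)"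
proof (cases "us = [] \<or> vs = []")
  case False
  then obtain a us' b vs' where *: "us = a # us'" "vs = b # vs'" by (meson list.exhaust)
  have "cycle_edges (us @ vs) = {{last vs, hd us}} \<union> path_edges (us @ vs)"
    using False by (simp add: cycle_edges_conv)
  also have "path_edges (us @ vs) = path_edges us \<union> {{last us, hd vs}} \<union> path_edges vs"
    using False path_edges_append[of us b vs'] path_edges_snoc[of us b] * by simp
  finally have 1: "cycle_edges (us @ vs)
      = {{last vs, hd us}} \<union> (path_edges us \<union> {{last us, hd vs}} \<union> path_edges vs)" .
  have "cycle_edges (vs @ us) = {{last us, hd vs}} \<union> path_edges (vs @ us)"
    using False by (simp add: cycle_edges_conv)
  also have "path_edges (vs @ us) = path_edges vs \<union> {{last vs, hd us}} \<union> path_edges us"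
    using False path_edges_append[of vs a us'] path_edges_snoc[of vs a] * by simp
  finally show ?thesis using 1 by blast
qed auto

lemma cycle_edges_subset:
  assumes "e \<in> cycle_edges xs"
  shows "e \<subseteq> set xs"
proof (cases "xs = []")
  case False
  then show ?thesis
    using assms path_edges_subset[of e xs] by (auto simp: cycle_edges_conv)
qed (use assms in \<open>simp add: cycle_edges_def\<close>)

lemma card_cycle_edges:
  assumes "distinct xs" "3 \<le> length xs"
  shows "card (cycle_edges xs) = length xs"
proof -
  let ?n = "length xs"
  let ?f = "\<lambda>i. {xs ! i, xs ! (Suc i mod ?n)}"
  have "inj_on ?f {..<?n}"
  proof (rule inj_onI)
    fix i j assume ij: "i \<in> {..<?n}" "j \<in> {..<?n}" and eq: "?f i = ?f j"
    have m: "Suc i mod ?n < ?n" "Suc j mod ?n < ?n" using assms(2)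
      by (metis length_greater_0_conv list.size(3) mod_less_divisor not_numeral_le_zero)+
    from eq consider "xs ! i = xs ! j"
      | "xs ! i = xs ! (Suc j mod ?n)" "xs ! (Suc i mod ?n) = xs ! j"
      by (auto simp: doubleton_eq_iff)
    then show "i = j"
    proof cases
      case 1 then show ?thesis using assms(1) ij by (simp add: nth_eq_iff_index_eq)
    next
      case 2
      then have "i = Suc j mod ?n" "Suc i mod ?n = j"
        using assms(1) ij m by (simp_all add: nth_eq_iff_index_eq)
      then show ?thesis using ij assms(2)
        by (auto simp: mod_Suc split: if_splits)
    qed
  qed
  moreover have "cycle_edges xs = ?f ` {..<?n}" unfolding cycle_edges_def by auto
  ultimately show ?thesis by (simp add: card_image)
qed

section \<open>Combinatorial triangulations of a polygon\<close>

text \<open>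
  The list is the polygon, read from one end of a distinguished base edge to the other; the edge set
  consists of the sides and the diagonals. The rule \<open>glue\<close> reads off the triangle on the base edge:
  its third corner \<open>v\<close> separates the polygon into two smaller ones, each of which may be a single
  edge.
\<close>

inductive triangulated :: "'a list \<Rightarrow> 'a set set \<Rightarrow> bool" where
  edge: "a \<noteq> b \<Longrightarrow> triangulated [a, b] {{a, b}}"
| glue: "\<lbrakk>triangulated (a # us @ [v]) E\<^sub>1; triangulated (v # ws @ [b]) E\<^sub>2;
          distinct (a # us @ v # ws @ [b])\<rbrakk>
        \<Longrightarrow> triangulated (a # us @ v # ws @ [b]) (insert {a, b} (E\<^sub>1 \<union> E\<^sub>2))"

definition nb :: "'a set set \<Rightarrow> 'a \<Rightarrow> 'a set" where
  "nb E v = {u. {v, u} \<in> E}"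

lemma nb_Un: "nb (E \<union> F) v = nb E v \<union> nb F v" and
  nb_insert: "nb (insert {a, b} E) v = nb E v \<union> {u. {v, u} = {a, b}}"
  by (auto simp: nb_def)

lemma triangulated_distinct: "triangulated xs E \<Longrightarrow> distinct xs"
  by (induction rule: triangulated.induct) auto

lemma triangulated_edge:
  "triangulated xs E \<Longrightarrow> e \<in> E \<Longrightarrow> e \<subseteq> set xs \<and> card e = 2"
  by (induction rule: triangulated.induct) auto

lemma triangulated_nb: "triangulated xs E \<Longrightarrow> nb E v \<subseteq> set xs - {v}"
  using triangulated_edge unfolding nb_def by fastforce

lemma triangulated_nb_outside: "triangulated xs E \<Longrightarrow> v \<notin> set xs \<Longrightarrow> nb E v = {}"
  using triangulated_edge unfolding nb_def by fastforce

lemma finite_nb: "triangulated xs E \<Longrightarrow> finite (nb E v)"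
  by (meson List.finite_set finite_Diff finite_subset triangulated_nb)

lemma triangulated_base: "triangulated xs E \<Longrightarrow> {hd xs, last xs} \<in> E"
  by (induction rule: triangulated.induct) auto

lemma triangulated_path: "triangulated xs E \<Longrightarrow> path_edges xs \<subseteq> E"
proof (induction rule: triangulated.induct)
  case (glue a us v E1 ws b E2)
  have "path_edges (a # us @ v # ws @ [b]) = path_edges (a # us @ [v]) \<union> path_edges (v # ws @ [b])"
    using path_edges_append[of "a # us" v "ws @ [b]"] by simp
  then show ?case using glue by auto
qed auto

lemma triangulated_length: "triangulated xs E \<Longrightarrow> 2 \<le> length xs"
  by (induction rule: triangulated.induct) auto

lemma triangulated_glue:
  assumes "triangulated L E\<^sub>1" "triangulated R E\<^sub>2" "last L = hd R" "distinct (L @ tl R)"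
  shows "triangulated (L @ tl R) (insert {hd L, last R} (E\<^sub>1 \<union> E\<^sub>2))"
proof -
  have split: "\<exists>a us b. xs = a # us @ [b]" if "triangulated xs E" for xs :: "'a list" and E
    using that by (cases rule: triangulated.cases) auto
  obtain a us v where L: "L = a # us @ [v]" using split[OF assms(1)] by blast
  obtain w ws b where R: "R = w # ws @ [b]" using split[OF assms(2)] by blast
  have "w = v" using assms(3) L R by simp
  then show ?thesis using triangulated.glue[of a us v E\<^sub>1 ws b E\<^sub>2] assms L R by simp
qed

lemma append_split_prefix:
  assumes "xs @ ys = us @ vs" "length xs \<le> length us"
  obtains zs where "us = xs @ zs" "ys = zs @ vs"
  using assms by (auto simp: append_eq_append_conv2)

text \<open>
  A side of a triangulated polygon can be replaced by a further triangulated polygon. This is how two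
  halves are put together again when the cut is along an arbitrary chord and not at the
  base edge.
\<close>

lemma triangulated_subst:
  assumes "triangulated xs E\<^sub>2" "xs = A @ [p, q] @ C"
    "triangulated (p # B @ [q]) E\<^sub>1" "distinct (A @ p # B @ q # C)"
  shows "triangulated (A @ p # B @ q # C) (E\<^sub>1 \<union> E\<^sub>2)"
  using assms
proof (induction arbitrary: A C rule: triangulated.induct)
  case (edge a b)
  then have "A = []" "C = []" "a = p" "b = q" by (auto simp: Cons_eq_append_conv)
  moreover have "{p, q} \<in> E\<^sub>1" using triangulated_base[OF edge(3)] by simp
  ultimately show ?case using edge by (simp add: insert_absorb)
next
  case (glue a us v F1 ws b F2)
  have eq: "(A @ [p, q]) @ C = (a # us @ [v]) @ (ws @ [b])" using glue.prems by simp
  have len: "triangulated L F \<Longrightarrow> L \<noteq> []" for L :: "'a list" and F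
    using triangulated_length by fastforce
  show ?case
  proof (cases "length (A @ [p, q]) \<le> length (a # us @ [v])")
    case True
    obtain C' where C': "a # us @ [v] = A @ [p, q] @ C'" "C = C' @ ws @ [b]"
      by (rule append_split_prefix[OF eq True]) simp
    let ?L = "A @ p # B @ q # C'"
    have t: "triangulated ?L (E\<^sub>1 \<union> F1)"
      using glue.IH(1)[OF C'(1) glue.prems(2)] glue.prems(3) C'(2) by (auto simp: Int_Un_distrib)
    have l: "last ?L = v" using arg_cong[OF C'(1), of last] by (simp split: if_splits)
    have h: "hd ?L = a" using arg_cong[OF C'(1), of hd] by (cases A) simp_all
    have "triangulated (?L @ tl (v # ws @ [b]))
        (insert {hd ?L, last (v # ws @ [b])} ((E\<^sub>1 \<union> F1) \<union> F2))"
      using glue.prems(3) C'(2) l by (intro triangulated_glue[OF t glue.hyps(2)]) simp_all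
    then show ?thesis using h C'(2) by (simp add: Un_assoc)
  next
    case False
    have eq2: "(a # us) @ (v # ws @ [b]) = A @ [p, q] @ C" using eq by simp
    obtain A' where A': "A = a # us @ A'" "v # ws @ [b] = A' @ [p, q] @ C"
      by (rule append_split_prefix[OF eq2]) (use False in simp_all)
    let ?R = "A' @ p # B @ q # C"
    have t: "triangulated ?R (E\<^sub>1 \<union> F2)"
      using glue.IH(2)[OF A'(2) glue.prems(2)] glue.prems(3) A'(1) by (auto simp: Int_Un_distrib)
    have l: "last ?R = b" using arg_cong[OF A'(2), of last] by (simp split: if_splits)
    have h: "hd ?R = v" using arg_cong[OF A'(2), of hd] by (cases A') simp_all
    have R: "?R = v # tl ?R" using h by (cases A') simp_all
    have "triangulated ((a # us @ [v]) @ tl ?R)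
        (insert {hd (a # us @ [v]), last ?R} (F1 \<union> (E\<^sub>1 \<union> F2)))"
      using glue.prems(3) A'(1) h R
      by (intro triangulated_glue[OF glue.hyps(1) t]) (simp, metis append_Cons append_assoc append_Nil)
    moreover have "(a # us @ [v]) @ tl ?R = A @ p # B @ q # C" using R A'(1) by simp
    ultimately show ?thesis using l by (simp add: Un_left_commute)
  qed
qed

lemma triangle_triangulated:
  assumes "distinct [a, b, c]"
  shows "triangulated [a, b, c] {{a, b}, {b, c}, {a, c}}"
proof -
  have "triangulated (a # [] @ b # [] @ [c]) (insert {a, c} ({{a, b}} \<union> {{b, c}}))"
    using assms by (intro triangulated.glue) (auto intro: triangulated.edge)
  then show ?thesis by (simp add: insert_commute)
qed

lemma nb_left_only:
  assumes "triangulated (v # ws @ [b]) E\<^sub>2" "y \<notin> set (v # ws @ [b])" "y \<noteq> a"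
  shows "nb (insert {a, b} (E\<^sub>1 \<union> E\<^sub>2)) y = nb E\<^sub>1 y"
  using triangulated_nb_outside[OF assms(1,2)] assms
  by (auto simp: nb_Un nb_insert doubleton_eq_iff)

lemma nb_right_only:
  assumes "triangulated (a # us @ [v]) E\<^sub>1" "y \<notin> set (a # us @ [v])" "y \<noteq> b"
  shows "nb (insert {a, b} (E\<^sub>1 \<union> E\<^sub>2)) y = nb E\<^sub>2 y"
  using triangulated_nb_outside[OF assms(1,2)] assms
  by (auto simp: nb_Un nb_insert doubleton_eq_iff)

text \<open>
  Every corner other than the ends of the base edge becomes the third corner of a base triangle
  somewhere in the recursion. There \<open>y\<close> is adjacent to its two cyclic neighbours \<open>p\<close>, \<open>q\<close> and to the
  two ends of that base edge; degree 2 forces these pairs to coincide.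
\<close>

lemma triangulated_ear:
  assumes "triangulated xs E" "xs = A @ [p, y, q] @ C" "card (nb E y) = 2"
  shows "{p, q} \<in> E"
  using assms
proof (induction arbitrary: A C rule: triangulated.induct)
  case (edge a b)
  then have "length [a, b] = length (A @ [p, y, q] @ C)" by metis
  then show ?case by simp
next
  case (glue a us v E1 ws b E2)
  have d: "distinct (A @ [p, y, q] @ C)" using glue.hyps(3) glue.prems by metis
  have fin: "finite (nb (insert {a, b} (E1 \<union> E2)) y)"
    using triangulated.glue[OF glue.hyps] finite_nb by fast
  have eq: "(A @ [p]) @ y # (q # C) = (a # us) @ v # (ws @ [b])" using glue.prems by simp
  consider "length (A @ [p]) = length (a # us)" | "length (A @ [p]) < length (a # us)"
    | "length (A @ [p]) > length (a # us)" by linarith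
  then show ?case
  proof cases
    case 1
    have e: "A @ [p] = a # us" "y = v" "q # C = ws @ [b]" using eq[unfolded append_eq_append_conv[OF disjI1, OF 1]] by simp_all
    have ab: "a \<in> nb E1 v" "b \<in> nb E2 v"
      using triangulated_base[OF glue.hyps(1)] triangulated_base[OF glue.hyps(2)]
      by (auto simp: nb_def insert_commute)
    have p: "p \<in> nb E1 v"
      using triangulated_path[OF glue.hyps(1)] path_edges_snoc[of "a # us" v]  e(1)
      by (auto simp: nb_def insert_commute dest: arg_cong[of _ _ last])
    have q: "q \<in> nb E2 v"
      using triangulated_path[OF glue.hyps(2)] e(3)[symmetric]
      by (auto simp: nb_def insert_commute)
    have "{a, b, p, q} \<subseteq> nb (insert {a, b} (E1 \<union> E2)) y"
      using ab p q e by (auto simp: nb_Un nb_insert)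
    then have "card {a, b, p, q} \<le> 2" using card_mono[OF fin] glue.prems(2) by metis
    moreover have "p \<in> set (a # us)" "q \<in> set (ws @ [b])"
      using arg_cong[OF e(1), of set] arg_cong[OF e(3), of set] by auto
    then have "a \<noteq> b" "p \<noteq> q" "a \<noteq> q" "p \<noteq> b" using glue.hyps(3) by auto
    ultimately have "p = a" "q = b" by (auto simp: card_insert_if split: if_splits)
    then show ?thesis by simp
  next
    case 2
    have eq2: "(A @ [p, y, q]) @ C = (a # us @ [v]) @ (ws @ [b])" using eq by simp
    obtain C' where C': "a # us @ [v] = A @ [p, y, q] @ C'"
      by (rule append_split_prefix[OF eq2]) (use 2 in simp_all)
    have "y \<in> set (a # us @ [v])" "y \<noteq> a"
      unfolding C' using d arg_cong[OF C', of hd] by (simp, cases A) auto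
    moreover have "distinct (A @ [p, y, q] @ C')" unfolding C'[symmetric] using glue.hyps(3) by auto
    then have "y \<noteq> v" using arg_cong[OF C', of last] last_in_set[of C'] by (auto split: if_splits)
    ultimately have "y \<notin> set (v # ws @ [b])" "y \<noteq> a" using glue.hyps(3) by auto
    then show ?thesis
      using nb_left_only[OF glue.hyps(2)] glue.IH(1)[OF C'] glue.prems(2) by simp
  next
    case 3
    have eq2: "(a # us) @ (v # ws @ [b]) = A @ ([p, y, q] @ C)" using eq by simp
    obtain A' where A': "v # ws @ [b] = A' @ [p, y, q] @ C"
      by (rule append_split_prefix[OF eq2]) (use 3 in simp_all)
    have "distinct (A' @ [p, y, q] @ C)" unfolding A'[symmetric] using glue.hyps(3) by auto
    then have "y \<noteq> v" using arg_cong[OF A', of hd] by (cases A') auto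
    moreover have "y \<in> set (v # ws @ [b])" unfolding A' by simp
    moreover have "y \<noteq> b" using d arg_cong[OF A', of last] by (auto split: if_splits)
    ultimately have "y \<notin> set (a # us @ [v])" "y \<noteq> b" using glue.hyps(3) by auto
    then show ?thesis
      using nb_right_only[OF glue.hyps(1)] glue.IH(2)[OF A'] glue.prems(2) by simp
  qed
qed

text \<open>
  Corners are compared by their position on the polygon. Two edges on different sides of the third
  corner \<open>v\<close> cannot interleave, nor can any edge interleave with the base edge, which spans
  everything.
\<close>

lemma triangulated_noncrossing:
  fixes xs :: "'a :: linorder list"
  assumes "triangulated xs E" "sorted_wrt (<) xs" "{a, b} \<in> E" "{c, d} \<in> E" "a < c" "c < b" "b < d"
  shows False
  using assms
proof (induction rule: triangulated.induct)
  case (edge u v)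
  then show ?case by (auto simp: doubleton_eq_iff)
next
  case (glue u us v E1 ws w E2)
  have s: "sorted_wrt (<) (u # us @ [v])" "sorted_wrt (<) (v # ws @ [w])"
    using glue.prems(1) by (auto simp: sorted_wrt_append)
  have range: "x \<le> w \<and> u \<le> x" if "x \<in> set (u # us @ v # ws @ [w])" for x
    using glue.prems(1) that by (auto simp: sorted_wrt_append intro: less_imp_le)
  have r1: "u \<le> x \<and> x \<le> v" if "x \<in> set (u # us @ [v])" for x
    using s(1) that by (auto simp: sorted_wrt_append intro: less_imp_le)
  have r2: "v \<le> x \<and> x \<le> w" if "x \<in> set (v # ws @ [w])" for x
    using s(2) that by (auto simp: sorted_wrt_append intro: less_imp_le)
  have vs: "x \<in> set (u # us @ v # ws @ [w])" if "e \<in> insert {u, w} (E1 \<union> E2)" "x \<in> e" for x e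
    using that triangulated_edge[OF glue.hyps(1)] triangulated_edge[OF glue.hyps(2)] by fastforce
  have bd: "u \<le> a" "b \<le> w" "u \<le> c" "d \<le> w" using vs range glue.prems(2,3) by blast+
  have "{a, b} \<noteq> {u, w}" "{c, d} \<noteq> {u, w}"
    using glue.prems bd by (auto simp: doubleton_eq_iff)
  then have "{a, b} \<in> E1 \<union> E2" "{c, d} \<in> E1 \<union> E2" using glue.prems(2,3) by auto
  moreover have "{x, y} \<in> E1 \<Longrightarrow> x \<le> v \<and> y \<le> v" "{x, y} \<in> E2 \<Longrightarrow> v \<le> x \<and> v \<le> y" for x y
    using triangulated_edge[OF glue.hyps(1), of "{x, y}"] triangulated_edge[OF glue.hyps(2), of "{x, y}"]
      r1 r2 by auto
  ultimately consider "{a, b} \<in> E1" "{c, d} \<in> E1" | "{a, b} \<in> E2" "{c, d} \<in> E2"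
    using glue.prems(4-6) by fastforce
  then show ?case using glue.IH s glue.prems(4-6) by cases blast+
qed

section \<open>A four-colouring whose classes almost dominate\<close>

text \<open>
  The colouring is determined by the colours \<open>a\<close>, \<open>b\<close> of the base edge and the colour \<open>c\<close> of the corner
  across that edge in an enclosing polygon: the third corner of the base triangle must get the
  remaining colour, and it then passes on to each of its two new base edges the colour of the
  opposite corner. An inner corner sees four colours, or is an ear and sees three. The ends of the base
  edge are incomplete within the polygon, hence the last clause, which says that they see all
  four colours once the corner across the base edge is counted.
\<close>

lemma rainbow_colouring:
  assumes "triangulated xs E" "a < 4" "b < 4" "c < 4" "a \<noteq> b" "a \<noteq> c" "b \<noteq> c"
  shows "\<exists>f :: 'a \<Rightarrow> nat. (\<forall>x. f x < 4) \<and> f (hd xs) = a \<and> f (last xs) = b \<and>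
    (2 < length xs \<longrightarrow>
      (\<forall>x\<in>set xs. f ` insert x (nb E x) = {..<4} \<or>
         card (nb E x) = 2 \<and> card (f ` insert x (nb E x)) = 3) \<and>
      (\<forall>x\<in>{hd xs, last xs}. insert c (f ` insert x (nb E x)) = {..<4}))"
  using assms
proof (induction arbitrary: a b c rule: triangulated.induct)
  case (edge u w)
  then show ?case by (intro exI[of _ "\<lambda>x. if x = u then a else b"]) auto
next
  case (glue u us v E1 ws w E2)
  let ?L = "u # us @ [v]" and ?R = "v # ws @ [w]" and ?E = "insert {u, w} (E1 \<union> E2)"
  have "card ({..<4} - {a, b, c}) = 1" using glue.prems by (subst card_Diff_subset) auto
  then obtain d where d: "{..<4} - {a, b, c} = {d}" by (auto simp: card_1_singleton_iff)
  then have four: "{..<4} = {a, b, c, d}" and ne: "d \<noteq> a" "d \<noteq> b" "d \<noteq> c" "d < 4"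
    using glue.prems by auto
  \<comment> \<open>From the left polygon, the corner across its base edge has colour \<open>b\<close>; from the right one, colour \<open>a\<close>.\<close>
  from glue.IH(1)[of a d b] glue.prems ne obtain f1 where f1: "\<And>x. f1 x < 4" "f1 u = a" "f1 v = d"
    and L: "us \<noteq> [] \<Longrightarrow> x \<in> set ?L \<Longrightarrow> f1 ` insert x (nb E1 x) = {..<4} \<or>
         card (nb E1 x) = 2 \<and> card (f1 ` insert x (nb E1 x)) = 3"
      "us \<noteq> [] \<Longrightarrow> x \<in> {u, v} \<Longrightarrow> insert b (f1 ` insert x (nb E1 x)) = {..<4}" for x
    by (simp only: list.sel last.simps last_snoc length_append length_Cons list.size) fastforce
  from glue.IH(2)[of d b a] glue.prems ne obtain f2 where f2: "\<And>x. f2 x < 4" "f2 v = d" "f2 w = b"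
    and R: "ws \<noteq> [] \<Longrightarrow> x \<in> set ?R \<Longrightarrow> f2 ` insert x (nb E2 x) = {..<4} \<or>
         card (nb E2 x) = 2 \<and> card (f2 ` insert x (nb E2 x)) = 3"
      "ws \<noteq> [] \<Longrightarrow> x \<in> {v, w} \<Longrightarrow> insert a (f2 ` insert x (nb E2 x)) = {..<4}" for x
    by (simp only: list.sel last.simps last_snoc length_append length_Cons list.size) fastforce
  define f where "f x = (if x \<in> set ?L then f1 x else f2 x)" for x
  have fL: "f x = f1 x" if "x \<in> set ?L" for x using that by (simp add: f_def)
  have fR: "f x = f2 x" if "x \<in> set ?R" for x
    using that glue.hyps(3) f1 f2 by (auto simp: f_def)
  have imL: "f ` insert x (nb E1 x) = f1 ` insert x (nb E1 x)" if "x \<in> set ?L" for x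
    using triangulated_nb[OF glue.hyps(1), of x] that by (intro image_cong refl fL) blast
  have imR: "f ` insert x (nb E2 x) = f2 ` insert x (nb E2 x)" if "x \<in> set ?R" for x
    using triangulated_nb[OF glue.hyps(2), of x] that by (intro image_cong refl fR) blast
  have less4: "f x < 4" for x using f1 f2 by (simp add: f_def)
  have vals: "f u = a" "f v = d" "f w = b"
    using fL[of u] fL[of v] fR[of w] f1 f2 by auto
  have uvw: "u \<noteq> v" "v \<noteq> w" "u \<noteq> w" using glue.hyps(3) by auto
  have out: "nb E1 w = {}" "nb E2 u = {}"
    using triangulated_nb_outside[OF glue.hyps(1), of w] triangulated_nb_outside[OF glue.hyps(2), of u]
      glue.hyps(3) by auto
  have nbs: "nb ?E v = nb E1 v \<union> nb E2 v" "nb ?E u = insert w (nb E1 u)" "nb ?E w = insert u (nb E2 w)"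
    using uvw out by (auto simp: nb_insert nb_Un doubleton_eq_iff)
  have base: "u \<in> nb E1 v" "v \<in> nb E1 u" "w \<in> nb E2 v" "v \<in> nb E2 w"
    using triangulated_base[OF glue.hyps(1)] triangulated_base[OF glue.hyps(2)]
    by (auto simp: nb_def insert_commute)
  have short: "nb E1 v = {u} \<and> nb E1 u = {v}" if "us = []"
    using triangulated_nb[OF glue.hyps(1), of u] triangulated_nb[OF glue.hyps(1), of v] base that by auto
  have short': "nb E2 v = {w} \<and> nb E2 w = {v}" if "ws = []"
    using triangulated_nb[OF glue.hyps(2), of w] triangulated_nb[OF glue.hyps(2), of v] base that by auto
  have lt: "f ` A \<subseteq> {..<4}" for A using less4 by auto
  have full_L: "f ` insert x (nb ?E x) = {..<4}" if "us \<noteq> []" "x \<in> {u, v}" for x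
  proof -
    have "insert b (f ` insert x (nb E1 x)) = {..<4}" using L(2)[OF that] that(2) by (subst imL) auto
    moreover have "w \<in> nb ?E x" "nb E1 x \<subseteq> nb ?E x" using that(2) nbs base by auto
    ultimately show ?thesis using vals lt[of "insert x (nb ?E x)"] by blast
  qed
  have full_R: "f ` insert x (nb ?E x) = {..<4}" if "ws \<noteq> []" "x \<in> {v, w}" for x
  proof -
    have "insert a (f ` insert x (nb E2 x)) = {..<4}" using R(2)[OF that] that(2) by (subst imR) auto
    moreover have "u \<in> nb ?E x" "nb E2 x \<subseteq> nb ?E x" using that(2) nbs base by auto
    ultimately show ?thesis using vals lt[of "insert x (nb ?E x)"] by blast
  qed
  have card3: "card {a, b, d} = 3" using glue.prems ne by simp
  have good: "f ` insert x (nb ?E x) = {..<4} \<or> card (nb ?E x) = 2 \<and> card (f ` insert x (nb ?E x)) = 3"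
    if x: "x \<in> set (u # us @ v # ws @ [w])" for x
  proof -
    consider "x = u" | "x = v" | "x = w" | "x \<in> set us" | "x \<in> set ws" using x by auto
    then show ?thesis
    proof cases
      case 1
      show ?thesis
      proof (cases "us = []")
        case True
        then have "nb ?E x = {w, v}" using nbs short 1 by simp
        then show ?thesis using vals 1 uvw card3 by (simp add: insert_commute)
      qed (use full_L 1 in simp)
    next
      case 2
      show ?thesis
      proof (cases "us = [] \<and> ws = []")
        case True
        then have "nb ?E x = {u, w}" using nbs short short' 2 by auto
        then show ?thesis using vals 2 uvw card3 by (simp add: insert_commute)
      next
        case False
        then show ?thesis using full_L[of v] full_R[of v] 2 by blast
      qed
    next
      case 3
      show ?thesis
      proof (cases "ws = []")
        case True
        then have "nb ?E x = {u, v}" using nbs short' 3 by simp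
        then show ?thesis using vals 3 uvw card3 by (simp add: insert_commute)
      qed (use full_R 3 in simp)
    next
      case 4
      then have "nb ?E x = nb E1 x" "us \<noteq> []"
        using nb_left_only[OF glue.hyps(2), of x u] glue.hyps(3) by auto
      then show ?thesis using L(1)[of x] imL[of x] 4 by simp
    next
      case 5
      then have "nb ?E x = nb E2 x" "ws \<noteq> []"
        using nb_right_only[OF glue.hyps(1), of x w] glue.hyps(3) by auto
      then show ?thesis using R(1)[of x] imR[of x] 5 by simp
    qed
  qed
  have ends: "insert c (f ` insert x (nb ?E x)) = {..<4}" if x: "x \<in> {u, w}" for x
  proof -
    consider "x = u" "us \<noteq> []" | "x = w" "ws \<noteq> []" | "x = u" "us = []" | "x = w" "ws = []"
      using x by auto
    then show ?thesis
    proof cases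
      case 1
      then show ?thesis using full_L[of u] glue.prems(3) by blast
    next
      case 2
      then show ?thesis using full_R[of w] glue.prems(3) by blast
    next
      case 3
      then have "nb ?E x = {w, v}" using nbs short by simp
      then show ?thesis using vals 3 four by auto
    next
      case 4
      then have "nb ?E x = {u, v}" using nbs short' by simp
      then show ?thesis using vals 4 four by auto
    qed
  qed
  show ?case
  proof (intro exI[of _ f] conjI impI ballI)
    show "\<forall>x. f x < 4" "f (hd (u # us @ v # ws @ [w])) = a" "f (last (u # us @ v # ws @ [w])) = b"
      using less4 vals by simp_all
  next
    fix x assume "x \<in> {hd (u # us @ v # ws @ [w]), last (u # us @ v # ws @ [w])}"
    then have "x \<in> {u, w}" by simp
    then show "insert c (f ` insert x (nb ?E x)) = {..<4}" by (rule ends)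
  qed (rule good)
qed

text \<open>
  \<open>C i\<close> is the class of colour \<open>i\<close> and \<open>M i\<close> the set of vertices that do not see it. Since only ears
  miss a colour, and only one each, the sets \<open>C i \<union> M i\<close> have total size at most \<open>n + n2\<close>.
\<close>

lemma triangulated_domination:
  assumes "triangulated xs E" "3 \<le> length xs"
  shows "\<exists>D\<subseteq>set xs. (\<forall>v\<in>set xs - D. \<exists>u\<in>D. {u, v} \<in> E) \<and>
    4 * card D \<le> length xs + card {v \<in> set xs. card (nb E v) = 2}"
proof -
  obtain f :: "'a \<Rightarrow> nat" where f: "\<And>x. f x < 4"
    and good: "\<And>x. x \<in> set xs \<Longrightarrow> f ` insert x (nb E x) = {..<4} \<or>
         card (nb E x) = 2 \<and> card (f ` insert x (nb E x)) = 3"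
  proof -
    have "\<exists>f :: 'a \<Rightarrow> nat. (\<forall>x. f x < 4) \<and> f (hd xs) = 0 \<and> f (last xs) = 1 \<and>
      (2 < length xs \<longrightarrow>
      (\<forall>x\<in>set xs. f ` insert x (nb E x) = {..<4} \<or>
         card (nb E x) = 2 \<and> card (f ` insert x (nb E x)) = 3) \<and>
      (\<forall>x\<in>{hd xs, last xs}. insert 2 (f ` insert x (nb E x)) = {..<4}))"
      by (rule rainbow_colouring[OF assms(1)]) simp_all
    then obtain f :: "'a \<Rightarrow> nat" where "(\<forall>x. f x < 4) \<and> f (hd xs) = 0 \<and> f (last xs) = 1 \<and>
      (2 < length xs \<longrightarrow>
      (\<forall>x\<in>set xs. f ` insert x (nb E x) = {..<4} \<or>
         card (nb E x) = 2 \<and> card (f ` insert x (nb E x)) = 3) \<and>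
      (\<forall>x\<in>{hd xs, last xs}. insert 2 (f ` insert x (nb E x)) = {..<4}))" ..
    moreover have "2 < length xs" using assms(2) by simp
    ultimately show thesis by (intro that[of f]) blast+
  qed
  define C where "C i = {x \<in> set xs. f x = i}" for i
  define M where "M i = {x \<in> set xs. i \<notin> f ` insert x (nb E x)}" for i
  let ?Y = "{v \<in> set xs. card (nb E v) = 2}"
  have "(\<Sum>i<4. card (C i)) = card (\<Union>i<4. C i)"
    by (rule card_UN_disjoint[symmetric]) (auto simp: C_def)
  also have "(\<Union>i<4. C i) = set xs" using f by (auto simp: C_def)
  finally have sumC: "(\<Sum>i<4. card (C i)) = length xs"
    using triangulated_distinct[OF assms(1)] by (simp add: distinct_card)
  have "(\<Sum>i<4. card (M i)) = (\<Sum>i<4. \<Sum>x\<in>set xs. if i \<notin> f ` insert x (nb E x) then 1 else 0)"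
    unfolding M_def by (intro sum.cong refl) (simp add: sum.If_cases Int_def conj_commute)
  also have "\<dots> = (\<Sum>x\<in>set xs. \<Sum>i<4. if i \<notin> f ` insert x (nb E x) then 1 else 0)"
    by (rule sum.swap)
  also have "\<dots> = (\<Sum>x\<in>set xs. card ({..<4} - f ` insert x (nb E x)))"
    by (intro sum.cong refl) (simp add: sum.If_cases Int_def Diff_eq Compl_eq)
  also have "\<dots> \<le> (\<Sum>x\<in>set xs. if card (nb E x) = 2 then 1 else 0)"
  proof (rule sum_mono)
    fix x assume x: "x \<in> set xs"
    define K where "K = f ` insert x (nb E x)"
    have "K \<subseteq> {..<4}" using f by (auto simp: K_def)
    then have "card ({..<4} - K) = 4 - card K"
      by (subst card_Diff_subset) (auto intro: finite_subset)
    moreover have "K = {..<4} \<or> card (nb E x) = 2 \<and> card K = 3"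
      using good[OF x] unfolding K_def .
    ultimately show "card ({..<4} - f ` insert x (nb E x)) \<le> (if card (nb E x) = 2 then 1 else 0)"
      unfolding K_def[symmetric] by (elim disjE) simp_all
  qed
  also have "\<dots> = card ?Y" by (simp add: sum.If_cases Int_def conj_commute)
  finally have sumM: "(\<Sum>i<4. card (M i)) \<le> card ?Y" .
  have "(\<Sum>i<4. card (C i \<union> M i)) \<le> (\<Sum>i<4. card (C i) + card (M i))"
    by (intro sum_mono card_Un_le)
  also have "\<dots> \<le> length xs + card ?Y" using sumC sumM by (simp add: sum.distrib)
  finally have total: "(\<Sum>i<4. card (C i \<union> M i)) \<le> length xs + card ?Y" .
  have "\<exists>i<4. 4 * card (C i \<union> M i) \<le> length xs + card ?Y"
  proof (rule ccontr)
    assume "\<not> ?thesis"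
    then have "length xs + card ?Y < 4 * card (C i \<union> M i)" if "i < 4" for i
      using that by auto
    from this[of 0] this[of 1] this[of 2] this[of 3]
    show False using total by (simp add: eval_nat_numeral)
  qed
  then obtain i where i: "4 * card (C i \<union> M i) \<le> length xs + card ?Y" by blast
  have "\<exists>u\<in>C i \<union> M i. {u, v} \<in> E" if v: "v \<in> set xs - (C i \<union> M i)" for v
  proof -
    have "i \<in> f ` insert v (nb E v)" "f v \<noteq> i" using v by (auto simp: C_def M_def)
    then obtain u where u: "u \<in> nb E v" "f u = i" by auto
    then have "u \<in> set xs" using triangulated_nb[OF assms(1), of v] by auto
    then show ?thesis using u by (auto simp: C_def nb_def insert_commute)
  qed
  then show ?thesis using i by (intro exI[of _ "C i \<union> M i"]) (auto simp: C_def M_def)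
qed

section \<open>Curves in plane graphs\<close>

lemma plane_graphD:
  assumes "plane_graph G"
  shows "finite (verts G)"
    and "e \<in> edges G \<Longrightarrow> e \<subseteq> verts G" and "e \<in> edges G \<Longrightarrow> card e = 2"
    and "e \<in> edges G \<Longrightarrow> \<exists>g. arc g \<and> path_image g = curve G e \<and> {pathstart g, pathfinish g} = e"
    and "e \<in> edges G \<Longrightarrow> (curve G e - e) \<inter> verts G = {}"
    and "e \<in> edges G \<Longrightarrow> f \<in> edges G \<Longrightarrow> e \<noteq> f \<Longrightarrow> (curve G e - e) \<inter> curve G f = {}"
  using assms unfolding plane_graph_def by (simp, simp, simp, simp, blast, blast)

lemma edge_subset_curve:
  assumes "plane_graph G" "e \<in> edges G"
  shows "e \<subseteq> curve G e"
proof -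
  obtain g where "path_image g = curve G e" "{pathstart g, pathfinish g} = e"
    using plane_graphD(4)[OF assms] by blast
  then show ?thesis using pathstart_in_path_image[of g] pathfinish_in_path_image[of g] by auto
qed

lemma vertex_on_curve:
  assumes "plane_graph G" "e \<in> edges G" "v \<in> verts G" "v \<in> curve G e"
  shows "v \<in> e"
  using plane_graphD(5)[OF assms(1,2)] assms(3,4) by blast

text \<open>
  Curves of distinct edges meet only in common end-vertices; formulated for sets of edges so that
  it applies directly to the paths that make up cycles and theta curves.
\<close>

lemma curves_Int:
  assumes "plane_graph G" "E \<subseteq> edges G" "F \<subseteq> edges G" "E \<inter> F = {}"
  shows "\<Union> (curve G ` E) \<inter> \<Union> (curve G ` F) \<subseteq> \<Union> E \<inter> \<Union> F"
proof
  fix z assume "z \<in> \<Union> (curve G ` E) \<inter> \<Union> (curve G ` F)"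
  then obtain e f where ef: "e \<in> E" "f \<in> F" "z \<in> curve G e" "z \<in> curve G f" by blast
  then have "e \<in> edges G" "f \<in> edges G" "e \<noteq> f" using assms by auto
  then have "z \<in> e" "z \<in> f"
    using plane_graphD(6)[OF assms(1), of e f] plane_graphD(6)[OF assms(1), of f e] ef by auto
  then show "z \<in> \<Union> E \<inter> \<Union> F" using ef by blast
qed

lemma edge_arc:
  assumes "plane_graph G" "{a, b} \<in> edges G"
  obtains g where "arc g" "path_image g = curve G {a, b}" "pathstart g = a" "pathfinish g = b"
proof -
  obtain g where g: "arc g" "path_image g = curve G {a, b}" "{pathstart g, pathfinish g} = {a, b}"
    using plane_graphD(4)[OF assms] by blast
  then consider "pathstart g = a" "pathfinish g = b" | "pathstart g = b" "pathfinish g = a"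
    by (auto simp: doubleton_eq_iff)
  then show thesis
  proof cases
    case 2
    then show thesis using that[of "reversepath g"] g by (simp add: arc_reversepath)
  qed (use that g in blast)
qed

text \<open>
  An edge without its ends is connected and dense in the edge. It therefore lies in one region of the
  plane if it avoids the region's boundary, and pulls its ends into the closure of that region.
\<close>

lemma open_curve:
  assumes "plane_graph G" "e \<in> edges G"
  shows "connected (curve G e - e)" "curve G e - e \<noteq> {}" "curve G e \<subseteq> closure (curve G e - e)"
proof -
  obtain g where g: "arc g" "path_image g = curve G e" "{pathstart g, pathfinish g} = e"
    using plane_graphD(4)[OF assms] by blast
  then have s: "simple_path g" by (simp add: arc_imp_simple_path)
  show "connected (curve G e - e)" "curve G e - e \<noteq> {}"
    using connected_simple_path_endless[OF s] nonempty_simple_path_endless[OF s] g by simp_all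
  show "curve G e \<subseteq> closure (curve G e - e)"
  proof
    fix z assume z: "z \<in> curve G e"
    have "connected (curve G e)" using g by (metis arc_imp_path connected_path_image)
    moreover have "\<not> (\<exists>x. curve G e = {x})"
      using g by (metis arc_distinct_ends pathfinish_in_path_image pathstart_in_path_image singletonD)
    ultimately have "z islimpt curve G e" using z by (metis connected_imp_perfect)
    then have "z islimpt (e \<union> (curve G e - e))" by (rule islimpt_subset) blast
    moreover have "finite e" using plane_graphD(3)[OF assms] card.infinite by fastforce
    ultimately have "z islimpt (curve G e - e)" using islimpt_Un_finite by blast
    then show "z \<in> closure (curve G e - e)" by (simp add: closure_def)
  qed
qed

lemma path_edges_arc:
  assumes "plane_graph G" "path_edges xs \<subseteq> edges G" "distinct xs" "2 \<le> length xs"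
  shows "\<exists>g. arc g \<and> path_image g = \<Union> (curve G ` path_edges xs) \<and>
    pathstart g = hd xs \<and> pathfinish g = last xs"
  using assms(2-4)
proof (induction xs rule: path_edges.induct)
  case (1 x y zs)
  obtain h where h: "arc h" "path_image h = curve G {x, y}" "pathstart h = x" "pathfinish h = y"
    using edge_arc[OF assms(1), of x y] 1 by auto
  show ?case
  proof (cases zs)
    case Nil
    then show ?thesis using h by (intro exI[of _ h]) simp
  next
    case (Cons z zs')
    then obtain g where g: "arc g" "path_image g = \<Union> (curve G ` path_edges (y # zs))"
      "pathstart g = y" "pathfinish g = last (y # zs)" using 1 by auto
    have "{x, y} \<notin> path_edges (y # zs)"
      using 1(3) path_edges_subset[of "{x, y}" "y # zs"] by auto
    then have "path_image h \<inter> path_image g \<subseteq> {x, y} \<inter> \<Union> (path_edges (y # zs))"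
      using curves_Int[OF assms(1), of "{{x, y}}" "path_edges (y # zs)"] 1(2) h g by auto
    also have "\<dots> \<subseteq> {y}" using path_edges_subset[of _ "y # zs"] 1(3) by fastforce
    finally have "path_image h \<inter> path_image g \<subseteq> {pathstart g}" using g by simp
    then have "arc (h +++ g)" using h g by (intro arc_join) simp_all
    then show ?thesis using h g by (intro exI[of _ "h +++ g"]) (simp add: path_image_join)
  qed
qed auto

definition outline :: "drawn_graph \<Rightarrow> complex list \<Rightarrow> complex set" where
  "outline G xs = \<Union> (curve G ` cycle_edges xs)"

lemma ends_not_path_edge:
  assumes "distinct (a # us @ [b])" "us \<noteq> []"
  shows "{a, b} \<notin> path_edges (a # us @ [b])"
proof -
  obtain u us' where "us = u # us'" using assms(2) by (cases us) auto
  then show ?thesis using assms(1) path_edges_subset[of "{a, b}" "u # us' @ [b]"]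
    by (auto simp: doubleton_eq_iff)
qed

lemma outline_jordan:
  assumes "plane_graph G" "is_cycle G xs"
  obtains c where "simple_path c" "pathfinish c = pathstart c" "path_image c = outline G xs"
proof -
  have xs: "3 \<le> length xs" "distinct xs" "cycle_edges xs \<subseteq> edges G"
    using assms(2) by (auto simp: is_cycle_def)
  obtain a us b where eq: "xs = a # us @ [b]" "us \<noteq> []"
  proof -
    obtain a ys where 1: "xs = a # ys" using xs(1) by (cases xs) auto
    then obtain us b where "ys = us @ [b]" using xs(1) by (cases ys rule: rev_cases) auto
    moreover have "us \<noteq> []" using 1 calculation xs(1) by auto
    ultimately show thesis using that 1 by blast
  qed
  have ce: "cycle_edges xs = insert {b, a} (path_edges xs)"
    by (subst cycle_edges_conv) (auto simp: eq)
  obtain g where g: "arc g" "path_image g = \<Union> (curve G ` path_edges xs)"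
    "pathstart g = a" "pathfinish g = b"
    using path_edges_arc[OF assms(1), of xs] xs ce eq by auto
  obtain h where h: "arc h" "path_image h = curve G {b, a}" "pathstart h = b" "pathfinish h = a"
    using edge_arc[OF assms(1), of b a] xs ce by auto
  have "{b, a} \<notin> path_edges xs"
    using ends_not_path_edge[of a us b] xs eq by (simp add: insert_commute)
  then have "path_image g \<inter> path_image h \<subseteq> {b, a}"
    using curves_Int[OF assms(1), of "path_edges xs" "{{b, a}}"] xs ce g h by auto
  then have "simple_path (g +++ h)" using g h by (intro simple_path_join_loop) auto
  moreover have "path_image (g +++ h) = outline G xs"
    using g h ce by (auto simp: path_image_join outline_def)
  ultimately show thesis using g h that[of "g +++ h"] by simp
qed

lemma outline_facts:
  assumes "plane_graph G" "is_cycle G xs"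
  shows "open (inside (outline G xs))" "connected (inside (outline G xs))"
    "inside (outline G xs) \<noteq> {}" "bounded (inside (outline G xs))"
    "open (outside (outline G xs))" "connected (outside (outline G xs))"
    "outside (outline G xs) \<noteq> {}" "\<not> bounded (outside (outline G xs))"
    "frontier (inside (outline G xs)) = outline G xs"
    "frontier (outside (outline G xs)) = outline G xs"
proof -
  obtain c where c: "simple_path c" "pathfinish c = pathstart c" "path_image c = outline G xs"
    using outline_jordan[OF assms] .
  note J = Jordan_inside_outside[OF c(1,2), unfolded c(3)]
  show "open (inside (outline G xs))" "connected (inside (outline G xs))"
    "inside (outline G xs) \<noteq> {}" "bounded (inside (outline G xs))"
    "open (outside (outline G xs))" "connected (outside (outline G xs))"
    "outside (outline G xs) \<noteq> {}" "\<not> bounded (outside (outline G xs))"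
    "frontier (inside (outline G xs)) = outline G xs"
    "frontier (outside (outline G xs)) = outline G xs"
    using J by simp_all
qed

lemma cycle_vertices_covered:
  assumes "xs \<noteq> []"
  shows "\<Union> (cycle_edges xs) = set xs"
proof
  show "\<Union> (cycle_edges xs) \<subseteq> set xs" using cycle_edges_subset by blast
  show "set xs \<subseteq> \<Union> (cycle_edges xs)"
  proof
    fix x assume "x \<in> set xs"
    then obtain i where "i < length xs" "xs ! i = x" by (auto simp: in_set_conv_nth)
    then show "x \<in> \<Union> (cycle_edges xs)" unfolding cycle_edges_def by blast
  qed
qed

lemma cycle_vertices_on_outline:
  assumes "plane_graph G" "is_cycle G xs"
  shows "set xs \<subseteq> outline G xs"
proof -
  have "xs \<noteq> []" "cycle_edges xs \<subseteq> edges G" using assms(2) by (auto simp: is_cycle_def)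
  then show ?thesis
    using cycle_vertices_covered[of xs] edge_subset_curve[OF assms(1)]
    unfolding outline_def by blast
qed

lemma vertices_on_outline:
  assumes "plane_graph G" "is_cycle G xs"
  shows "verts G \<inter> outline G xs = set xs"
proof
  have "cycle_edges xs \<subseteq> edges G" "set xs \<subseteq> verts G" using assms(2) by (auto simp: is_cycle_def)
  then show "verts G \<inter> outline G xs \<subseteq> set xs"
    using vertex_on_curve[OF assms(1)] cycle_edges_subset[of _ xs] unfolding outline_def by blast
  show "set xs \<subseteq> verts G \<inter> outline G xs"
    using \<open>set xs \<subseteq> verts G\<close> cycle_vertices_on_outline[OF assms] by blast
qed

section \<open>Outerplane drawings\<close>

text \<open>
  Everything about a mop except that its bounded faces are triangles. This part is inherited by both
  halves of a cut, independently of the faces.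
\<close>

definition outerplane :: "drawn_graph \<Rightarrow> complex list \<Rightarrow> bool" where
  "outerplane G xs \<longleftrightarrow> plane_graph G \<and> hamiltonian_cycle G xs \<and>
     point_set G \<subseteq> outline G xs \<union> inside (outline G xs)"

definition triangular_faces :: "drawn_graph \<Rightarrow> complex list \<Rightarrow> bool" where
  "triangular_faces G xs \<longleftrightarrow> (\<forall>F\<in>faces G. F \<subseteq> inside (outline G xs) \<longrightarrow>
     (\<exists>ts. length ts = 3 \<and> bounded_by_cycle G F ts))"

lemma outerplaneD:
  assumes "outerplane G xs"
  shows "plane_graph G" "is_cycle G xs" "set xs = verts G" "3 \<le> length xs" "distinct xs"
    "cycle_edges xs \<subseteq> edges G" "point_set G \<subseteq> outline G xs \<union> inside (outline G xs)"
    "outline G xs \<subseteq> point_set G"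
  using assms unfolding outerplane_def hamiltonian_cycle_def is_cycle_def point_set_def outline_def
  by auto

lemma outerplane_rotate:
  assumes "outerplane G (us @ vs)"
  shows "outerplane G (vs @ us)" "outline G (us @ vs) = outline G (vs @ us)"
    "triangular_faces G (us @ vs) \<longleftrightarrow> triangular_faces G (vs @ us)"
  using assms cycle_edges_append_commute[of us vs]
  by (auto simp: outerplane_def hamiltonian_cycle_def is_cycle_def outline_def triangular_faces_def)

text \<open>
  The rest of the drawing lies on or inside the Jordan curve formed by the outer cycle, so it does not
  change the unbounded component of the complement.
\<close>

lemma exterior_face_outerplane:
  assumes "outerplane G xs"
  shows "exterior_face G = outside (outline G xs)"
proof -
  let ?P = "point_set G" and ?J = "outline G xs"
  note D = outerplaneD[OF assms] and O = outline_facts[OF outerplaneD(1,2)[OF assms]]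
  have "outside ?J \<subseteq> outside ?P"
  proof
    fix z assume z: "z \<in> outside ?J"
    have "outside ?J \<subseteq> - ?P" using D(7) inside_Int_outside outside_no_overlap by blast
    then have "outside ?J \<subseteq> connected_component_set (- ?P) z"
      using z O(6) by (intro connected_component_maximal)
    then show "z \<in> outside ?P" using O(8) by (auto simp: outside intro: bounded_subset)
  qed
  then show ?thesis
    using outside_mono[OF D(8)] exterior_face_eq_outside[OF D(1)] by auto
qed

text \<open>
  From left to right, the frontier of the exterior face is a Jordan curve \<open>J\<close> through all vertices.
  The exterior face is contained in the outside of \<open>J\<close>, and it cannot be smaller because the outside
  is connected and would otherwise meet the frontier \<open>J\<close>.
\<close>

lemma mop_iff_outerplane:
  "mop G \<longleftrightarrow> (\<exists>xs. outerplane G xs \<and> triangular_faces G xs)"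
proof
  assume m: "mop G"
  then have pg: "plane_graph G"
    and tri: "\<And>F. F \<in> faces G - {exterior_face G} \<Longrightarrow> \<exists>ts. length ts = 3 \<and> bounded_by_cycle G F ts"
    and on: "verts G \<subseteq> frontier (exterior_face G)"
    by (auto simp: mop_def triangulated_disc_def)
  obtain xs where xs: "bounded_by_cycle G (exterior_face G) xs"
    using m by (auto simp: mop_def triangulated_disc_def)
  let ?P = "point_set G" and ?J = "outline G xs"
  have cyc: "is_cycle G xs" and fr: "frontier (outside ?P) = ?J"
    using xs exterior_face_eq_outside[OF pg] by (auto simp: bounded_by_cycle_def outline_def)
  note O = outline_facts[OF pg cyc]
  have JP: "?J \<subseteq> ?P" using cyc by (auto simp: is_cycle_def outline_def point_set_def)
  have "outside ?P \<noteq> {}"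
    using unbounded_outside[OF compact_imp_bounded[OF compact_point_set[OF pg]]] by auto
  then have "outside ?J \<subseteq> outside ?P"
    using connected_Int_frontier[OF O(6), of "outside ?P"] outside_mono[OF JP] fr
      outside_no_overlap[of ?J] by blast
  then have out: "outside ?P = outside ?J" using outside_mono[OF JP] by auto
  then have "?P \<subseteq> ?J \<union> inside ?J" using outside_no_overlap[of ?P] inside_outside[of ?J] by blast
  moreover have "verts G \<subseteq> ?J" using on fr exterior_face_eq_outside[OF pg] by simp
  then have "set xs = verts G" using vertices_on_outline[OF pg cyc] by blast
  ultimately have "outerplane G xs" using pg cyc by (simp add: outerplane_def hamiltonian_cycle_def)
  moreover have "triangular_faces G xs"
    unfolding triangular_faces_def
  proof (intro ballI impI)
    fix F assume F: "F \<in> faces G" "F \<subseteq> inside ?J"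
    then have "F \<noteq> {}" unfolding faces_def by (metis in_components_nonempty)
    then have "F \<noteq> exterior_face G"
      using F(2) inside_Int_outside[of ?J] unfolding exterior_face_eq_outside[OF pg] out by blast
    then show "\<exists>ts. length ts = 3 \<and> bounded_by_cycle G F ts" using tri F(1) by blast
  qed
  ultimately show "\<exists>xs. outerplane G xs \<and> triangular_faces G xs" by blast
next
  assume "\<exists>xs. outerplane G xs \<and> triangular_faces G xs"
  then obtain xs where xs: "outerplane G xs" "triangular_faces G xs" by blast
  let ?P = "point_set G" and ?J = "outline G xs"
  note D = outerplaneD[OF xs(1)] and O = outline_facts[OF outerplaneD(1,2)[OF xs(1)]]
    and E = exterior_face_outerplane[OF xs(1)]
  have "F \<subseteq> inside ?J" if F: "F \<in> faces G - {exterior_face G}" for F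
  proof -
    have "exterior_face G \<in> faces G"
      using unbounded_face_iff[OF D(1)] exterior_face_eq_outside[OF D(1)] by blast
    then have "F \<inter> outside ?J = {}"
      using F E components_nonoverlap[of F "- ?P" "outside ?J"] by (simp add: faces_def)
    moreover have "F \<subseteq> - ?P" using F by (simp add: faces_def in_components_subset)
    then have "F \<inter> ?J = {}" using D(8) by blast
    ultimately show ?thesis unfolding inside_outside[of ?J] by blast
  qed
  then have "\<forall>F\<in>faces G - {exterior_face G}. \<exists>ts. length ts = 3 \<and> bounded_by_cycle G F ts"
    using xs(2) unfolding triangular_faces_def by simp
  moreover have "bounded_by_cycle G (exterior_face G) xs"
    using D(2) O(10) E by (simp add: bounded_by_cycle_def outline_def)
  moreover have "verts G \<subseteq> frontier (exterior_face G)"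
    using E O(10) cycle_vertices_on_outline[OF D(1,2)] D(3) by simp
  ultimately show "mop G" using D(1) unfolding mop_def triangulated_disc_def by blast
qed

section \<open>Cutting an outerplane drawing along a chord\<close>

definition induced :: "drawn_graph \<Rightarrow> complex set \<Rightarrow> drawn_graph" where
  "induced G V = \<lparr>verts = V, edges = {e \<in> edges G. e \<subseteq> V}, curve = curve G\<rparr>"

lemma induced_simps [simp]:
  "verts (induced G V) = V" "edges (induced G V) = {e \<in> edges G. e \<subseteq> V}"
  "curve (induced G V) = curve G"
  by (simp_all add: induced_def)

lemma outline_induced [simp]: "outline (induced G V) xs = outline G xs"
  by (simp add: outline_def)

lemma plane_graph_induced:
  assumes "plane_graph G" "V \<subseteq> verts G"
  shows "plane_graph (induced G V)"
  unfolding plane_graph_def induced_simps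
proof (intro conjI ballI)
  show "finite V" using assms finite_subset plane_graphD(1) by blast
next
  fix e assume e: "e \<in> {e \<in> edges G. e \<subseteq> V}"
  then show "e \<subseteq> V" "card e = 2" using plane_graphD(3)[OF assms(1)] by simp_all
  show "\<exists>g. arc g \<and> path_image g = curve G e \<and> {pathstart g, pathfinish g} = e"
    using plane_graphD(4)[OF assms(1)] e by simp
  have "(curve G e - e) \<inter> (verts G \<union> \<Union> (curve G ` (edges G - {e}))) = {}"
    using assms(1) e by (simp add: plane_graph_def)
  then show "(curve G e - e) \<inter> (V \<union> \<Union> (curve G ` ({e \<in> edges G. e \<subseteq> V} - {e}))) = {}"
    using assms(2) by auto
qed

text \<open>
  Inside \<open>U\<close> the components of the complement of a set depend only on the part of the set in \<open>U\<close>,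
  provided that the set separates \<open>U\<close> from the rest. With \<open>U\<close> the interior of one half of a cut, this
  identifies faces of the half with faces of the whole drawing.
\<close>

lemma components_local:
  assumes "P \<inter> U = Q \<inter> U" "frontier U \<subseteq> P" "frontier U \<subseteq> Q" "F \<subseteq> U"
  shows "F \<in> components (- P) \<longleftrightarrow> F \<in> components (- Q)"
proof -
  have "F \<in> components (- Q)"
    if PQ: "P \<inter> U = Q \<inter> U" "frontier U \<subseteq> Q" and F: "F \<in> components (- P)" for P Q
  proof -
    note max = F[unfolded in_components_maximal]
    have f: "F \<noteq> {}" "F \<subseteq> - P" "connected F" using max by simp_all
    have "D = F" if D: "D \<noteq> {}" "F \<subseteq> D" "D \<subseteq> - Q" "connected D" for D
    proof -
      have "D \<inter> U \<noteq> {}" "D \<inter> frontier U = {}" using f(1) assms(4) D PQ(2) by auto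
      then have "D \<subseteq> U" using connected_Int_frontier[OF D(4), of U] by blast
      then have "D \<subseteq> - P" using D(3) PQ(1) by blast
      then show "D = F" using max D by simp
    qed
    moreover have "F \<subseteq> - Q" using f(2) assms(4) PQ(1) by blast
    ultimately show ?thesis
      unfolding in_components_maximal using f by simp
  qed
  from this[of P Q] this[of Q P] show ?thesis using assms by (auto simp only:)
qed

text \<open>
  A chord \<open>{a, b}\<close> of the outer cycle, whose list has been rotated to begin at \<open>a\<close>. The lists \<open>us\<close> and
  \<open>ws\<close> are the vertices strictly on either side; that both are nonempty says that the edge is
  not a side of the polygon. Facts are proved for the left half only, since the right half is the left
  half of the list rotated to begin at \<open>b\<close>.
\<close>

locale chord =
  fixes G :: drawn_graph and a b :: complex and us ws :: "complex list"
  assumes disc: "outerplane G (a # us @ b # ws)"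
    and nonempty: "us \<noteq> []" "ws \<noteq> []"
    and chord: "{a, b} \<in> edges G"
begin

abbreviation "J \<equiv> outline G (a # us @ b # ws)"
abbreviation "L \<equiv> a # us @ [b]"
abbreviation "R \<equiv> b # ws @ [a]"

lemmas D = outerplaneD[OF disc]

lemma cycle_L: "cycle_edges L = insert {a, b} (path_edges L)"
  by (subst cycle_edges_conv) (auto simp: insert_commute)

lemma cycle_R: "cycle_edges R = insert {a, b} (path_edges R)"
  by (subst cycle_edges_conv) (auto simp: insert_commute)

lemma cycle_J: "cycle_edges (a # us @ b # ws) = path_edges L \<union> path_edges R"
proof -
  have "path_edges R = insert {last (b # ws), a} (path_edges (b # ws))"
    using path_edges_snoc[of "b # ws" a] by simp
  moreover have "path_edges (a # us @ b # ws) = path_edges L \<union> path_edges (b # ws)"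
    using path_edges_append[of "a # us" b ws] by simp
  ultimately show ?thesis by (subst cycle_edges_conv) (auto simp: nonempty)
qed

lemma distinct_ends: "a \<noteq> b" using D(5) by auto

lemma chord_not_path: "{a, b} \<notin> path_edges L" "{a, b} \<notin> path_edges R"
  using ends_not_path_edge[of a us b] ends_not_path_edge[of b ws a] D(5) nonempty
  by (auto simp: insert_commute)

lemma path_edges_disjoint: "path_edges L \<inter> path_edges R = {}"
proof (rule ccontr)
  assume "\<not> ?thesis"
  then obtain e where e: "e \<in> path_edges L" "e \<in> path_edges R" by blast
  have "e \<subseteq> set L \<inter> set R" using path_edges_subset e by blast
  also have "set L \<inter> set R = {a, b}" using D(5) by auto
  finally have "e \<subseteq> {a, b}" .
  moreover have "card e = 2" using plane_graphD(3)[OF D(1)] e cycle_J D(6) by blast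
  ultimately have "e = {a, b}" using distinct_ends by (intro card_subset_eq) auto
  then show False using e chord_not_path by simp
qed

text \<open>
  The two paths between \<open>a\<close> and \<open>b\<close> on the outer cycle and the chord form a theta curve.
  The chord is the arc that runs through the interior, because the drawing has nothing outside
  the outer cycle.
\<close>

lemma regions:
  "inside (outline G L) \<inter> inside (outline G R) = {}"
  "inside (outline G L) \<union> inside (outline G R) \<union> (curve G {a, b} - {a, b}) = inside J"
proof -
  note pg = D(1)
  obtain c where c: "arc c" "path_image c = curve G {a, b}" "pathstart c = a" "pathfinish c = b"
    using edge_arc[OF pg chord] .
  obtain c1 where c1: "arc c1" "path_image c1 = \<Union> (curve G ` path_edges L)" "pathstart c1 = a" "pathfinish c1 = b"
    using path_edges_arc[OF pg, of L] D(5,6) cycle_J by auto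
  obtain c2' where c2': "arc c2'" "path_image c2' = \<Union> (curve G ` path_edges R)" "pathstart c2' = b" "pathfinish c2' = a"
    using path_edges_arc[OF pg, of R] D(5,6) cycle_J by auto
  define c2 where "c2 = reversepath c2'"
  have c2: "arc c2" "path_image c2 = \<Union> (curve G ` path_edges R)" "pathstart c2 = a" "pathfinish c2 = b"
    using c2' by (auto simp: c2_def arc_reversepath)
  have ends: "{a, b} \<subseteq> path_image g" if "pathstart g = a" "pathfinish g = b" for g :: "real \<Rightarrow> complex"
    using that pathstart_in_path_image[of g] pathfinish_in_path_image[of g] by auto
  have sub: "path_edges L \<subseteq> edges G" "path_edges R \<subseteq> edges G" using D(6) cycle_J by auto
  have LR: "\<Union> (path_edges L) \<inter> \<Union> (path_edges R) \<subseteq> {a, b}"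
  proof -
    have "\<Union> (path_edges L) \<inter> \<Union> (path_edges R) \<subseteq> set L \<inter> set R" using path_edges_subset by blast
    also have "\<dots> = {a, b}" using D(5) by auto
    finally show ?thesis .
  qed
  have i12: "path_image c1 \<inter> path_image c2 = {a, b}"
  proof (rule equalityI)
    show "path_image c1 \<inter> path_image c2 \<subseteq> {a, b}"
      unfolding c1(2) c2(2) using curves_Int[OF pg sub path_edges_disjoint] LR by (rule order_trans)
  qed (use ends[OF c1(3,4)] ends[OF c2(3,4)] in blast)
  have with_chord: "path_image g \<inter> path_image c = {a, b}"
    if g: "pathstart g = a" "pathfinish g = b" "path_image g = \<Union> (curve G ` E)"
      and E: "E \<subseteq> edges G" "{a, b} \<notin> E" for g E
  proof (rule equalityI)
    show "path_image g \<inter> path_image c \<subseteq> {a, b}"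
      unfolding g(3) c(2) using curves_Int[OF pg E(1), of "{{a, b}}"] chord E(2) by simp
  qed (use ends[OF g(1,2)] ends[OF c(3,4)] in blast)
  have i1: "path_image c1 \<inter> path_image c = {a, b}"
    by (rule with_chord[OF c1(3,4,2) sub(1) chord_not_path(1)])
  have i2: "path_image c2 \<inter> path_image c = {a, b}"
    by (rule with_chord[OF c2(3,4,2) sub(2) chord_not_path(2)])
  have im: "path_image c1 \<union> path_image c = outline G L" "path_image c2 \<union> path_image c = outline G R"
    "path_image c1 \<union> path_image c2 = J"
    using c1 c2 c cycle_L cycle_R cycle_J by (auto simp: outline_def)
  have "path_image c - {a, b} \<subseteq> point_set G" using c chord by (auto simp: point_set_def)
  then have "path_image c - {a, b} \<subseteq> inside J" using D(7) i1 i2 im(3) by blast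
  moreover have "path_image c - {a, b} \<noteq> {}" using open_curve(2)[OF pg chord] c by simp
  ultimately have "path_image c \<inter> inside (path_image c1 \<union> path_image c2) \<noteq> {}" using im(3) by auto
  note split = split_inside_simple_closed_curve[OF arc_imp_simple_path[OF c1(1)] c1(3,4)
      arc_imp_simple_path[OF c2(1)] c2(3,4) arc_imp_simple_path[OF c(1)] c(3,4) distinct_ends i12 i1 i2 this, unfolded im, unfolded c(2)]
  show "inside (outline G L) \<inter> inside (outline G R) = {}" by (rule split)
  show "inside (outline G L) \<union> inside (outline G R) \<union> (curve G {a, b} - {a, b}) = inside J"
    by (rule split)
qed

lemma cycle_LR_edges: "cycle_edges L \<subseteq> edges G" "cycle_edges R \<subseteq> edges G"
  using cycle_L cycle_R cycle_J D(6) chord by auto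

lemma is_cycle_LR: "is_cycle G L" "is_cycle G R"
  using cycle_LR_edges D(3,5) nonempty by (auto simp: is_cycle_def Suc_le_eq)

lemmas LF = outline_facts[OF D(1) is_cycle_LR(1)] and RF = outline_facts[OF D(1) is_cycle_LR(2)]

lemma J_Un: "J \<subseteq> outline G L \<union> outline G R" "outline G L \<subseteq> J \<union> curve G {a, b}"
   "outline G R \<subseteq> J \<union> curve G {a, b}" "curve G {a, b} \<subseteq> outline G L" "curve G {a, b} \<subseteq> outline G R"
  using cycle_L cycle_R cycle_J by (auto simp: outline_def)

lemma vertices_not_inside: "verts G \<inter> inside J = {}"
  using cycle_vertices_on_outline[OF D(1,2)] inside_no_overlap[of J] unfolding D(3) by blast

lemma vertices_L: "verts G \<inter> (outline G L \<union> inside (outline G L)) = set L"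
  using vertices_on_outline[OF D(1) is_cycle_LR(1)] vertices_not_inside regions(2) by blast

lemma vertices_R: "verts G \<inter> (outline G R \<union> inside (outline G R)) = set R"
  using vertices_on_outline[OF D(1) is_cycle_LR(2)] vertices_not_inside regions(2) by blast

text \<open>
  An edge that is neither the chord nor a side has its open curve inside the outer cycle and off the
  chord, hence in one of the two regions; its ends are then vertices on the boundary of that region.
\<close>

lemma edge_side:
  assumes "f \<in> edges G"
  shows "f \<subseteq> set L \<and> curve G f \<subseteq> outline G L \<union> inside (outline G L) \<or>
    f \<subseteq> set R \<and> curve G f \<subseteq> outline G R \<union> inside (outline G R)"
proof -
  note pg = D(1)
  have f: "f \<subseteq> verts G" "f \<subseteq> curve G f"
    using plane_graphD(2)[OF pg assms] edge_subset_curve[OF pg assms] by auto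
  have "curve G f \<subseteq> outline G L \<union> inside (outline G L) \<or>
    curve G f \<subseteq> outline G R \<union> inside (outline G R)"
  proof (cases "f \<in> cycle_edges L \<union> cycle_edges R")
    case True
    then show ?thesis by (auto simp: outline_def)
  next
    case False
    have "(curve G f - f) \<inter> curve G e = {}" if "e \<in> cycle_edges L \<union> cycle_edges R" for e
    proof -
      have "e \<in> edges G" "e \<noteq> f" using that cycle_LR_edges False by auto
      then show ?thesis using plane_graphD(6)[OF pg assms, of e] by blast
    qed
    then have avoid: "(curve G f - f) \<inter> (outline G L \<union> outline G R) = {}"
      by (auto simp: outline_def)
    moreover have "curve G f \<subseteq> point_set G" using assms by (auto simp: point_set_def)
    ultimately have "curve G f - f \<subseteq> inside (outline G L) \<union> inside (outline G R)"
      using D(7) J_Un regions(2) by blast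
    then have "curve G f - f \<subseteq> inside (outline G L) \<or> curve G f - f \<subseteq> inside (outline G R)"
      using connectedD[OF open_curve(1)[OF pg assms] LF(1) RF(1)] regions(1) by blast
    then have "closure (curve G f - f) \<subseteq> closure (inside (outline G L)) \<or>
       closure (curve G f - f) \<subseteq> closure (inside (outline G R))"
      using closure_mono by metis
    moreover have "closure (inside (outline G K)) = outline G K \<union> inside (outline G K)"
      if "is_cycle G K" for K
      using outline_facts(9)[OF pg that] closure_Un_frontier[of "inside (outline G K)"] by auto
    ultimately show ?thesis using open_curve(3)[OF pg assms] is_cycle_LR by auto
  qed
  then show ?thesis using f vertices_L vertices_R by blast
qed

lemma edges_Un: "edges G = edges (induced G (set L)) \<union> edges (induced G (set R))"
  using edge_side by auto

lemma curve_L: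
  assumes "f \<in> edges G" "f \<subseteq> set L"
  shows "curve G f \<subseteq> outline G L \<union> inside (outline G L)"
proof (rule ccontr)
  assume not: "\<not> ?thesis"
  then have "f \<subseteq> set L \<inter> set R" using edge_side assms by auto
  also have "set L \<inter> set R = {a, b}" using D(5) by auto
  finally have "f = {a, b}"
    using plane_graphD(3)[OF D(1) assms(1)] distinct_ends by (intro card_subset_eq) auto
  then show False using not J_Un(4) by blast
qed

lemma outerplane_L: "outerplane (induced G (set L)) L"
proof -
  have "set L \<subseteq> outline G L" using cycle_vertices_on_outline[OF D(1) is_cycle_LR(1)] .
  then have "point_set (induced G (set L)) \<subseteq> outline G L \<union> inside (outline G L)"
    using curve_L by (auto simp: point_set_def)
  moreover have "set L \<subseteq> verts G" using D(3) by auto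
  moreover have "cycle_edges L \<subseteq> edges (induced G (set L))"
    using cycle_LR_edges(1) cycle_edges_subset[of _ L] by (simp add: subset_iff)
  ultimately show ?thesis
    using plane_graph_induced[OF D(1)] is_cycle_LR(1)
    by (auto simp: outerplane_def hamiltonian_cycle_def is_cycle_def)
qed

lemma point_set_L:
  "point_set G \<inter> inside (outline G L) = point_set (induced G (set L)) \<inter> inside (outline G L)"
proof (intro equalityI subsetI)
  fix z assume z: "z \<in> point_set G \<inter> inside (outline G L)"
  then have "z \<notin> verts G" using vertices_not_inside regions(2) by blast
  then obtain f where f: "f \<in> edges G" "z \<in> curve G f" using z by (auto simp: point_set_def)
  have "z \<notin> outline G R" "z \<notin> inside (outline G R)"
    using z regions J_Un(3,4) inside_no_overlap[of J] inside_no_overlap[of "outline G L"] by blast+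
  then have "f \<subseteq> set L" using edge_side[OF f(1)] f(2) by blast
  then show "z \<in> point_set (induced G (set L)) \<inter> inside (outline G L)"
    using f z by (auto simp: point_set_def)
next
  fix z assume "z \<in> point_set (induced G (set L)) \<inter> inside (outline G L)"
  then show "z \<in> point_set G \<inter> inside (outline G L)" using D(3) by (auto simp: point_set_def)
qed

lemma faces_L:
  assumes "F \<subseteq> inside (outline G L)"
  shows "F \<in> faces G \<longleftrightarrow> F \<in> faces (induced G (set L))"
proof -
  have "outline G L \<subseteq> point_set G" using cycle_LR_edges by (auto simp: outline_def point_set_def)
  moreover have "outline G L \<subseteq> point_set (induced G (set L))"
    using outerplaneD(8)[OF outerplane_L] by simp
  ultimately show ?thesis
    unfolding faces_def using LF(9) by (intro components_local[OF point_set_L _ _ assms]) simp_all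
qed

lemma bounded_by_cycle_L:
  assumes "F \<subseteq> inside (outline G L)"
  shows "bounded_by_cycle G F ts \<longleftrightarrow> bounded_by_cycle (induced G (set L)) F ts"
proof
  assume b: "bounded_by_cycle G F ts"
  then have ts: "ts \<noteq> []" "cycle_edges ts \<subseteq> edges G" and fr: "frontier F = \<Union> (curve G ` cycle_edges ts)"
    by (auto simp: bounded_by_cycle_def is_cycle_def)
  have "frontier F \<subseteq> closure (inside (outline G L))"
    using closure_mono[OF assms] by (auto simp: frontier_def)
  also have "\<dots> = outline G L \<union> inside (outline G L)"
    using LF(9) closure_Un_frontier[of "inside (outline G L)"] by auto
  finally have "curve G e \<subseteq> outline G L \<union> inside (outline G L)" if "e \<in> cycle_edges ts" for e
    using that fr by auto
  then have e: "e \<subseteq> set L" if "e \<in> cycle_edges ts" for e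
    using that ts(2) edge_subset_curve[OF D(1), of e] plane_graphD(2)[OF D(1), of e] vertices_L by blast
  then have "set ts \<subseteq> set L" using cycle_vertices_covered[OF ts(1)] by blast
  then show "bounded_by_cycle (induced G (set L)) F ts"
    using b e by (auto simp: bounded_by_cycle_def is_cycle_def)
next
  have "set L \<subseteq> verts G" using D(3) by auto
  then show "bounded_by_cycle (induced G (set L)) F ts \<Longrightarrow> bounded_by_cycle G F ts"
    by (auto simp: bounded_by_cycle_def is_cycle_def)
qed

lemma triangular_faces_L:
  "triangular_faces (induced G (set L)) L \<longleftrightarrow> (\<forall>F\<in>faces G. F \<subseteq> inside (outline G L) \<longrightarrow>
     (\<exists>ts. length ts = 3 \<and> bounded_by_cycle G F ts))"
  unfolding triangular_faces_def outline_induced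
  using faces_L bounded_by_cycle_L by blast

end

lemma chord_flip:
  assumes "chord G a b us ws"
  shows "chord G b a ws us"
proof -
  interpret chord G a b us ws by fact
  show ?thesis
    by (unfold_locales) (use outerplane_rotate(1)[of G "a # us" "b # ws"] disc nonempty chord in
        \<open>simp_all add: insert_commute\<close>)
qed

theorem chord_split:
  assumes "chord G a b us ws"
  shows "outerplane (induced G (set (a # us @ [b]))) (a # us @ [b])"
    "outerplane (induced G (set (b # ws @ [a]))) (b # ws @ [a])"
    "edges G = edges (induced G (set (a # us @ [b]))) \<union> edges (induced G (set (b # ws @ [a])))"
    "inside (outline G (b # ws @ [a])) \<subseteq> inside (outline G (a # us @ b # ws))"
    "triangular_faces G (a # us @ b # ws) \<longleftrightarrow>
       triangular_faces (induced G (set (a # us @ [b]))) (a # us @ [b]) \<and>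
       triangular_faces (induced G (set (b # ws @ [a]))) (b # ws @ [a])"
proof -
  interpret c: chord G a b us ws by fact
  interpret d: chord G b a ws us by (rule chord_flip[OF assms])
  show "outerplane (induced G (set c.L)) c.L" "outerplane (induced G (set c.R)) c.R"
    using c.outerplane_L d.outerplane_L .
  show "edges G = edges (induced G (set c.L)) \<union> edges (induced G (set c.R))" by (rule c.edges_Un)
  show "inside (outline G c.R) \<subseteq> inside c.J" using c.regions by blast
  have "F \<subseteq> inside c.J \<longleftrightarrow> F \<subseteq> inside (outline G c.L) \<or> F \<subseteq> inside (outline G c.R)"
    if F: "F \<in> faces G" for F
  proof
    assume "F \<subseteq> inside c.J"
    moreover have "F \<subseteq> - point_set G" "connected F"
      using F in_components_subset in_components_connected unfolding faces_def by blast+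
    moreover have "curve G {a, b} \<subseteq> point_set G" using c.chord by (auto simp: point_set_def)
    ultimately have "F \<subseteq> inside (outline G c.L) \<union> inside (outline G c.R)"
      using c.regions(2) by blast
    then show "F \<subseteq> inside (outline G c.L) \<or> F \<subseteq> inside (outline G c.R)"
      using connectedD[OF \<open>connected F\<close> c.LF(1) c.RF(1)] c.regions(1) by blast
  next
    assume "F \<subseteq> inside (outline G c.L) \<or> F \<subseteq> inside (outline G c.R)"
    then show "F \<subseteq> inside c.J" using c.regions(2) by blast
  qed
  then show "triangular_faces G (a # us @ b # ws) \<longleftrightarrow>
       triangular_faces (induced G (set c.L)) c.L \<and> triangular_faces (induced G (set c.R)) c.R"
    unfolding c.triangular_faces_L d.triangular_faces_L unfolding triangular_faces_def by blast
qed

section \<open>Mops are the outerplane drawings of polygon triangulations\<close>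

lemma doubleton_subset_eq: "card e = 2 \<Longrightarrow> e \<subseteq> {x, y} \<Longrightarrow> e = {x, y}"
  by (rule card_subset_eq) (auto dest: card_mono[rotated] simp: card_insert_if split: if_splits)

text \<open>
  Without chords the drawing is just a Jordan curve, and its interior is the only bounded face.
\<close>

lemma inner_face_without_chords:
  assumes "outerplane G xs" "edges G = cycle_edges xs"
  shows "F \<in> faces G \<and> F \<subseteq> inside (outline G xs) \<longleftrightarrow> F = inside (outline G xs)"
proof -
  let ?J = "outline G xs"
  note D = outerplaneD[OF assms(1)] and O = outline_facts[OF outerplaneD(1,2)[OF assms(1)]]
  have P: "point_set G = ?J"
    using cycle_vertices_on_outline[OF D(1,2)] D(3) assms(2) by (auto simp: point_set_def outline_def)
  have I: "inside ?J \<in> components (- ?J)" using O(2,3) by (simp add: inside_in_components)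
  show ?thesis
  proof
    assume F: "F \<in> faces G \<and> F \<subseteq> inside ?J"
    then have "F \<in> components (- ?J)" by (simp add: faces_def P)
    moreover have "F \<inter> inside ?J \<noteq> {}" using F in_components_nonempty unfolding faces_def by blast
    ultimately show "F = inside ?J" using components_eq[OF _ I] by blast
  qed (use I P in \<open>simp add: faces_def\<close>)
qed

text \<open>
  The only bounded face has the outer cycle as its frontier and is bounded by a 3-cycle; since
  different edges have different curves, the two cycles have the same edges.
\<close>

lemma no_chords_imp_triangle:
  assumes "outerplane G xs" "triangular_faces G xs" "edges G = cycle_edges xs"
  shows "length xs = 3"
proof -
  let ?J = "outline G xs"
  note D = outerplaneD[OF assms(1)] and O = outline_facts[OF outerplaneD(1,2)[OF assms(1)]]
  have "inside ?J \<in> faces G"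
    using inner_face_without_chords[OF assms(1,3)] by blast
  then obtain ts where ts: "length ts = 3" "bounded_by_cycle G (inside ?J) ts"
    using assms(2) unfolding triangular_faces_def by blast
  then have cyc: "is_cycle G ts" and J: "?J = \<Union> (curve G ` cycle_edges ts)"
    using O(9) by (auto simp: bounded_by_cycle_def)
  have sub: "cycle_edges ts \<subseteq> edges G" using cyc by (simp add: is_cycle_def)
  have "e \<in> cycle_edges ts" if e: "e \<in> cycle_edges xs" for e
  proof -
    have eG: "e \<in> edges G" using e D(6) by blast
    obtain z where z: "z \<in> curve G e - e" using open_curve(2)[OF D(1) eG] by blast
    then have "z \<in> ?J" using e by (auto simp: outline_def)
    then obtain f where f: "f \<in> cycle_edges ts" "z \<in> curve G f" using J by blast
    then have "f \<in> edges G" using sub by blast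
    then have "f = e" using plane_graphD(6)[OF D(1) eG, of f] z f(2) by blast
    then show ?thesis using f by simp
  qed
  then have "cycle_edges ts = cycle_edges xs" using sub assms(3) by blast
  moreover have "card (cycle_edges ts) = 3" "card (cycle_edges xs) = length xs"
    using card_cycle_edges[of ts] card_cycle_edges[of xs] cyc D(4,5) ts(1) by (auto simp: is_cycle_def)
  ultimately show ?thesis by simp
qed

lemma triangle_cycle_triangulated:
  assumes "distinct [a, b, c]"
  shows "triangulated [a, b, c] (cycle_edges [a, b, c])"
  using triangle_triangulated[OF assms] by (simp add: cycle_edges_conv insert_commute)

lemma split_at_two:
  assumes "p \<in> set xs" "q \<in> set xs" "p \<noteq> q"
  obtains A B C where "xs = A @ p # B @ q # C" | A B C where "xs = A @ q # B @ p # C"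
proof -
  obtain A R where AR: "xs = A @ p # R" using split_list[OF assms(1)] by blast
  then consider "q \<in> set R" | "q \<in> set A" using assms by auto
  then show thesis
  proof cases
    case 1
    then obtain B C where "R = B @ q # C" by (auto dest: split_list)
    then show thesis using that(1) AR by simp
  next
    case 2
    then obtain B C where "A = B @ q # C" by (auto dest: split_list)
    then show thesis using that(2)[of B C R] AR by simp
  qed
qed

text \<open>
  Either there is no chord and the polygon is a triangle, or any chord cuts the drawing into two
  smaller ones, whose triangulations are recombined by \<open>triangulated_subst\<close>.
\<close>

theorem outerplane_triangulated:
  assumes "outerplane G xs" "triangular_faces G xs"
  shows "triangulated xs (edges G)"
  using assms
proof (induction "length xs" arbitrary: G xs rule: less_induct)
  case less
  note D = outerplaneD[OF less.prems(1)]
  show ?case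
  proof (cases "edges G = cycle_edges xs")
    case True
    then have "length xs = 3" using no_chords_imp_triangle less.prems by blast
    then obtain a b c where "xs = [a, b, c]" by (auto simp: length_Suc_conv eval_nat_numeral)
    then show ?thesis using triangle_cycle_triangulated[of a b c] D(5) True by simp
  next
    case False
    then obtain e where e: "e \<in> edges G" "e \<notin> cycle_edges xs" using D(6) by blast
    then have "card e = 2" "e \<subseteq> set xs" using plane_graphD(2,3)[OF D(1)] D(3) by simp_all
    then obtain p0 q0 where "e = {p0, q0}" "p0 \<noteq> q0" "p0 \<in> set xs" "q0 \<in> set xs"
      by (auto simp: card_2_iff)
    \<comment> \<open>The two ends of the chord are named in the order in which the list visits them.\<close>
    then obtain p q A B C where xs: "xs = A @ p # B @ q # C" and pq: "e = {p, q}"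
      using split_at_two[of p0 xs q0 thesis] by (metis insert_commute)
    have "B \<noteq> []"
    proof
      assume "B = []"
      then have "{p, q} \<in> path_edges xs" using path_edges_append[of A p "q # C"] xs by simp
      then show False using e pq cycle_edges_conv[of xs] xs by simp
    qed
    moreover have "C @ A \<noteq> []"
    proof
      assume "C @ A = []"
      then have "{last xs, hd xs} = {p, q}" using xs by auto
      then show False using e pq cycle_edges_conv[of xs] xs by simp
    qed
    moreover have xs': "outerplane G (p # B @ q # (C @ A))" "triangular_faces G (p # B @ q # (C @ A))"
      using outerplane_rotate[of G A "p # B @ q # C"] less.prems xs by simp_all
    ultimately have ch: "chord G p q B (C @ A)" using e pq by unfold_locales simp_all
    define G1 where "G1 = induced G (set (p # B @ [q]))"
    define G2 where "G2 = induced G (set (q # (C @ A) @ [p]))"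
    note S = chord_split[OF ch, folded G1_def G2_def]
    have len: "length (p # B @ [q]) < length xs" "length (A @ [p] @ q # C) < length xs"
      using xs \<open>B \<noteq> []\<close> \<open>C @ A \<noteq> []\<close> by auto
    have t1: "triangulated (p # B @ [q]) (edges G1)"
      using less.hyps[OF len(1) S(1)] S(5) xs'(2) by blast
    have "q # (C @ A) @ [p] = (q # C) @ (A @ [p])" by simp
    then have "outerplane G2 ((q # C) @ (A @ [p]))" "triangular_faces G2 ((q # C) @ (A @ [p]))"
      using S(2,5) xs'(2) by metis+
    then have "outerplane G2 (A @ [p] @ q # C)" "triangular_faces G2 (A @ [p] @ q # C)"
      using outerplane_rotate[of G2 "q # C" "A @ [p]"] by simp_all
    then have t2: "triangulated (A @ [p] @ q # C) (edges G2)" by (rule less.hyps[OF len(2)])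
    have "triangulated (A @ p # B @ q # C) (edges G1 \<union> edges G2)"
      using triangulated_subst[OF t2 _ t1] D(5) xs by simp
    then show ?thesis using S(3) xs by simp
  qed
qed

text \<open>
  The next three lemmas compute the edges that remain in each half when the polygon is cut along a side of
  its base triangle. An edge of the other half would have to lie in the overlap of the two vertex
  lists, which has too few elements.
\<close>

lemma glue_restrict_left:
  assumes "triangulated (a # us @ [v]) E\<^sub>1" "triangulated (v # ws @ [b]) E\<^sub>2"
    "distinct (a # us @ v # ws @ [b])"
  shows "{e \<in> insert {a, b} (E\<^sub>1 \<union> E\<^sub>2). e \<subseteq> set (a # us @ [v])} = E\<^sub>1"
proof -
  have "\<not> e \<subseteq> set (a # us @ [v])" if "e \<in> E\<^sub>2" for e
  proof
    assume "e \<subseteq> set (a # us @ [v])"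
    then have "e \<subseteq> {v, v}" using triangulated_edge[OF assms(2) that] assms(3) by auto
    then have "card e \<le> card {v, v}" by (intro card_mono) auto
    then show False using triangulated_edge[OF assms(2) that] by simp
  qed
  moreover have "\<not> {a, b} \<subseteq> set (a # us @ [v])" using assms(3) by auto
  ultimately show ?thesis using triangulated_edge[OF assms(1)] by blast
qed

lemma glue_restrict_right:
  assumes "triangulated (a # us @ [v]) E\<^sub>1" "triangulated (v # ws @ [b]) E\<^sub>2"
    "distinct (a # us @ v # ws @ [b])"
  shows "{e \<in> insert {a, b} (E\<^sub>1 \<union> E\<^sub>2). e \<subseteq> set (v # ws @ [b])} = E\<^sub>2"
proof -
  have "\<not> e \<subseteq> set (v # ws @ [b])" if "e \<in> E\<^sub>1" for e
  proof
    assume "e \<subseteq> set (v # ws @ [b])"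
    then have "e \<subseteq> {v, v}" using triangulated_edge[OF assms(1) that] assms(3) by auto
    then have "card e \<le> card {v, v}" by (intro card_mono) auto
    then show False using triangulated_edge[OF assms(1) that] by simp
  qed
  moreover have "\<not> {a, b} \<subseteq> set (v # ws @ [b])" using assms(3) by auto
  ultimately show ?thesis using triangulated_edge[OF assms(2)] by blast
qed

lemma glue_restrict_collapse_left:
  assumes "triangulated (a # us @ [v]) E\<^sub>1" "triangulated (v # ws @ [b]) E\<^sub>2"
    "distinct (a # us @ v # ws @ [b])"
  shows "{e \<in> insert {a, b} (E\<^sub>1 \<union> E\<^sub>2). e \<subseteq> set (a # v # ws @ [b])} = insert {a, b} ({{a, v}} \<union> E\<^sub>2)"
proof -
  have 1: "e = {a, v}" if "e \<in> E\<^sub>1" "e \<subseteq> set (a # v # ws @ [b])" for e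
  proof (rule doubleton_subset_eq)
    show "e \<subseteq> {a, v}" using triangulated_edge[OF assms(1) that(1)] that(2) assms(3) by auto
  qed (use triangulated_edge[OF assms(1) that(1)] in simp)
  have 2: "{a, v} \<in> E\<^sub>1" using triangulated_base[OF assms(1)] by simp
  have 3: "e \<subseteq> set (a # v # ws @ [b])" if "e \<in> insert {a, b} ({{a, v}} \<union> E\<^sub>2)" for e
    using that triangulated_edge[OF assms(2), of e] by auto
  show ?thesis
  proof (intro equalityI subsetI)
    fix e assume "e \<in> {e \<in> insert {a, b} (E\<^sub>1 \<union> E\<^sub>2). e \<subseteq> set (a # v # ws @ [b])}"
    then show "e \<in> insert {a, b} ({{a, v}} \<union> E\<^sub>2)" using 1[of e] by blast
  next
    fix e assume e: "e \<in> insert {a, b} ({{a, v}} \<union> E\<^sub>2)"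
    then show "e \<in> {e \<in> insert {a, b} (E\<^sub>1 \<union> E\<^sub>2). e \<subseteq> set (a # v # ws @ [b])}"
      using 2 3[OF e] by blast
  qed
qed

text \<open>
  The base triangle with corners \<open>a\<close>, \<open>v\<close>, \<open>b\<close> has at least one side that is a chord unless it is the
  whole polygon. Cutting along such a side leaves two smaller triangulated polygons.
\<close>

theorem triangulated_triangular_faces:
  assumes "outerplane G xs" "triangulated xs (edges G)"
  shows "triangular_faces G xs"
  using assms
proof (induction "length xs" arbitrary: G xs rule: less_induct)
  case less
  note D = outerplaneD[OF less.prems(1)]
  from less.prems(2) show ?case
  proof cases
    case (edge a b)
    then show ?thesis using D(4) by simp
  next
    case (glue a us v E1 ws b E2)
    note R = glue_restrict_left[OF glue(3-5)] glue_restrict_right[OF glue(3-5)]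
      glue_restrict_collapse_left[OF glue(3-5)]
    have av: "{a, v} \<in> edges G" "{v, b} \<in> edges G"
      using triangulated_base[OF glue(3)] triangulated_base[OF glue(4)] glue(2) by auto
    consider "us \<noteq> []" | "us = []" "ws \<noteq> []" | "us = []" "ws = []" by blast
    then show ?thesis
    proof cases
      case 1
      then have ch: "chord G a v us (ws @ [b])"
        using less.prems(1) av glue(1) by unfold_locales simp_all
      note S = chord_split[OF ch]
      let ?G1 = "induced G (set (a # us @ [v]))" and ?G2 = "induced G (set (v # (ws @ [b]) @ [a]))"
      have "triangular_faces ?G1 (a # us @ [v])"
        using S(1) R(1) glue(1-3) by (intro less.hyps) simp_all
      moreover have "triangular_faces ?G2 ([a] @ v # ws @ [b])"
      proof (rule less.hyps)
        show "length ([a] @ v # ws @ [b]) < length xs" using glue(1) 1 by simp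
        show "outerplane ?G2 ([a] @ v # ws @ [b])"
          using outerplane_rotate(1)[of ?G2 "v # ws @ [b]" "[a]"] S(2) by simp
        have "edges ?G2 = insert {a, b} ({{a, v}} \<union> E2)"
          using R(3) glue(2) by (simp add: insert_commute)
        moreover have "triangulated (a # [] @ v # ws @ [b]) (insert {a, b} ({{a, v}} \<union> E2))"
          using glue(4,5) by (intro triangulated.glue) (auto intro: triangulated.edge)
        ultimately show "triangulated ([a] @ v # ws @ [b]) (edges ?G2)" by simp
      qed
      then have "triangular_faces ?G2 (v # (ws @ [b]) @ [a])"
        using outerplane_rotate(3)[of ?G2 "v # ws @ [b]" "[a]"] S(2) by simp
      ultimately show ?thesis using S(5) glue(1) by simp
    next
      case 2
      have rot: "outerplane G (v # ws @ b # [a])" "triangular_faces G (v # ws @ b # [a]) \<longleftrightarrow> triangular_faces G xs"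
        using outerplane_rotate[of G "[a]" "v # ws @ [b]"] less.prems(1) glue(1) 2 by simp_all
      then have ch: "chord G v b ws [a]" using av 2 by unfold_locales simp_all
      note S = chord_split[OF ch]
      let ?G1 = "induced G (set (v # ws @ [b]))" and ?G2 = "induced G (set (b # [a] @ [v]))"
      have "triangular_faces ?G1 (v # ws @ [b])"
        using S(1) R(2) glue(1,2,4) by (intro less.hyps) simp_all
      moreover have "triangular_faces ?G2 [b, a, v]"
      proof (rule less.hyps)
        show "length [b, a, v] < length xs" using glue(1) 2 by simp
        show out: "outerplane ?G2 [b, a, v]" using S(2) by simp
        have "e \<in> cycle_edges [b, a, v]" if "e \<in> edges ?G2" for e
        proof -
          have "card e = 2" "e \<subseteq> {b, a, v}"
            using that plane_graphD(3)[OF D(1)] by auto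
          then have "e = {b, a} \<or> e = {a, v} \<or> e = {v, b}"
            by (auto simp: card_2_iff)
          then show ?thesis by (auto simp: cycle_edges_conv insert_commute)
        qed
        then have "edges ?G2 = cycle_edges [b, a, v]" using outerplaneD(6)[OF out] by blast
        then show "triangulated [b, a, v] (edges ?G2)"
          using triangle_cycle_triangulated[of b a v] outerplaneD(5)[OF out] by simp
      qed
      ultimately show ?thesis using S(5) rot by simp
    next
      case 3
      have "E1 = {{a, v}}" "E2 = {{v, b}}"
        using glue(3,4) 3 by (auto elim: triangulated.cases simp: Cons_eq_append_conv)
      then have "edges G = cycle_edges xs"
        using glue(1,2) 3 by (auto simp: cycle_edges_conv insert_commute)
      moreover note inner_face_without_chords[OF less.prems(1) this]
      ultimately show ?thesis
        using outline_facts(9)[OF D(1,2)] D(2) glue(1) 3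
        unfolding triangular_faces_def bounded_by_cycle_def outline_def
        by (metis One_nat_def append_Nil length_Cons list.size(3) numeral_3_eq_3)
    qed
  qed
qed

section \<open>Removing ears\<close>

definition mop_along :: "drawn_graph \<Rightarrow> complex list \<Rightarrow> bool" where
  "mop_along G xs \<longleftrightarrow> outerplane G xs \<and> triangular_faces G xs"

lemma mop_iff_mop_along: "mop G \<longleftrightarrow> (\<exists>xs. mop_along G xs)"
  by (simp add: mop_along_def mop_iff_outerplane)

lemma mop_along_rotate: "mop_along G (us @ vs) \<Longrightarrow> mop_along G (vs @ us)"
  using outerplane_rotate by (auto simp: mop_along_def)

lemma mop_along_triangulated: "mop_along G xs \<Longrightarrow> triangulated xs (edges G)"
  by (simp add: mop_along_def outerplane_triangulated)

lemma nbrs_eq_nb: "nbrs G v = nb (edges G) v"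
  by (simp add: nbrs_def nb_def)

lemma card_verts:
  assumes "outerplane G xs"
  shows "card (verts G) = length xs"
  using outerplaneD(3,5)[OF assms] distinct_card by metis

lemma mop_along_nbrs:
  assumes "mop_along G xs"
  shows "nbrs G v \<subseteq> verts G - {v}" "finite (nbrs G v)"
  using triangulated_nb[OF mop_along_triangulated[OF assms]] finite_nb[OF mop_along_triangulated[OF assms]]
    outerplaneD(3)[of G xs] assms by (auto simp: nbrs_eq_nb mop_along_def)

lemma filter_neq:
  assumes "distinct (A @ y # C)"
  shows "filter (\<lambda>x. x \<noteq> y) (A @ y # C) = A @ C"
proof -
  have "filter (\<lambda>x. x \<noteq> y) A = A" "filter (\<lambda>x. x \<noteq> y) C = C"
    by (rule filter_True, use assms in auto)+
  then show ?thesis by simp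
qed

text \<open>
  With the cycle rotated to \<open>p, y, q, \<dots>\<close> the neighbours \<open>p\<close>, \<open>q\<close> of \<open>y\<close> are adjacent, and \<open>{p, q}\<close> is a
  chord because there are at least four vertices. One half of the cut is the triangle \<open>p, y, q\<close>; the other is
  the graph without \<open>y\<close>, in which \<open>{p, q}\<close> has become a side. The vertex \<open>y\<close> lies on the old outer
  cycle, so not inside the new one.
\<close>

lemma ear_removal:
  assumes "mop_along G xs" "4 \<le> length xs" "y \<in> set xs" "vertex_degree G y = 2"
  shows "mop_along (induced G (verts G - {y})) (filter (\<lambda>x. x \<noteq> y) xs)"
    and "nbrs G y \<in> cycle_edges (filter (\<lambda>x. x \<noteq> y) xs)"
    and "nbrs G y \<notin> cycle_edges xs"
    and "y \<in> exterior_face (induced G (verts G - {y}))"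
    and "\<And>x. x \<in> nbrs G y \<Longrightarrow> 3 \<le> vertex_degree G x"
proof -
  let ?ys = "filter (\<lambda>x. x \<noteq> y) xs"
  note out = assms(1)[unfolded mop_along_def, THEN conjunct1]
  note D = outerplaneD[OF out]
  obtain A C where xs: "xs = A @ y # C" using split_list[OF assms(3)] by blast
  have ys: "?ys = A @ C" using D(5) xs filter_neq[of A y C] by simp
  obtain q D' p where zs: "C @ A = q # D' @ [p]" and D': "D' \<noteq> []"
  proof -
    obtain q R where 1: "C @ A = q # R" using assms(2) xs by (cases "C @ A") auto
    moreover have "length R \<ge> 2" using arg_cong[OF 1, of length] assms(2) xs by simp
    moreover then obtain D' p where "R = D' @ [p]" by (cases R rule: rev_cases) auto
    ultimately show thesis using that by (cases D') auto
  qed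
  have "y # C @ A = (y # C) @ A" by simp
  then have "mop_along G (y # C @ A)" using mop_along_rotate[of G A "y # C"] assms(1) xs by simp
  then have m: "mop_along G (p # y # q # D')"
    using mop_along_rotate[of G "y # q # D'" "[p]"] zs by simp
  note t = mop_along_triangulated[OF m]
  have outm: "outerplane G (p # y # q # D')" using m by (simp add: mop_along_def)
  note Dm = outerplaneD[OF outm]
  have ce: "cycle_edges xs = cycle_edges (p # y # q # D')"
    using cycle_edges_append_commute[of A "y # C"] cycle_edges_append_commute[of "y # q # D'" "[p]"] xs zs
    by simp
  have deg: "card (nb (edges G) y) = 2" using assms(4) by (simp add: vertex_degree_def nbrs_eq_nb)
  have pq: "{p, q} \<in> edges G" using triangulated_ear[OF t _ deg, of "[]" p q D'] by simp
  have path: "{p, y} \<in> edges G" "{y, q} \<in> edges G" "{last D', p} \<in> edges G" "{q, hd D'} \<in> edges G"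
    using Dm(6) D' by (auto simp: cycle_edges_conv neq_Nil_conv)
  have nb: "nbrs G y = {p, q}"
  proof (rule sym, rule card_subset_eq)
    show "finite (nbrs G y)" by (rule mop_along_nbrs[OF assms(1)])
    show "{p, q} \<subseteq> nbrs G y" using path by (auto simp: nbrs_def insert_commute)
    show "card {p, q} = card (nbrs G y)" using Dm(5) assms(4) by (simp add: vertex_degree_def)
  qed
  have ch: "chord G p q [y] D'"
    using outm pq D' by unfold_locales simp_all
  have V: "set (q # D' @ [p]) = verts G - {y}" using Dm(3,5) by auto
  note S = chord_split[OF ch, unfolded V]
  let ?G = "induced G (verts G - {y})"
  have "mop_along ?G (C @ A)" using S(2,5) m unfolding zs mop_along_def by simp
  then show my: "mop_along ?G ?ys" using mop_along_rotate ys by simp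
  have "{p, q} \<in> cycle_edges (C @ A)" unfolding zs by (simp add: cycle_edges_conv)
  then show "nbrs G y \<in> cycle_edges ?ys"
    using nb ys cycle_edges_append_commute[of A C] by simp
  show "nbrs G y \<notin> cycle_edges xs"
  proof
    assume "nbrs G y \<in> cycle_edges xs"
    moreover have "last D' \<in> set D'" "hd D' \<in> set D'" using D' by simp_all
    ultimately have "{p, q} \<in> path_edges D'"
      using Dm(5) D' unfolding ce nb by (auto simp: cycle_edges_conv doubleton_eq_iff neq_Nil_conv split: if_splits)
    then show False using path_edges_subset Dm(5) by fastforce
  qed
  have J: "outline ?G ?ys = outline G (q # D' @ [p])"
    using ys zs cycle_edges_append_commute[of A C] by (simp add: outline_def)
  have "verts G \<inter> outline G (q # D' @ [p]) = set (q # D' @ [p])"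
    using chord.is_cycle_LR(2)[OF ch] by (rule vertices_on_outline[OF D(1)])
  moreover have "y \<in> verts G" using Dm(3) by auto
  ultimately have "y \<notin> outline G (q # D' @ [p])" using Dm(5) by auto
  moreover have "y \<notin> inside (outline G (q # D' @ [p]))"
    using S(4) chord.vertices_not_inside[OF ch] \<open>y \<in> verts G\<close> by auto
  ultimately have "y \<in> outside (outline ?G ?ys)"
    unfolding J outside_inside by blast
  then show "y \<in> exterior_face ?G"
    using my exterior_face_outerplane[of ?G ?ys] by (simp add: mop_along_def)
  have "3 \<le> vertex_degree G x" if "{u, v, w} \<subseteq> nbrs G x" "distinct [u, v, w]" for x u v w
    using card_mono[OF mop_along_nbrs(2)[OF assms(1)] that(1)] that(2) by (simp add: vertex_degree_def)
  note three = this
  have "{y, q, last D'} \<subseteq> nbrs G p" "{y, p, hd D'} \<subseteq> nbrs G q"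
    using path pq by (auto simp: nbrs_def insert_commute)
  moreover have "distinct [y, q, last D']" "distinct [y, p, hd D']"
    using Dm(5) D' last_in_set[OF D'] hd_in_set[OF D'] by auto
  ultimately show "3 \<le> vertex_degree G x" if "x \<in> nbrs G y" for x
    using that three unfolding nb by blast
qed

lemma cycle_edges_filter:
  assumes "e \<in> cycle_edges xs" "y \<notin> e" "distinct xs"
  shows "e \<in> cycle_edges (filter (\<lambda>x. x \<noteq> y) xs)"
proof (cases "y \<in> set xs")
  case True
  then obtain A C where xs: "xs = A @ y # C" using split_list by metis
  have ys: "filter (\<lambda>x. x \<noteq> y) xs = A @ C" using assms(3) xs filter_neq[of A y C] by simp
  have "e \<in> cycle_edges (y # C @ A)" using assms(1) cycle_edges_append_commute[of A "y # C"] xs by simp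
  then have "e \<in> path_edges (C @ A)"
    using assms(2) by (cases "C @ A") (auto simp: cycle_edges_conv split: if_splits)
  then have "e \<in> cycle_edges (C @ A)" by (cases "C @ A = []") (auto simp: cycle_edges_conv)
  then show ?thesis using ys cycle_edges_append_commute[of A C] by simp
next
  case False
  then have "filter (\<lambda>x. x \<noteq> y) xs = xs" by (auto simp: filter_id_conv)
  then show ?thesis using assms(1) by simp
qed

lemma exterior_face_mono:
  assumes "plane_graph G" "W \<subseteq> verts G"
  shows "exterior_face G \<subseteq> exterior_face (induced G W)"
  unfolding exterior_face_eq_outside[OF assms(1)] exterior_face_eq_outside[OF plane_graph_induced[OF assms]]
  by (rule outside_mono) (use assms(2) in \<open>auto simp: point_set_def\<close>)

definition ears :: "drawn_graph \<Rightarrow> complex set" where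
  "ears G = {v \<in> verts G. vertex_degree G v = 2}"

lemma nbrs_ear:
  assumes "mop_along G xs" "4 \<le> length xs" "y \<in> ears G"
  shows "nbrs G y \<subseteq> verts G - ears G" "card (nbrs G y) = 2" "nbrs G y \<in> edges G"
proof -
  have y: "y \<in> set xs" "vertex_degree G y = 2"
    using assms(1,3) outerplaneD(3)[of G xs] by (auto simp: ears_def mop_along_def)
  note R = ear_removal[OF assms(1,2) y]
  show "nbrs G y \<subseteq> verts G - ears G"
    using R(5) mop_along_nbrs(1)[OF assms(1), of y] by (fastforce simp: ears_def)
  show "card (nbrs G y) = 2" using y(2) by (simp add: vertex_degree_def)
  show "nbrs G y \<in> edges G" using R(1,2) outerplaneD(6) by (fastforce simp: mop_along_def)
qed

lemma nbrs_induced: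
  assumes "y \<in> W" "nbrs G y \<subseteq> W"
  shows "nbrs (induced G W) y = nbrs G y"
  using assms by (auto simp: nbrs_def)

text \<open>
  Neighbours of an ear have degree at least 3, so ears are not adjacent and the remaining ears
  keep their two neighbours when others are deleted. The side that a deleted ear leaves behind
  survives later deletions because it contains no ear.
\<close>

lemma ears_removal:
  assumes "mop_along G xs" "4 \<le> length xs" "Y \<subseteq> ears G" "3 \<le> card (verts G - Y)"
  shows "mop_along (induced G (verts G - Y)) (filter (\<lambda>x. x \<notin> Y) xs) \<and>
    (\<forall>y\<in>Y. y \<in> exterior_face (induced G (verts G - Y)) \<and>
       nbrs G y \<in> cycle_edges (filter (\<lambda>x. x \<notin> Y) xs))"
proof -
  note D = outerplaneD[OF assms(1)[unfolded mop_along_def, THEN conjunct1]]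
  have "finite Y" using assms(3) plane_graphD(1)[OF D(1)] by (auto simp: ears_def intro: finite_subset)
  then show ?thesis using assms(3,4)
  proof (induction Y rule: finite_induct)
    case empty
    have "\<forall>e\<in>edges G. e \<subseteq> verts G" using plane_graphD(2)[OF D(1)] by blast
    then have "{e \<in> edges G. e \<subseteq> verts G} = edges G" by blast
    then have "induced G (verts G) = G" by (simp add: induced_def)
    then show ?case using assms(1) by simp
  next
    case (insert y Y)
    let ?M = "induced G (verts G - Y)" and ?zs = "filter (\<lambda>x. x \<notin> Y) xs"
    let ?M' = "induced G (verts G - insert y Y)" and ?zs' = "filter (\<lambda>x. x \<notin> insert y Y) xs"
    have fin: "finite (verts G)" by (rule plane_graphD(1)[OF D(1)])
    have y: "y \<in> verts G" "y \<in> ears G" using insert.prems by (auto simp: ears_def)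
    have c: "card (verts G - Y) = Suc (card (verts G - insert y Y))"
    proof -
      have "card (insert y (verts G - insert y Y)) = Suc (card (verts G - insert y Y))"
        using fin by (intro card_insert_disjoint) auto
      moreover have "insert y (verts G - insert y Y) = verts G - Y" using y insert.hyps by auto
      ultimately show ?thesis by argo
    qed
    then have IH: "mop_along ?M ?zs" "\<And>z. z \<in> Y \<Longrightarrow> z \<in> exterior_face ?M \<and> nbrs G z \<in> cycle_edges ?zs"
      using insert.IH insert.prems by auto
    have len: "4 \<le> length ?zs"
      using card_verts[of ?M ?zs] IH(1) c insert.prems(2) by (simp add: mop_along_def)
    have "nbrs ?M y = nbrs G y"
      using nbrs_ear(1)[OF assms(1,2) y(2)] insert.prems(1) insert.hyps y by (intro nbrs_induced) auto
    moreover then have "vertex_degree ?M y = 2"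
      using nbrs_ear(2)[OF assms(1,2) y(2)] by (simp add: vertex_degree_def)
    moreover have "y \<in> set ?zs" using D(3) y insert.hyps by auto
    moreover have MM: "induced ?M (verts ?M - {y}) = ?M'"
      by (auto simp: induced_def)
    moreover have zz: "filter (\<lambda>x. x \<noteq> y) ?zs = ?zs'"
      by (simp, rule filter_cong) auto
    ultimately have R: "mop_along ?M' ?zs'" "nbrs G y \<in> cycle_edges ?zs'" "y \<in> exterior_face ?M'"
      using ear_removal[OF IH(1) len, of y] by metis+
    moreover have "z \<in> exterior_face ?M'" "nbrs G z \<in> cycle_edges ?zs'" if z: "z \<in> Y" for z
    proof -
      have "exterior_face ?M \<subseteq> exterior_face ?M'"
        using exterior_face_mono[of ?M "verts ?M - {y}"] plane_graph_induced[OF D(1), of "verts G - Y"] MM by auto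
      then show "z \<in> exterior_face ?M'" using IH(2)[OF z] by blast
      have "y \<notin> nbrs G z"
        using nbrs_ear(1)[OF assms(1,2), of z] insert.prems(1) z y(2) by auto
      then show "nbrs G z \<in> cycle_edges ?zs'"
        using cycle_edges_filter[of "nbrs G z" ?zs y] IH(2)[OF z] D(5) zz by simp
    qed
    ultimately show ?case by blast
  qed
qed

text \<open>
  If the ears \<open>y\<close> and \<open>z\<close> had the same neighbours, then after deleting all ears but \<open>z\<close> their common
  neighbours would be joined by a side, left behind by \<open>y\<close>, whereas the neighbours of an ear are never
  joined by a side as long as there are four vertices.
\<close>

lemma nbrs_inj_on_ears:
  assumes "mop_along G xs" "4 \<le> length xs" "3 \<le> card (verts G - ears G)"
  shows "inj_on (nbrs G) (ears G)"
proof (rule inj_onI, rule ccontr)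
  fix y z assume yz: "y \<in> ears G" "z \<in> ears G" "nbrs G y = nbrs G z" "y \<noteq> z"
  note D = outerplaneD[OF assms(1)[unfolded mop_along_def, THEN conjunct1]]
  let ?Y = "ears G - {z}"
  let ?M = "induced G (verts G - ?Y)" and ?zs = "filter (\<lambda>x. x \<notin> ?Y) xs"
  have fin: "finite (verts G)" by (rule plane_graphD(1)[OF D(1)])
  have z: "z \<in> verts G" using yz by (simp add: ears_def)
  have c: "card (verts G - ?Y) = Suc (card (verts G - ears G))"
  proof -
    have "card (insert z (verts G - ears G)) = Suc (card (verts G - ears G))"
      using fin yz by (intro card_insert_disjoint) auto
    moreover have "insert z (verts G - ears G) = verts G - ?Y" using z yz by auto
    ultimately show ?thesis by argo
  qed
  then have R: "mop_along ?M ?zs" "nbrs G y \<in> cycle_edges ?zs"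
    using ears_removal[OF assms(1,2), of ?Y] assms(3) yz(1,4) by auto
  have len: "4 \<le> length ?zs"
    using card_verts[of ?M ?zs] R(1) c assms(3) by (simp add: mop_along_def)
  have n: "nbrs ?M z = nbrs G z"
    using nbrs_ear(1)[OF assms(1,2) yz(2)] z by (intro nbrs_induced) auto
  then have "vertex_degree ?M z = 2"
    using nbrs_ear(2)[OF assms(1,2) yz(2)] by (simp add: vertex_degree_def)
  moreover have "z \<in> set ?zs" using D(3) z by auto
  ultimately show False using ear_removal(3)[OF R(1) len, of z] n R(2) yz(3) by simp
qed

section \<open>Dominating sets\<close>

lemma domination_number_le:
  assumes "finite (verts G)" "dominating G S"
  shows "domination_number G \<le> card S"
proof -
  have "finite {S. dominating G S}"
    by (rule finite_subset[of _ "Pow (verts G)"]) (use assms in \<open>auto simp: dominating_def\<close>)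
  then show ?thesis unfolding domination_number_def using assms(2) by (intro Min_le) auto
qed

lemma packing_le_domination_number:
  assumes "finite (verts G)" "P \<subseteq> verts G"
    "\<And>y z. y \<in> P \<Longrightarrow> z \<in> P \<Longrightarrow> y \<noteq> z \<Longrightarrow> insert y (nbrs G y) \<inter> insert z (nbrs G z) = {}"
  shows "card P \<le> domination_number G"
proof -
  have *: "card P \<le> card S" if S: "dominating G S" for S
  proof -
    have "\<exists>u. u \<in> S \<and> u \<in> insert y (nbrs G y)" if "y \<in> P" for y
    proof (cases "y \<in> S")
      case False
      then obtain u where "u \<in> S" "{u, y} \<in> edges G"
        using S assms(2) \<open>y \<in> P\<close> unfolding dominating_def by blast
      then show ?thesis by (auto simp: nbrs_def insert_commute)
    qed auto
    then obtain f where f: "\<And>y. y \<in> P \<Longrightarrow> f y \<in> S \<and> f y \<in> insert y (nbrs G y)" by metis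
    have "inj_on f P"
    proof (rule inj_onI, rule ccontr)
      fix y z assume yz: "y \<in> P" "z \<in> P" "f y = f z" "y \<noteq> z"
      then show False using assms(3)[OF yz(1,2,4)] f[OF yz(1)] f[OF yz(2)] by auto
    qed
    moreover have "finite S" using S assms(1) finite_subset by (auto simp: dominating_def)
    ultimately show ?thesis using f by (intro card_inj_on_le) auto
  qed
  have "finite {S. dominating G S}"
    by (rule finite_subset[of _ "Pow (verts G)"]) (use assms in \<open>auto simp: dominating_def\<close>)
  moreover have "dominating G (verts G)" by (simp add: dominating_def)
  ultimately show ?thesis unfolding domination_number_def using * by (subst Min_ge_iff) auto
qed

text \<open>
  Every second vertex of the path covers it.
\<close>

lemma path_cover:
  "\<exists>D\<subseteq>set xs. 2 * card D \<le> length xs \<and> (\<forall>e\<in>path_edges xs. e \<inter> D \<noteq> {})"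
proof (induction xs rule: induct_list012)
  case (3 x y zs)
  then obtain D where D: "D \<subseteq> set zs" "2 * card D \<le> length zs" "\<forall>e\<in>path_edges zs. e \<inter> D \<noteq> {}"
    by blast
  have "e \<inter> insert y D \<noteq> {}" if "e \<in> path_edges (x # y # zs)" for e
    using that D(3) by (cases zs) auto
  moreover have "2 * card (insert y D) \<le> length (x # y # zs)"
    using D(2) card_insert_le_m1[of "Suc (card D)" D y] by (auto simp: card_insert_if)
  ultimately show ?case using D(1) by (intro exI[of _ "insert y D"]) auto
qed auto

text \<open>
  One vertex of the cycle together with a cover of the path formed by the others. The rounding in
  \<open>length xs + 1\<close> is only used up when the length is odd.
\<close>

lemma cycle_cover:
  assumes "xs \<noteq> []"
  shows "\<exists>D\<subseteq>set xs. 2 * card D \<le> length xs + 1 \<and> (\<forall>e\<in>cycle_edges xs. e \<inter> D \<noteq> {})"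
proof -
  obtain x ys where xs: "xs = x # ys" using assms by (cases xs) auto
  obtain D where D: "D \<subseteq> set ys" "2 * card D \<le> length ys" "\<forall>e\<in>path_edges ys. e \<inter> D \<noteq> {}"
    using path_cover[of ys] by (elim exE conjE)
  have "e \<inter> insert x D \<noteq> {}" if "e \<in> cycle_edges xs" for e
    using that D(3) xs by (cases ys) (auto simp: cycle_edges_conv)
  moreover have "2 * card (insert x D) \<le> length xs + 1"
    using D(2) finite_subset[OF D(1)] xs by (simp add: card_insert_if)
  ultimately show ?thesis using D(1) xs by (intro exI[of _ "insert x D"]) auto
qed

lemma path_edge_split:
  "e \<in> path_edges xs \<Longrightarrow> \<exists>A p q C. xs = A @ p # q # C \<and> e = {p, q}"
proof (induction xs rule: path_edges.induct)
  case (1 x y zs)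
  show ?case
  proof (cases "e = {x, y}")
    case True
    then show ?thesis by (intro exI[of _ "[]"] exI[of _ x] exI[of _ y] exI[of _ zs]) simp
  next
    case False
    then obtain A p q C where "y # zs = A @ p # q # C" "e = {p, q}" using 1 by auto
    then show ?thesis by (intro exI[of _ "x # A"] exI[of _ p] exI[of _ q] exI[of _ C]) simp
  qed
qed auto

lemma cycle_edge_rotate:
  assumes "e \<in> cycle_edges xs"
  obtains us vs where "xs = us @ vs" "e = {last (vs @ us), hd (vs @ us)}"
proof -
  have "xs \<noteq> []" using assms by (auto simp: cycle_edges_def)
  then consider "e = {last xs, hd xs}" | "e \<in> path_edges xs" using assms by (auto simp: cycle_edges_conv)
  then show thesis
  proof cases
    case 1
    then show thesis using that[of "[]" xs] by simp
  next
    case 2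
    then obtain A p q C where "xs = A @ p # q # C" "e = {p, q}" using path_edge_split by blast
    then show thesis using that[of "A @ [p]" "q # C"] by simp
  qed
qed

lemma path_vertices_covered: "2 \<le> length xs \<Longrightarrow> \<Union> (path_edges xs) = set xs"
proof (induction xs rule: path_edges.induct)
  case (1 x y zs)
  then show ?case by (cases zs) auto
qed auto

text \<open>
  \<open>E\<close> is a set of edges that spans the vertices other than ears and includes the edge on which each ear
  sits. A vertex cover of \<open>E\<close> then meets every closed neighbourhood.
\<close>

lemma cover_dominates:
  assumes "mop_along G xs" "4 \<le> length xs" "D \<subseteq> verts G" "E \<subseteq> edges G" "\<Union> E = verts G - ears G"
    "\<And>e. e \<in> E \<Longrightarrow> e \<inter> D \<noteq> {}" "\<And>y. y \<in> ears G \<Longrightarrow> nbrs G y \<in> E"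
  shows "dominating G D"
  unfolding dominating_def
proof (intro conjI ballI assms(3))
  note D = outerplaneD[OF assms(1)[unfolded mop_along_def, THEN conjunct1]]
  fix v assume v: "v \<in> verts G - D"
  show "\<exists>u\<in>D. {u, v} \<in> edges G"
  proof (cases "v \<in> ears G")
    case True
    then obtain u where "u \<in> nbrs G v" "u \<in> D" using assms(6,7) by blast
    then show ?thesis by (auto simp: nbrs_def insert_commute)
  next
    case False
    then obtain e where e: "e \<in> E" "v \<in> e" using v assms(5) by blast
    then obtain u where u: "u \<in> e" "u \<in> D" using assms(6) by blast
    have "card e = 2" using e assms(4) plane_graphD(3)[OF D(1)] by blast
    moreover have "{u, v} \<subseteq> e" "u \<noteq> v" using e u v by auto
    ultimately have "e = {u, v}" by (metis card_2_iff insert_absorb insert_subset singletonD insertE insert_commute)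
    then show ?thesis using e u assms(4) by blast
  qed
qed

text \<open>
  \<open>E\<close> in \<open>cover_dominates\<close> is the outer cycle of the mop without ears, or that cycle without one
  edge that carries no ear. When fewer than three vertices remain, the mop has two vertices besides its
  ears, and either of them dominates.
\<close>

theorem domination_number_le_cover:
  assumes "mop_along G xs" "4 \<le> length xs"
  shows "2 * domination_number G + card (ears G) \<le>
    length xs + (if odd (card (ears G)) \<and> length xs = 2 * card (ears G) then 1 else 0)"
proof -
  note out = assms(1)[unfolded mop_along_def, THEN conjunct1]
  note D = outerplaneD[OF out]
  let ?Y = "ears G" and ?V = "verts G - ears G"
  have fin: "finite (verts G)" by (rule plane_graphD(1)[OF D(1)])
  have Yv: "?Y \<subseteq> verts G" by (auto simp: ears_def)
  have n: "length xs = card ?V + card ?Y"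
    using card_verts[OF out] card_Diff_subset[OF finite_subset[OF Yv fin] Yv] card_mono[OF fin Yv] by simp
  show ?thesis
  proof (cases "3 \<le> card ?V")
    case True
    let ?M = "induced G ?V" and ?ms = "filter (\<lambda>x. x \<notin> ?Y) xs"
    have R: "mop_along ?M ?ms" "\<And>y. y \<in> ?Y \<Longrightarrow> nbrs G y \<in> cycle_edges ?ms"
      using ears_removal[OF assms _ True] by auto
    note DM = outerplaneD[OF R(1)[unfolded mop_along_def, THEN conjunct1]]
    have m: "length ?ms = card ?V" using card_verts[of ?M ?ms] R(1) by (simp add: mop_along_def)
    have sub: "cycle_edges ?ms \<subseteq> edges G" using DM(6) by auto
    have V: "set ?ms = ?V" using DM(3) by simp
    have im: "nbrs G ` ?Y \<subseteq> cycle_edges ?ms" using R(2) by auto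
    have card_ce: "card (cycle_edges ?ms) = card ?V" using card_cycle_edges DM(4,5) m by metis
    have finc: "finite (cycle_edges ?ms)" using card_ce True card.infinite by fastforce
    have cardY: "card (nbrs G ` ?Y) = card ?Y"
      by (rule card_image[OF nbrs_inj_on_ears[OF assms True]])
    show ?thesis
    proof (cases "nbrs G ` ?Y = cycle_edges ?ms")
      case True
      then have eq: "card ?Y = card ?V" using card_ce cardY by simp
      have ne: "?ms \<noteq> []" using DM(4) by (metis list.size(3) not_numeral_le_zero)
      obtain S where S: "S \<subseteq> set ?ms" "2 * card S \<le> length ?ms + 1" "\<forall>e\<in>cycle_edges ?ms. e \<inter> S \<noteq> {}"
        using cycle_cover[OF ne] by (elim exE conjE)
      have "dominating G S"
        by (rule cover_dominates[OF assms _ sub])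
          (use S V R(2) cycle_vertices_covered[OF ne] in \<open>auto\<close>)
      then have "2 * domination_number G \<le> card ?V + 1"
        using domination_number_le[OF fin, of S] S(2) m by linarith
      then show ?thesis using n eq by (auto elim!: evenE)
    next
      case False
      then obtain e where e: "e \<in> cycle_edges ?ms" "e \<notin> nbrs G ` ?Y" using im by blast
      obtain us vs where uv: "?ms = us @ vs" "e = {last (vs @ us), hd (vs @ us)}"
        using cycle_edge_rotate[OF e(1)] .
      have len: "2 \<le> length (vs @ us)" using DM(4) uv(1) by simp
      then have ne: "vs @ us \<noteq> []" by auto
      have ce: "cycle_edges ?ms = insert e (path_edges (vs @ us))"
        using cycle_edges_append_commute[of us vs] cycle_edges_conv[OF ne] uv by simp
      have same: "set ?ms = set (vs @ us)" "length ?ms = length (vs @ us)" using uv(1) by auto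
      obtain S where S: "S \<subseteq> set (vs @ us)" "2 * card S \<le> length (vs @ us)"
        "\<forall>e\<in>path_edges (vs @ us). e \<inter> S \<noteq> {}"
        using path_cover[of "vs @ us"] by (elim exE conjE)
      have "dominating G S"
      proof (rule cover_dominates[OF assms])
        show "S \<subseteq> verts G" using S(1) same(1) V by auto
        show "path_edges (vs @ us) \<subseteq> edges G" using ce sub by blast
        show "\<Union> (path_edges (vs @ us)) = ?V" using path_vertices_covered[OF len] same(1) V by simp
        show "\<And>e. e \<in> path_edges (vs @ us) \<Longrightarrow> e \<inter> S \<noteq> {}" using S(3) by blast
        fix y assume y: "y \<in> ?Y"
        then have "nbrs G y \<noteq> e" using e(2) by blast
        then show "nbrs G y \<in> path_edges (vs @ us)" using R(2)[OF y] ce by simp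
      qed
      then have "2 * domination_number G \<le> card ?V"
        using domination_number_le[OF fin, of S] S(2) m same(2) by linarith
      then show ?thesis using n by simp
    qed
  next
    case False
    then have "?Y \<noteq> {}" using n assms(2) by auto
    then obtain y where y: "y \<in> ?Y" by blast
    note N = nbrs_ear[OF assms]
    have finV: "finite ?V" using fin by simp
    have V: "nbrs G z = ?V" if "z \<in> ?Y" for z
      using N(1,2)[OF that] card_mono[OF finV N(1)[OF that]] False by (intro card_subset_eq[OF finV]) auto
    then have cV: "card ?V = 2" using N(2)[OF y] y by simp
    then obtain p q where pq: "?V = {p, q}" by (auto simp: card_2_iff)
    have "dominating G {p}"
    proof (rule cover_dominates[OF assms])
      show "{p} \<subseteq> verts G" using pq by auto
      show "{?V} \<subseteq> edges G" using N(3)[OF y] V[OF y] by simp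
      show "\<And>e. e \<in> {?V} \<Longrightarrow> e \<inter> {p} \<noteq> {}" unfolding pq by simp
      show "\<And>z. z \<in> ?Y \<Longrightarrow> nbrs G z \<in> {?V}" using V by simp
    qed simp
    then have "domination_number G \<le> 1" using domination_number_le[OF fin, of "{p}"] by simp
    then show ?thesis using n cV by simp
  qed
qed

section \<open>Every polygon triangulation is drawn on a parabola\<close>

definition pt :: "real \<Rightarrow> complex" where
  "pt x = Complex x (x\<^sup>2)"

text \<open>
  The vertical distance to the parabola. It turns the chord between the points at \<open>u\<close> and \<open>v\<close> into
  the graph of \<open>(x - u) * (v - x)\<close>, so that comparing chords becomes comparing such products.
\<close>

definition height :: "complex \<Rightarrow> real" where
  "height z = Im z - (Re z)\<^sup>2"

lemma pt_simps [simp]: "Re (pt x) = x" "Im (pt x) = x\<^sup>2" "height (pt x) = 0"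
  by (simp_all add: pt_def height_def)

lemma inj_pt: "inj pt"
  by (metis injI pt_simps(1))

lemma pt_iff: "z = pt x \<longleftrightarrow> Re z = x \<and> height z = 0"
  by (auto simp: complex_eq_iff height_def)

lemma chord_on_parabola:
  assumes "u < v"
  shows "convex hull {pt u, pt v} = {z. u \<le> Re z \<and> Re z \<le> v \<and> height z = (Re z - u) * (v - Re z)}"
proof (intro equalityI subsetI)
  fix z assume "z \<in> convex hull {pt u, pt v}"
  then obtain t where t: "0 \<le> t" "t \<le> 1" "z = (1 - t) *\<^sub>R pt u + t *\<^sub>R pt v"
    by (auto simp: segment_convex_hull[symmetric] in_segment)
  have R: "Re z = u + t * (v - u)" and I: "Im z = (1 - t) * u\<^sup>2 + t * v\<^sup>2"
    unfolding t(3) by (simp_all add: algebra_simps)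
  have "0 \<le> t * (v - u)" "t * (v - u) \<le> 1 * (v - u)"
    using t(1) mult_right_mono[OF t(2), of "v - u"] assms by simp_all
  moreover have "height z = (Re z - u) * (v - Re z)"
    unfolding height_def R I by (simp add: power2_eq_square algebra_simps)
  ultimately show "z \<in> {z. u \<le> Re z \<and> Re z \<le> v \<and> height z = (Re z - u) * (v - Re z)}"
    using R by simp
next
  fix z assume z: "z \<in> {z. u \<le> Re z \<and> Re z \<le> v \<and> height z = (Re z - u) * (v - Re z)}"
  define t where "t = (Re z - u) / (v - u)"
  have t: "0 \<le> t" "t \<le> 1" "Re z = u + t * (v - u)" using z assms by (auto simp: t_def)
  have "Im z = (Re z)\<^sup>2 + (Re z - u) * (v - Re z)" using z by (simp add: height_def)
  also have "\<dots> = (1 - t) * u\<^sup>2 + t * v\<^sup>2" unfolding t(3) by (simp add: power2_eq_square algebra_simps)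
  finally have "z = (1 - t) *\<^sub>R pt u + t *\<^sub>R pt v"
    using t(3) by (simp add: complex_eq_iff algebra_simps)
  then show "z \<in> convex hull {pt u, pt v}"
    using t by (auto simp: segment_convex_hull[symmetric] in_segment)
qed

lemma nested_chords:
  fixes x :: real
  assumes "u \<le> c" "d \<le> v" "c \<le> x" "x \<le> d"
  shows "(x - c) * (d - x) \<le> (x - u) * (v - x)"
  using assms by (intro mult_mono) auto

lemma nested_chords_strict:
  fixes x :: real
  assumes "u \<le> c" "d \<le> v" "c \<le> x" "x \<le> d" "u < x" "x < v" "(c, d) \<noteq> (u, v)"
  shows "(x - c) * (d - x) < (x - u) * (v - x)"
proof (cases "u < c")
  case True
  have "(x - c) * (d - x) \<le> (x - c) * (v - x)" using assms by (intro mult_left_mono) auto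
  also have "\<dots> < (x - u) * (v - x)" using assms True by (intro mult_strict_right_mono) auto
  finally show ?thesis .
next
  case False
  then have "d < v" "u = c" using assms by auto
  then show ?thesis using assms by simp
qed

abbreviation consecutive :: "'a list \<Rightarrow> ('a \<times> 'a) set" where
  "consecutive xs \<equiv> set (zip xs (tl xs))"

lemma path_edges_consecutive: "path_edges xs = (\<lambda>(c, d). {c, d}) ` consecutive xs"
  by (induction xs rule: path_edges.induct) auto

lemma consecutive_gap:
  assumes "sorted_wrt (<) (xs :: 'a :: linorder list)" "(c, d) \<in> consecutive xs"
  shows "c < d \<and> c \<in> set xs \<and> d \<in> set xs \<and> (\<forall>u\<in>set xs. u \<le> c \<or> d \<le> u)"
  using assms
proof (induction xs rule: path_edges.induct)
  case (1 x y zs)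
  then show ?case by (cases "(c, d) = (x, y)") (auto intro: less_imp_le)
qed auto

lemma consecutive_cover:
  fixes x :: "'a :: linorder"
  assumes "2 \<le> length xs" "hd xs \<le> x" "x \<le> last xs"
  shows "\<exists>(c, d)\<in>consecutive xs. c \<le> x \<and> x \<le> d"
  using assms
proof (induction xs rule: path_edges.induct)
  case (1 a b zs)
  then show ?case
  proof (cases "x \<le> b")
    case False
    then have "zs \<noteq> []" using 1(4) by auto
    then have "\<exists>(c, d)\<in>consecutive (b # zs). c \<le> x \<and> x \<le> d"
      using 1 False by (cases zs) auto
    then show ?thesis by auto
  qed auto
qed auto

lemma sorted_ends:
  assumes "sorted_wrt (<) (xs :: 'a :: linorder list)" "u \<in> set xs"
  shows "hd xs \<le> u \<and> u \<le> last xs"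
proof (cases xs rule: rev_cases)
  case (snoc ys y)
  then show ?thesis using assms by (cases ys) (auto simp: sorted_wrt_append intro: less_imp_le)
qed (use assms in auto)

lemma path_edges_map: "path_edges (map f ys) = (`) f ` path_edges ys"
  by (induction ys rule: path_edges.induct) auto

definition parabola_graph :: "real list \<Rightarrow> real set set \<Rightarrow> drawn_graph" where
  "parabola_graph xs E = \<lparr>verts = pt ` set xs, edges = (`) pt ` E, curve = (\<lambda>e. convex hull e)\<rparr>"

context
  fixes xs :: "real list" and E :: "real set set"
  assumes tri: "triangulated xs E" and sorted: "sorted_wrt (<) xs" and len: "3 \<le> length xs"
begin

lemma parabola_edge:
  assumes "e \<in> edges (parabola_graph xs E)"
  obtains u v where "e = {pt u, pt v}" "u < v" "u \<in> set xs" "v \<in> set xs" "{u, v} \<in> E"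
proof -
  obtain f where f: "f \<in> E" "e = pt ` f" using assms by (auto simp: parabola_graph_def)
  then have c: "card f = 2" "f \<subseteq> set xs" using triangulated_edge[OF tri] by auto
  then obtain a b where ab: "f = {a, b}" "a \<noteq> b" by (auto simp: card_2_iff)
  show thesis
  proof (cases "a < b")
    case True
    then show thesis using that[of a b] f c ab by simp
  next
    case False
    then show thesis using that[of b a] f c ab by (simp add: insert_commute)
  qed
qed

lemma plane_parabola_graph: "plane_graph (parabola_graph xs E)"
  unfolding plane_graph_def
proof (intro conjI ballI)
  let ?G = "parabola_graph xs E"
  show "finite (verts ?G)" by (simp add: parabola_graph_def)
  fix e assume "e \<in> edges ?G"
  then obtain u v where uv: "e = {pt u, pt v}" "u < v" "u \<in> set xs" "v \<in> set xs" "{u, v} \<in> E"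
    by (rule parabola_edge)
  then have ne: "pt u \<noteq> pt v" using inj_pt by (auto simp: inj_def)
  show "e \<subseteq> verts ?G" using uv by (simp add: parabola_graph_def)
  show "card e = 2" using uv ne by simp
  show "\<exists>g. arc g \<and> path_image g = curve ?G e \<and> {pathstart g, pathfinish g} = e"
    using uv ne by (intro exI[of _ "linepath (pt u) (pt v)"])
      (simp add: parabola_graph_def segment_convex_hull arc_linepath)
  have ce: "z \<in> curve ?G e - e \<longleftrightarrow> u < Re z \<and> Re z < v \<and> height z = (Re z - u) * (v - Re z)" for z
    using uv(2) unfolding uv(1) by (auto simp: parabola_graph_def chord_on_parabola pt_iff)
  show "(curve ?G e - e) \<inter> (verts ?G \<union> \<Union> (curve ?G ` (edges ?G - {e}))) = {}"
  proof (rule ccontr)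
    assume "\<not> ?thesis"
    then obtain z where z: "z \<in> curve ?G e - e"
      and "z \<in> verts ?G \<or> (\<exists>f\<in>edges ?G - {e}. z \<in> curve ?G f)" by blast
    moreover have "verts ?G = pt ` set xs" by (simp add: parabola_graph_def)
    ultimately consider w where "z = pt w" | f where "f \<in> edges ?G" "f \<noteq> e" "z \<in> curve ?G f"
      by blast
    then show False
    proof cases
      case 1
      then show False using z ce[of z] by auto
    next
      case 2
      obtain c d where cd: "f = {pt c, pt d}" "c < d" "{c, d} \<in> E"
        using parabola_edge[OF 2(1)] by metis
      have ne: "(c, d) \<noteq> (u, v)" using 2(2) uv(1) cd(1) by auto
      have x: "u < Re z" "Re z < v" "c \<le> Re z" "Re z \<le> d"
        and h: "(Re z - u) * (v - Re z) = (Re z - c) * (d - Re z)"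
        using z ce[of z] 2(3) cd(2) unfolding cd(1)
        by (auto simp: parabola_graph_def chord_on_parabola)
      consider "u \<le> c" "d \<le> v" | "c \<le> u" "v \<le> d" | "u < c" "v < d" | "c < u" "d < v" by linarith
      then show False
      proof cases
        case 1
        then show False using nested_chords_strict[of u c d v "Re z"] x h ne by simp
      next
        case 2
        then show False using nested_chords_strict[of c u v d "Re z"] x h ne by auto
      next
        case 3
        then show False using triangulated_noncrossing[OF tri sorted uv(5) cd(3)] x by auto
      next
        case 4
        then show False using triangulated_noncrossing[OF tri sorted cd(3) uv(5)] x by auto
      qed
    qed
  qed
qed

lemma cycle_edges_parabola:
  "cycle_edges (map pt xs) = (`) pt ` insert {hd xs, last xs} (path_edges xs)"
proof -
  have "xs \<noteq> []" using len by auto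
  then show ?thesis
    by (subst cycle_edges_conv) (auto simp: path_edges_map hd_map last_map insert_commute)
qed

lemma hamiltonian_cycle_parabola: "hamiltonian_cycle (parabola_graph xs E) (map pt xs)"
proof -
  have "cycle_edges (map pt xs) \<subseteq> (`) pt ` E"
    unfolding cycle_edges_parabola
    by (rule image_mono) (use triangulated_base[OF tri] triangulated_path[OF tri] in blast)
  then show ?thesis
    using len triangulated_distinct[OF tri] inj_pt
    by (auto simp: hamiltonian_cycle_def is_cycle_def parabola_graph_def distinct_map intro: inj_on_subset)
qed

lemma outline_parabola:
  "z \<in> outline (parabola_graph xs E) (map pt xs) \<longleftrightarrow>
    (hd xs \<le> Re z \<and> Re z \<le> last xs \<and> height z = (Re z - hd xs) * (last xs - Re z)) \<or>
    (\<exists>(c, d)\<in>consecutive xs. c \<le> Re z \<and> Re z \<le> d \<and> height z = (Re z - c) * (d - Re z))"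
proof -
  obtain a b ys where xs: "xs = a # b # ys" using len by (cases xs; cases "tl xs") auto
  have "hd xs < last xs" using sorted xs by (cases ys rule: rev_cases) (auto simp: sorted_wrt_append)
  then have top: "convex hull (pt ` {hd xs, last xs}) =
      {z. hd xs \<le> Re z \<and> Re z \<le> last xs \<and> height z = (Re z - hd xs) * (last xs - Re z)}"
    by (simp add: chord_on_parabola)
  have "convex hull (pt ` {c, d}) =
      {z. c \<le> Re z \<and> Re z \<le> d \<and> height z = (Re z - c) * (d - Re z)}"
    if "(c, d) \<in> consecutive xs" for c d
    using consecutive_gap[OF sorted that] by (simp add: chord_on_parabola)
  then have low: "(\<Union>(c, d)\<in>consecutive xs. convex hull (pt ` {c, d})) =
     {z. \<exists>(c, d)\<in>consecutive xs. c \<le> Re z \<and> Re z \<le> d \<and> height z = (Re z - c) * (d - Re z)}"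
    by fastforce
  have "outline (parabola_graph xs E) (map pt xs) = convex hull (pt ` {hd xs, last xs}) \<union>
      (\<Union>(c, d)\<in>consecutive xs. convex hull (pt ` {c, d}))"
    unfolding outline_def cycle_edges_parabola path_edges_consecutive
    by (auto simp: parabola_graph_def)
  then show ?thesis unfolding top low by blast
qed

text \<open>
  The open polygon with corners on the parabola: strictly below its longest chord and strictly above
  the chords of consecutive corners.
\<close>

definition between :: "complex set" where
  "between = {z. height z < (Re z - hd xs) * (last xs - Re z) \<and>
     (\<forall>(c, d)\<in>consecutive xs. (Re z - c) * (d - Re z) < height z)}"

definition weakly_between :: "complex set" where
  "weakly_between = {z. height z \<le> (Re z - hd xs) * (last xs - Re z) \<and>
     (\<forall>(c, d)\<in>consecutive xs. (Re z - c) * (d - Re z) \<le> height z)}"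

text \<open>
  Beyond the first corner the longest chord lies below the first short one, so no point can be
  between the two; similarly beyond the last corner.
\<close>

lemma weakly_between_Re:
  assumes "z \<in> weakly_between"
  shows "hd xs \<le> Re z" "Re z \<le> last xs"
proof -
  obtain a d e ys where xs: "xs = a # d # e # ys"
    using len by (cases xs; cases "tl xs"; cases "tl (tl xs)") auto
  then have "(a, d) \<in> consecutive xs" "d < last xs"
    using sorted sorted_ends[of "e # ys" e] by (auto simp: last_ConsR)
  moreover have "a = hd xs" using xs by simp
  ultimately have "(Re z - hd xs) * (d - Re z) \<le> (Re z - hd xs) * (last xs - Re z)" "d < last xs"
    using assms unfolding weakly_between_def by fastforce+
  then show "hd xs \<le> Re z"
    using mult_strict_left_mono_neg[of "d - Re z" "last xs - Re z" "Re z - hd xs"] by linarith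
next
  obtain ws c b where xs: "xs = ws @ [c, b]" "ws \<noteq> []"
  proof -
    obtain zs b where 1: "xs = zs @ [b]" using len by (cases xs rule: rev_cases) auto
    moreover obtain ws c where 2: "zs = ws @ [c]" using len 1 by (cases zs rule: rev_cases) auto
    moreover have "ws \<noteq> []" using len 1 2 by auto
    ultimately show thesis using that by simp
  qed
  have "length ws < length xs - 1" "xs ! length ws = c" "tl xs ! length ws = b"
    using xs by (auto simp: nth_tl nth_append)
  then have "(c, b) \<in> consecutive xs" by (auto simp: set_zip intro!: exI[of _ "length ws"])
  moreover have "hd xs < c" using sorted xs by (cases ws) (auto simp: sorted_wrt_append)
  moreover have "b = last xs" using xs by simp
  ultimately have "(Re z - c) * (last xs - Re z) \<le> (Re z - hd xs) * (last xs - Re z)" "hd xs < c"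
    using assms unfolding weakly_between_def by fastforce+
  then show "Re z \<le> last xs"
    using mult_strict_right_mono_neg[of "Re z - c" "Re z - hd xs" "last xs - Re z"] by linarith
qed

lemma weakly_between_cases:
  assumes "z \<in> weakly_between"
  shows "0 \<le> height z" "z \<in> between \<or> z \<in> outline (parabola_graph xs E) (map pt xs)"
proof -
  note x = weakly_between_Re[OF assms]
  have "2 \<le> length xs" using len by simp
  then obtain c d where cd: "(c, d) \<in> consecutive xs" "c \<le> Re z" "Re z \<le> d"
    using consecutive_cover x by blast
  have "0 \<le> (Re z - c) * (d - Re z)" using cd by simp
  also have "\<dots> \<le> height z" using assms cd(1) by (auto simp: weakly_between_def)
  finally show pos: "0 \<le> height z" .
  show "z \<in> between \<or> z \<in> outline (parabola_graph xs E) (map pt xs)"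
  proof (cases "z \<in> between")
    case False
    then consider "height z = (Re z - hd xs) * (last xs - Re z)"
      | c d where "(c, d) \<in> consecutive xs" "height z = (Re z - c) * (d - Re z)"
      using assms by (fastforce simp: between_def weakly_between_def)
    then show ?thesis
    proof cases
      case 1
      then show ?thesis using x by (simp add: outline_parabola)
    next
      case 2
      then have "c < d" using consecutive_gap[OF sorted] by blast
      then have "c \<le> Re z \<and> Re z \<le> d" using pos unfolding 2(2) by (auto simp: zero_le_mult_iff)
      then show ?thesis using 2 unfolding outline_parabola by blast
    qed
  qed simp
qed

text \<open>
  The region is open and its frontier lies on the outline, so a component of the complement of the
  outline that meets the region is contained in it; and the region is bounded.
\<close>

lemma between_inside: "between \<subseteq> inside (outline (parabola_graph xs E) (map pt xs))"
proof -
  let ?J = "outline (parabola_graph xs E) (map pt xs)"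
  have "between = {z. height z < (Re z - hd xs) * (last xs - Re z)} \<inter>
     (\<Inter>(c, d)\<in>consecutive xs. {z. (Re z - c) * (d - Re z) < height z})"
    by (auto simp: between_def)
  moreover have "open {z. height z < (Re z - hd xs) * (last xs - Re z)}"
    unfolding height_def by (intro open_Collect_less continuous_intros)
  moreover have "open (\<Inter>(c, d)\<in>consecutive xs. {z. (Re z - c) * (d - Re z) < height z})"
    unfolding height_def by (intro open_INT ballI) (auto intro!: open_Collect_less continuous_intros)
  ultimately have op: "open between" by auto
  have "weakly_between = {z. height z \<le> (Re z - hd xs) * (last xs - Re z)} \<inter>
     (\<Inter>(c, d)\<in>consecutive xs. {z. (Re z - c) * (d - Re z) \<le> height z})"
    by (auto simp: weakly_between_def)
  moreover have "closed {z. height z \<le> (Re z - hd xs) * (last xs - Re z)}"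
    unfolding height_def by (intro closed_Collect_le continuous_intros)
  moreover have "closed (\<Inter>(c, d)\<in>consecutive xs. {z. (Re z - c) * (d - Re z) \<le> height z})"
    unfolding height_def by (intro closed_INT ballI) (auto intro!: closed_Collect_le continuous_intros)
  ultimately have cl: "closed weakly_between" by auto
  have sub: "between \<subseteq> weakly_between" by (fastforce simp: between_def weakly_between_def)
  then have "closure between \<subseteq> weakly_between" using cl by (simp add: closure_minimal)
  then have fr: "frontier between \<subseteq> ?J"
    using weakly_between_cases(2) op by (auto simp: frontier_def interior_open)
  have disj: "between \<inter> ?J = {}"
    by (fastforce simp: outline_parabola between_def)
  have bd: "bounded between"
  proof (rule bounded_subset)
    let ?m = "max \<bar>hd xs\<bar> \<bar>last xs\<bar>"
    let ?w = "last xs - hd xs"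
    show "bounded (cbox (Complex (hd xs) 0) (Complex (last xs) (?w * ?w + ?m\<^sup>2)))" by (rule bounded_cbox)
    show "between \<subseteq> cbox (Complex (hd xs) 0) (Complex (last xs) (?w * ?w + ?m\<^sup>2))"
    proof
      fix z assume "z \<in> between"
      then have z: "z \<in> weakly_between" using sub by blast
      note x = weakly_between_Re[OF z] and h = weakly_between_cases(1)[OF z]
      have "height z \<le> (Re z - hd xs) * (last xs - Re z)" using z by (simp add: weakly_between_def)
      also have "\<dots> \<le> ?w * ?w" using x by (intro mult_mono) auto
      finally have "height z \<le> ?w * ?w" .
      moreover have "(Re z)\<^sup>2 \<le> ?m\<^sup>2" using x by (intro abs_le_square_iff[THEN iffD1]) auto
      ultimately show "z \<in> cbox (Complex (hd xs) 0) (Complex (last xs) (?w * ?w + ?m\<^sup>2))"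
        using x h order_trans[OF zero_le_power2, of "Re z" "Im z"]
        by (auto simp: in_cbox_complex_iff height_def)
    qed
  qed
  show ?thesis
  proof
    fix z assume z: "z \<in> between"
    let ?C = "connected_component_set (- ?J) z"
    have zJ: "z \<in> - ?J" using z disj by blast
    then have "z \<in> ?C" by (simp add: connected_component_refl)
    moreover have "?C \<subseteq> - ?J" by (rule connected_component_subset)
    then have "?C \<inter> frontier between = {}" using fr by blast
    moreover have "connected ?C" by (rule connected_connected_component)
    ultimately have "?C \<subseteq> between" using connected_Int_frontier[of ?C between] z by blast
    then have "bounded ?C" by (rule bounded_subset[OF bd])
    then show "z \<in> inside ?J" using zJ by (simp add: inside_def)
  qed
qed

text \<open>
  Every edge lies in the closed polygon: nested chords are ordered by height, and no corner lies
  strictly between consecutive ones.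
\<close>

lemma outerplane_parabola_graph: "outerplane (parabola_graph xs E) (map pt xs)"
proof -
  let ?G = "parabola_graph xs E" and ?J = "outline (parabola_graph xs E) (map pt xs)"
  have cyc: "is_cycle ?G (map pt xs)" "verts ?G = set (map pt xs)"
    using hamiltonian_cycle_parabola by (auto simp: hamiltonian_cycle_def)
  have "z \<in> weakly_between" if e: "e \<in> edges ?G" and z: "z \<in> curve ?G e" for e z
  proof -
    obtain u v where uv: "e = {pt u, pt v}" "u < v" "u \<in> set xs" "v \<in> set xs"
      using parabola_edge[OF e] by metis
    have x: "u \<le> Re z" "Re z \<le> v" and h: "height z = (Re z - u) * (v - Re z)"
      using z uv(2) unfolding uv(1) by (auto simp: parabola_graph_def chord_on_parabola)
    have "height z \<le> (Re z - hd xs) * (last xs - Re z)"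
      unfolding h using sorted_ends[OF sorted uv(3)] sorted_ends[OF sorted uv(4)] x
      by (intro nested_chords) auto
    moreover have "(Re z - c) * (d - Re z) \<le> height z" if cd: "(c, d) \<in> consecutive xs" for c d
    proof (cases "c < Re z \<and> Re z < d")
      case True
      have "u \<le> c" "d \<le> v" using consecutive_gap[OF sorted cd] uv(3,4) x True by force+
      then show ?thesis unfolding h using True by (intro nested_chords) auto
    next
      case False
      then have "(Re z - c) * (d - Re z) \<le> 0"
        using consecutive_gap[OF sorted cd] by (auto simp: mult_le_0_iff)
      also have "0 \<le> height z" unfolding h using x by simp
      finally show ?thesis .
    qed
    ultimately show ?thesis by (auto simp: weakly_between_def)
  qed
  then have "z \<in> ?J \<union> inside ?J" if "e \<in> edges ?G" "z \<in> curve ?G e" for e z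
    using weakly_between_cases(2)[of z] between_inside that by blast
  moreover have "verts ?G \<subseteq> ?J"
    using cycle_vertices_on_outline[OF plane_parabola_graph cyc(1)] cyc(2) by simp
  ultimately have "point_set ?G \<subseteq> ?J \<union> inside ?J" by (auto simp: point_set_def)
  then show ?thesis
    using plane_parabola_graph hamiltonian_cycle_parabola by (simp add: outerplane_def)
qed

end

lemma triangulated_map:
  assumes "triangulated xs E" "inj f"
  shows "triangulated (map f xs) ((`) f ` E)"
  using assms(1)
proof (induction rule: triangulated.induct)
  case (edge a b)
  then show ?case using assms(2) triangulated.edge[of "f a" "f b"] by (auto simp: inj_eq)
next
  case (glue a us v E1 ws b E2)
  have "distinct (map f (a # us @ v # ws @ [b]))"
    unfolding distinct_map using glue.hyps(3) inj_on_subset[OF assms(2) subset_UNIV] by blast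
  then show ?case
    using triangulated.glue[of "f a" "map f us" "f v" _ "map f ws" "f b"] glue.IH
    by (simp add: image_Un)
qed

text \<open>
  The corner \<open>i\<close> is placed at \<open>(i, i\<^sup>2)\<close> and edges are drawn as segments. Chords of a parabola
  cross only if their ends interleave, which edges of a triangulation never do.
\<close>

theorem triangulation_realised:
  fixes xs :: "nat list"
  assumes "triangulated xs E" "sorted_wrt (<) xs" "3 \<le> length xs"
  obtains G f where "mop_along G (map f xs)" "inj (f :: nat \<Rightarrow> complex)" "edges G = (`) f ` E"
proof -
  have inj: "inj (real :: nat \<Rightarrow> real)" by simp
  let ?xs = "map real xs" and ?E = "(`) real ` E"
  have t: "triangulated ?xs ?E" using triangulated_map[OF assms(1) inj] .
  have s: "sorted_wrt (<) ?xs" using assms(2) by (simp add: sorted_wrt_map)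
  have l: "3 \<le> length ?xs" using assms(3) by simp
  let ?G = "parabola_graph ?xs ?E" and ?f = "pt \<circ> real"
  have E: "edges ?G = (`) ?f ` E" by (simp add: parabola_graph_def image_image image_comp)
  have "outerplane ?G (map ?f xs)" using outerplane_parabola_graph[OF t s l] by simp
  moreover have inj_f: "inj ?f" using inj_pt inj by (rule inj_compose)
  moreover have "triangulated (map ?f xs) (edges ?G)" unfolding E by (rule triangulated_map[OF assms(1) inj_f])
  ultimately show thesis
    using that[of ?G ?f] triangulated_triangular_faces E by (simp add: mop_along_def)
qed

section \<open>The two bounds and the cases of equality\<close>

text \<open>
  Collects, in the vocabulary of the definitions, what the colouring and the covering argument give.
\<close>

lemma mop_bounds:
  assumes "mop G" "4 \<le> graph_order G"
  obtains xs where "mop_along G xs" "length xs = graph_order G" "num_deg2 G = card (ears G)"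
    "4 * domination_number G \<le> graph_order G + num_deg2 G"
    "2 * domination_number G + num_deg2 G \<le> graph_order G +
       (if odd (num_deg2 G) \<and> graph_order G = 2 * num_deg2 G then 1 else 0)"
proof -
  obtain xs where xs: "mop_along G xs" using assms(1) by (auto simp: mop_iff_mop_along)
  note out = xs[unfolded mop_along_def, THEN conjunct1]
  note D = outerplaneD[OF out]
  have n: "length xs = graph_order G" using card_verts[OF out] by (simp add: graph_order_def)
  have e: "num_deg2 G = card (ears G)" by (simp add: num_deg2_def ears_def)
  have "{v \<in> set xs. card (nb (edges G) v) = 2} = ears G"
    using D(3) by (auto simp: ears_def vertex_degree_def nbrs_eq_nb)
  then obtain S where S: "S \<subseteq> set xs" "\<forall>v\<in>set xs - S. \<exists>u\<in>S. {u, v} \<in> edges G"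
    "4 * card S \<le> length xs + card (ears G)"
    using triangulated_domination[OF mop_along_triangulated[OF xs] D(4)] by auto
  then have "dominating G S" using D(3) by (simp add: dominating_def)
  then have "4 * domination_number G \<le> graph_order G + num_deg2 G"
    using domination_number_le[OF plane_graphD(1)[OF D(1)], of S] S(3) n e by linarith
  moreover have "2 * domination_number G + num_deg2 G \<le> graph_order G +
       (if odd (num_deg2 G) \<and> graph_order G = 2 * num_deg2 G then 1 else 0)"
    using domination_number_le_cover[OF xs] assms(2) unfolding n e by simp
  ultimately show thesis using that[OF xs n e] by blast
qed

lemma attached_ears:
  assumes "mop_along G xs" "4 \<le> length xs" "3 \<le> card (verts G - ears G)"
    "distinct ys" "set ys = ears G"
  shows "attached G (induced G (verts G - ears G)) (filter (\<lambda>x. x \<notin> ears G) xs) ys"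
proof -
  let ?M = "induced G (verts G - ears G)"
  note D = outerplaneD[OF assms(1)[unfolded mop_along_def, THEN conjunct1]]
  note R = ears_removal[OF assms(1,2) subset_refl assms(3)]
  have "ears G \<subseteq> verts G" by (auto simp: ears_def)
  moreover have "edges G = edges ?M \<union> {{y, x} | y x. y \<in> set ys \<and> x \<in> nbrs G y}"
  proof (intro equalityI subsetI)
    fix e assume e: "e \<in> edges G"
    show "e \<in> edges ?M \<union> {{y, x} | y x. y \<in> set ys \<and> x \<in> nbrs G y}"
    proof (cases "e \<subseteq> verts G - ears G")
      case False
      then obtain y where y: "y \<in> e" "y \<in> ears G" using plane_graphD(2)[OF D(1) e] by blast
      moreover obtain x where "e = {y, x}"
        using plane_graphD(3)[OF D(1) e] y(1) by (auto simp: card_2_iff insert_commute)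
      ultimately show ?thesis using e assms(5) by (auto simp: nbrs_def)
    qed (use e in simp)
  qed (auto simp: nbrs_def)
  ultimately show ?thesis
    unfolding attached_def mop_iff_mop_along
    using R assms(4,5) by (auto simp: plane_subgraph_def mop_along_def outerplane_def)
qed

text \<open>
  All ears together serve as the attached vertices: the numbers fit, distinct ears sit on distinct
  sides, and a vertex of degree 2 in the rest that is adjacent to no ear already has degree 2 in the
  whole graph, so it is an ear and does not belong to the rest.
\<close>

lemma special_of_triple:
  assumes "mop_along G xs" "4 \<le> length xs" "length xs = 3 * card (ears G)"
  shows "special (card (ears G)) G"
proof -
  note out = assms(1)[unfolded mop_along_def, THEN conjunct1]
  note D = outerplaneD[OF out]
  let ?V = "verts G - ears G"
  let ?M = "induced G ?V" and ?ms = "filter (\<lambda>x. x \<notin> ears G) xs"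
  have fin: "finite (verts G)" by (rule plane_graphD(1)[OF D(1)])
  have sub: "ears G \<subseteq> verts G" by (auto simp: ears_def)
  have cV: "card ?V = 2 * card (ears G)"
    using card_Diff_subset[OF finite_subset[OF sub fin] sub] card_verts[OF out] assms(3) by simp
  then have three: "3 \<le> card ?V" using assms(2,3) by simp
  obtain ys where ys: "set ys = ears G" "distinct ys"
    using finite_distinct_list[OF finite_subset[OF sub fin]] by blast
  note att = attached_ears[OF assms(1,2) three ys(2,1)]
  note R = ears_removal[OF assms(1,2) subset_refl three]
  have "length ?ms = 2 * card (ears G)"
    using card_verts[of ?M ?ms] R cV by (simp add: mop_along_def)
  moreover have "x \<in> closed_nbrs G (set ys)" if x: "x \<in> set ?ms" "vertex_degree ?M x = 2" for x
  proof (rule ccontr)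
    assume not: "x \<notin> closed_nbrs G (set ys)"
    have xV: "x \<in> ?V" using x(1) D(3) by auto
    have "nbrs G x \<subseteq> ?V"
      using not mop_along_nbrs(1)[OF assms(1), of x] ys(1)
      by (auto simp: closed_nbrs_def nbrs_def insert_commute)
    then have "nbrs ?M x = nbrs G x" using xV by (intro nbrs_induced)
    then have "x \<in> ears G" using x(2) xV by (simp add: ears_def vertex_degree_def)
    then show False using xV by simp
  qed
  moreover have "length ys = card (ears G)" using ys distinct_card by metis
  ultimately have "special_via (card (ears G)) G ?M ?ms ys"
    using att R nbrs_inj_on_ears[OF assms(1,2) three] ys(1) by (simp add: special_via_def)
  moreover have "2 \<le> card (ears G)" using assms(2,3) by simp
  ultimately show ?thesis using assms(1) unfolding special_def mop_iff_mop_along by blast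
qed

text \<open>
  The rest is a triangle, and the three ears sit on three different sides of it, hence on all of
  them; they only have to be listed in the order of the sides.
\<close>

lemma extreme_of_six_three:
  assumes "mop_along G xs" "length xs = 6" "card (ears G) = 3"
  shows "extreme 3 G"
proof -
  note out = assms(1)[unfolded mop_along_def, THEN conjunct1]
  note D = outerplaneD[OF out]
  let ?V = "verts G - ears G"
  let ?M = "induced G ?V" and ?ms = "filter (\<lambda>x. x \<notin> ears G) xs"
  have fin: "finite (verts G)" by (rule plane_graphD(1)[OF D(1)])
  have sub: "ears G \<subseteq> verts G" by (auto simp: ears_def)
  have len: "4 \<le> length xs" using assms(2) by simp
  have cV: "card ?V = 3"
    using card_Diff_subset[OF finite_subset[OF sub fin] sub] card_verts[OF out] assms(2,3) by simp
  then have three: "3 \<le> card ?V" by simp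
  note R = ears_removal[OF assms(1) len subset_refl three]
  note inj = nbrs_inj_on_ears[OF assms(1) len three]
  have outM: "outerplane ?M ?ms" using R by (simp add: mop_along_def)
  note DM = outerplaneD[OF outM]
  have lm: "length ?ms = 3" using card_verts[OF outM] cV by simp
  have ce: "card (cycle_edges ?ms) = 3" using card_cycle_edges[OF DM(5,4)] lm by simp
  have im: "nbrs G ` ears G = cycle_edges ?ms"
  proof (rule card_subset_eq)
    show "finite (cycle_edges ?ms)" using ce card.infinite by fastforce
    show "nbrs G ` ears G \<subseteq> cycle_edges ?ms" using R by blast
    show "card (nbrs G ` ears G) = card (cycle_edges ?ms)" using card_image[OF inj] assms(3) ce by simp
  qed
  let ?e = "\<lambda>i. {?ms ! i, ?ms ! (Suc i mod 3)}"
  \<comment> \<open>Sends a side of the triangle to the ear that sits on it.\<close>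
  let ?f = "inv_into (ears G) (nbrs G)"
  define ys where "ys = map (\<lambda>i. ?f (?e i)) [0..<3]"
  have E: "cycle_edges ?ms = ?e ` {0..<3}" using lm by (auto simp: cycle_edges_def)
  have "set ys = ?f ` cycle_edges ?ms" unfolding ys_def E by auto
  also have "\<dots> = ears G" unfolding im[symmetric] by (rule inv_into_image_cancel[OF inj subset_refl])
  finally have set_ys: "set ys = ears G" .
  then have dist: "distinct ys" using assms(3) by (intro card_distinct) (simp add: ys_def)
  have "nbrs G (ys ! i) = ?e i" if "i < 3" for i
    unfolding ys_def using that im E by (simp add: f_inv_into_f del: upt_Suc)
  then show ?thesis
    unfolding extreme_def mop_iff_mop_along
    using assms(1) attached_ears[OF assms(1) len three dist set_ys] lm
    by (intro conjI exI[of _ ?M] exI[of _ ?ms] exI[of _ ys] exI[of _ xs]) (simp_all add: ys_def del: upt_Suc)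
qed

text \<open>
  The closed neighbourhoods of the attached vertices are pairwise disjoint, and each contains a
  vertex of any dominating set.
\<close>

lemma extra_special_domination_number:
  assumes "extra_special t G"
  shows "graph_order G = 3 * t" "t \<le> domination_number G"
proof -
  obtain M xs ys where v: "special_via t G M xs ys"
    and disj: "\<And>y z. y \<in> set ys \<Longrightarrow> z \<in> set ys \<Longrightarrow> y \<noteq> z \<Longrightarrow> nbrs G y \<inter> nbrs G z = {}"
    using assms by (auto simp: extra_special_def)
  have pg: "plane_graph G" using assms by (simp add: extra_special_def mop_def triangulated_disc_def)
  from v have len: "length xs = 2 * t" "length ys = t" and nb: "\<And>y. y \<in> set ys \<Longrightarrow> nbrs G y \<in> cycle_edges xs"
    and M: "plane_graph M" and xs: "set xs = verts M" "distinct xs"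
    and ys: "distinct ys" "set ys \<subseteq> exterior_face M" "set ys \<subseteq> verts G" and V: "verts G = verts M \<union> set ys"
    by (auto simp: special_via_def attached_def mop_def triangulated_disc_def hamiltonian_cycle_def is_cycle_def)
  have "verts M \<subseteq> point_set M" by (auto simp: point_set_def)
  then have d: "set xs \<inter> set ys = {}"
    using ys(2) xs(1) outside_no_overlap[of "point_set M"] unfolding exterior_face_eq_outside[OF M] by blast
  show "graph_order G = 3 * t"
    unfolding graph_order_def V xs(1)[symmetric]
    using card_Un_disjoint[OF _ _ d] distinct_card[OF xs(2)] distinct_card[OF ys(1)] len by simp
  have "nbrs G y \<subseteq> set xs" if "y \<in> set ys" for y using cycle_edges_subset[OF nb[OF that]] .
  then have "insert y (nbrs G y) \<inter> insert z (nbrs G z) = {}"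
    if "y \<in> set ys" "z \<in> set ys" "y \<noteq> z" for y z
    using that disj[OF that] d by blast
  then have "card (set ys) \<le> domination_number G"
    by (intro packing_le_domination_number[OF plane_graphD(1)[OF pg] ys(3)])
  then show "t \<le> domination_number G" using distinct_card[OF ys(1)] len by simp
qed

section \<open>Two sharp families\<close>

text \<open>
  The triangulation of the polygon \<open>0, \<dots>, 3 * s + 2\<close> in which the triangles on
  \<open>3 * j, 3 * j + 1, 3 * j + 2\<close> are attached to a fan with centre \<open>0\<close>. For \<open>0 < s\<close> the ears are the vertices
  \<open>3 * j + 1\<close>, and the blocks of three consecutive vertices are their disjoint closed neighbourhoods.
\<close>

fun block_fan :: "nat \<Rightarrow> nat set set" where
  "block_fan 0 = {{0, 1}, {1, 2}, {0, 2}}"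
| "block_fan (Suc s) = (let p = 3 * s + 3 in
     insert {0, p + 2} (insert {0, p} (block_fan s \<union> {{p - 1, p}}) \<union> {{p, p + 1}, {p + 1, p + 2}, {p, p + 2}}))"

lemma triangulated_extend:
  assumes "triangulated [0..<k] E" "2 \<le> k"
  shows "triangulated [0..<Suc k] (insert {0, k} (E \<union> {{k - 1, k}}))"
proof -
  have "triangulated ([0..<k] @ tl [k - 1, k]) (insert {hd [0..<k], last [k - 1, k]} (E \<union> {{k - 1, k}}))"
    using assms by (intro triangulated_glue triangulated.edge) auto
  then show ?thesis using assms(2) by (simp add: hd_upt)
qed

lemma triangulated_block_fan: "triangulated [0..<3 * s + 3] (block_fan s)"
proof (induction s)
  case 0
  have "[0..<3] = [0, 1, 2 :: nat]" by (simp add: upt_rec)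
  then show ?case using triangle_triangulated[of 0 1 "2 :: nat"] by simp
next
  case (Suc s)
  let ?p = "3 * s + 3"
  have 1: "triangulated [0..<Suc ?p] (insert {0, ?p} (block_fan s \<union> {{?p - 1, ?p}}))"
    by (rule triangulated_extend[OF Suc]) simp
  have 2: "triangulated [?p, ?p + 1, ?p + 2] {{?p, ?p + 1}, {?p + 1, ?p + 2}, {?p, ?p + 2}}"
    by (rule triangle_triangulated) simp
  have "[0..<Suc p] @ tl [p, p + 1, p + 2] = [0..<Suc (Suc (Suc p))]" for p by simp
  moreover have "3 * Suc s + 3 = Suc (Suc (Suc ?p))" by simp
  ultimately have "[0..<Suc ?p] @ tl [?p, ?p + 1, ?p + 2] = [0..<3 * Suc s + 3]" by metis
  moreover have "hd [0..<Suc ?p] = 0" by (simp add: hd_upt del: upt_Suc)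
  ultimately show ?case
    using triangulated_glue[OF 1 2] by (simp add: Let_def)
qed

lemma block_edges:
  "j \<le> s \<Longrightarrow> {3 * j, 3 * j + 1} \<in> block_fan s \<and> {3 * j + 1, 3 * j + 2} \<in> block_fan s \<and>
     {3 * j, 3 * j + 2} \<in> block_fan s"
  "j < s \<Longrightarrow> {3 * j + 2, 3 * j + 3} \<in> block_fan s"
  "{0, 3 * s + 2} \<in> block_fan s"
  "0 < s \<Longrightarrow> {0, 3} \<in> block_fan s"
proof -
  show "j \<le> s \<Longrightarrow> {3 * j, 3 * j + 1} \<in> block_fan s \<and> {3 * j + 1, 3 * j + 2} \<in> block_fan s \<and>
     {3 * j, 3 * j + 2} \<in> block_fan s"
  proof (induction s)
    case (Suc s)
    then show ?case by (cases "j = Suc s") (auto simp: Let_def numeral_eq_Suc)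
  qed (auto simp: numeral_eq_Suc)
  show "j < s \<Longrightarrow> {3 * j + 2, 3 * j + 3} \<in> block_fan s"
  proof (induction s)
    case (Suc s)
    then show ?case by (cases "j = s") (auto simp: Let_def)
  qed simp
  show "{0, 3 * s + 2} \<in> block_fan s" by (cases s) (auto simp: Let_def)
  show "0 < s \<Longrightarrow> {0, 3} \<in> block_fan s"
  proof (induction s)
    case (Suc s)
    then show ?case by (cases "s = 0") (auto simp: Let_def)
  qed simp
qed

lemma block_fan_ear: "{3 * j + 1, u} \<in> block_fan s \<Longrightarrow> u = 3 * j \<or> u = 3 * j + 2"
proof (induction s)
  case (Suc s)
  then show ?case by (auto simp: Let_def doubleton_eq_iff) presburger+
qed (auto simp: doubleton_eq_iff)

lemma nb_block_ear:
  assumes "block_fan s \<subseteq> E" "\<And>u. {3 * j + 1, u} \<in> E \<Longrightarrow> u = 3 * j \<or> u = 3 * j + 2" "j \<le> s"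
  shows "nb E (3 * j + 1) = {3 * j, 3 * j + 2}"
proof -
  have "{3 * j + 1, 3 * j} \<in> E" "{3 * j + 1, 3 * j + 2} \<in> E"
    using block_edges(1)[OF assms(3)] assms(1) by (auto simp only: insert_commute)
  then show ?thesis using assms(2) by (auto simp: nb_def)
qed

text \<open>
  The fan makes every vertex other than the tips of the blocks incident with three edges; \<open>0 < s\<close> is
  needed since a single block is a triangle, all of whose vertices have degree 2.
\<close>

lemma block_fan_degree:
  assumes "block_fan s \<subseteq> E" "finite (nb E k)" "0 < s" "k < 3 * s + 3" "k mod 3 \<noteq> 1"
  shows "3 \<le> card (nb E k)"
proof -
  have three: "3 \<le> card (nb E k)"
    if "{{k, a}, {k, b}, {k, c}} \<subseteq> block_fan s" "distinct [a, b, c]" for a b c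
  proof -
    have "{a, b, c} \<subseteq> nb E k" using that(1) assms(1) by (auto simp: nb_def)
    then have "card {a, b, c} \<le> card (nb E k)" by (rule card_mono[OF assms(2)])
    then show ?thesis using that(2) by simp
  qed
  consider "k = 0" | i where "k = 3 * i + 3" "i < s" | j where "k = 3 * j + 2" "j < s" | "k = 3 * s + 2"
  proof -
    have "k = 3 * (k div 3) + k mod 3" "k mod 3 < 3" by simp_all
    then consider "k = 3 * (k div 3)" | "k = 3 * (k div 3) + 2" using assms(5) by linarith
    then show thesis
    proof cases
      case 1
      then show thesis using that(1) that(2)[of "k div 3 - 1"] assms(4) by (cases "k div 3") auto
    next
      case 2
      then show thesis using that(3)[of "k div 3"] that(4) assms(4) by (cases "k div 3 = s") auto
    qed
  qed
  then show ?thesis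
  proof cases
    case 1
    then show ?thesis using block_edges(1)[of 0 s] block_edges(4)[OF assms(3)]
      by (intro three[of 1 2 3]) (auto simp: numeral_2_eq_2)
  next
    case 2
    have "3 * Suc i = 3 * i + 3" by simp
    then show ?thesis
      using block_edges(1)[of "Suc i" s] block_edges(2)[OF 2(2)] 2
      by (intro three[of "3 * i + 2" "3 * i + 4" "3 * i + 5"]) (auto simp: insert_commute numeral_eq_Suc)
  next
    case 3
    then show ?thesis using block_edges(1)[of j s] block_edges(2)[of j s]
      by (intro three[of "3 * j" "3 * j + 1" "3 * j + 3"]) (auto simp: insert_commute)
  next
    case 4
    then show ?thesis using block_edges(1)[of s s] block_edges(3)[of s] assms(3)
      by (intro three[of "3 * s" "3 * s + 1" 0]) (auto simp: insert_commute)
  qed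
qed

text \<open>
  \<open>E\<close> may have more edges than the fan, as long as none of them ends in a tip \<open>3 * j + 1\<close>; the tips then
  still have disjoint closed neighbourhoods.
\<close>

lemma block_fan_realised:
  assumes t: "triangulated [0..<k] E" and "3 * s + 3 \<le> k" "block_fan s \<subseteq> E"
    and ear: "\<And>j u. j \<le> s \<Longrightarrow> {3 * j + 1, u} \<in> E \<Longrightarrow> u = 3 * j \<or> u = 3 * j + 2"
  obtains G where "mop G" "graph_order G = k" "num_deg2 G = card {i. i < k \<and> card (nb E i) = 2}"
    "s + 1 \<le> domination_number G"
proof -
  have sorted: "sorted_wrt (<) [0..<k]" by simp
  have len: "3 \<le> length [0..<k]" using assms(2) by simp
  obtain G and f :: "nat \<Rightarrow> complex" where G: "mop_along G (map f [0..<k])" "inj f" "edges G = (`) f ` E"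
    using triangulation_realised[OF t sorted len] .
  note out = G(1)[unfolded mop_along_def, THEN conjunct1]
  note D = outerplaneD[OF out]
  have V: "verts G = f ` {0..<k}" using D(3) by simp
  have nbrs: "nbrs G (f i) = f ` nb E i" for i
  proof (intro equalityI subsetI)
    fix u assume "u \<in> nbrs G (f i)"
    then obtain e where e: "e \<in> E" "{f i, u} = f ` e" using G(3) by (auto simp: nbrs_def)
    then obtain m where "u = f m" by blast
    then have "f ` {i, m} = f ` e" using e by simp
    then have "{i, m} = e" unfolding inj_image_eq_iff[OF G(2)] .
    then show "u \<in> f ` nb E i" using e \<open>u = f m\<close> by (simp add: nb_def)
  next
    fix u assume "u \<in> f ` nb E i"
    then obtain m where "u = f m" "{i, m} \<in> E" by (auto simp: nb_def)
    moreover then have "f ` {i, m} \<in> edges G" using G(3) by blast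
    ultimately show "u \<in> nbrs G (f i)" by (simp add: nbrs_def)
  qed
  have deg: "vertex_degree G (f i) = card (nb E i)" for i
    unfolding vertex_degree_def nbrs by (rule card_image) (rule inj_on_subset[OF G(2) subset_UNIV])
  have "{v \<in> verts G. vertex_degree G v = 2} = f ` {i. i < k \<and> card (nb E i) = 2}"
    using deg unfolding V by auto
  then have n2: "num_deg2 G = card {i. i < k \<and> card (nb E i) = 2}"
    unfolding num_deg2_def by (simp add: card_image[OF inj_on_subset[OF G(2) subset_UNIV]])
  let ?g = "\<lambda>j. f (3 * j + 1)"
  have inj_g: "inj_on ?g {..s}" 
    by (rule inj_onI) (drule injD[OF G(2)], simp)
  have "card (?g ` {..s}) \<le> domination_number G"
  proof (rule packing_le_domination_number[OF plane_graphD(1)[OF D(1)]])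
    show "?g ` {..s} \<subseteq> verts G" unfolding V using assms(2) by auto
    fix y z assume "y \<in> ?g ` {..s}" "z \<in> ?g ` {..s}" "y \<noteq> z"
    then obtain i j where ij: "i \<le> s" "j \<le> s" "i \<noteq> j" "y = ?g i" "z = ?g j" by auto
    have N: "insert (?g l) (nbrs G (?g l)) = f ` {3 * l + 1, 3 * l, 3 * l + 2}" if "l \<le> s" for l
    proof -
      have "nb E (3 * l + 1) = {3 * l, 3 * l + 2}"
        using ear[OF that] by (rule nb_block_ear[OF assms(3) _ that])
      then show ?thesis unfolding nbrs by (simp only: image_insert image_empty)
    qed
    have "{3 * i + 1, 3 * i, 3 * i + 2} \<inter> {3 * j + 1, 3 * j, 3 * j + 2} = {}"
      using ij(3) by auto
    then show "insert y (nbrs G y) \<inter> insert z (nbrs G z) = {}"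
      unfolding ij(4,5) N[OF ij(1)] N[OF ij(2)] image_Int[OF G(2), symmetric] by simp
  qed
  then have "s + 1 \<le> domination_number G" using card_image[OF inj_g] by simp
  moreover have "graph_order G = k" using card_verts[OF out] by (simp add: graph_order_def)
  moreover have "mop G" using G(1) by (auto simp: mop_iff_mop_along)
  ultimately show thesis using that n2 by blast
qed

lemma card_block_ears: "card ((\<lambda>j. 3 * j + 1) ` {..s}) = s + (1 :: nat)"
  by (subst card_image) (auto simp: inj_on_def)

text \<open>
  Here the packing number \<open>s + 1\<close> equals a quarter of \<open>n + n2 = (3 * s + 3) + (s + 1)\<close>.
\<close>

lemma sharp_few_ears:
  assumes "0 < s"
  shows "\<exists>G. mop G \<and> graph_order G = 3 * s + 3 \<and> num_deg2 G = s + 1 \<and> domination_number G = s + 1"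
proof -
  let ?E = "block_fan s" and ?k = "3 * s + 3"
  note t = triangulated_block_fan[of s]
  obtain G where G: "mop G" "graph_order G = ?k" "num_deg2 G = card {i. i < ?k \<and> card (nb ?E i) = 2}"
    "s + 1 \<le> domination_number G"
    using block_fan_realised[OF t _ subset_refl] block_fan_ear by auto
  have "{i. i < ?k \<and> card (nb ?E i) = 2} = (\<lambda>j. 3 * j + 1) ` {..s}"
  proof (intro equalityI subsetI)
    fix i assume i: "i \<in> {i. i < ?k \<and> card (nb ?E i) = 2}"
    then have "i mod 3 = 1" using block_fan_degree[OF subset_refl finite_nb[OF t] assms, of i] by fastforce
    then have "i = 3 * (i div 3) + 1" by presburger
    moreover have "i < 3 * s + 3" using i by blast
    then have "i div 3 \<le> s" by presburger
    ultimately show "i \<in> (\<lambda>j. 3 * j + 1) ` {..s}" by blast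
  next
    fix i assume "i \<in> (\<lambda>j. 3 * j + 1) ` {..s}"
    then obtain j where j: "j \<le> s" "i = 3 * j + 1" by auto
    have "nb ?E i = {3 * j, 3 * j + 2}"
      unfolding j(2) by (rule nb_block_ear[OF subset_refl block_fan_ear j(1)])
    then show "i \<in> {i. i < ?k \<and> card (nb ?E i) = 2}" using j by simp
  qed
  then have n2: "num_deg2 G = s + 1" using G(3) card_block_ears by simp
  have "4 \<le> graph_order G" using G(2) assms by simp
  then have "4 * domination_number G \<le> graph_order G + num_deg2 G"
    using mop_bounds[OF G(1)] by metis
  then have "domination_number G \<le> s + 1" using G(2) n2 by simp
  then show ?thesis using G n2 by (intro exI[of _ G]) simp
qed

text \<open>
  One more ear on the base edge of the fan leaves the packing unchanged and raises \<open>n2\<close> above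
  \<open>n / 3\<close>; now the packing number is half of \<open>n - n2 = (3 * s + 4) - (s + 2)\<close>.
\<close>

lemma sharp_many_ears:
  assumes "0 < s"
  shows "\<exists>G. mop G \<and> graph_order G = 3 * s + 4 \<and> num_deg2 G = s + 2 \<and> domination_number G = s + 1"
proof -
  let ?p = "3 * s + 3" and ?k = "3 * s + 4"
  let ?E = "insert {0, ?p} (block_fan s \<union> {{?p - 1, ?p}})"
  have "triangulated [0..<Suc ?p] ?E"
    by (rule triangulated_extend[OF triangulated_block_fan]) simp
  moreover have "Suc ?p = ?k" by simp
  ultimately have t: "triangulated [0..<?k] ?E" by metis
  have sub: "block_fan s \<subseteq> ?E" by blast
  have ear: "u = 3 * j \<or> u = 3 * j + 2" if "{3 * j + 1, u} \<in> ?E" "j \<le> s" for j u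
  proof -
    have "3 * j + 1 \<notin> {0, ?p}" "3 * j + 1 \<notin> {?p - 1, ?p}" using that(2) by simp_all
    moreover have "3 * j + 1 \<in> {3 * j + 1, u}" by (rule insertI1)
    ultimately have "{3 * j + 1, u} \<noteq> {0, ?p}" "{3 * j + 1, u} \<noteq> {?p - 1, ?p}" by metis+
    then show ?thesis using that(1) block_fan_ear[of j u s] by simp
  qed
  obtain G where G: "mop G" "graph_order G = ?k" "num_deg2 G = card {i. i < ?k \<and> card (nb ?E i) = 2}"
    "s + 1 \<le> domination_number G"
    using block_fan_realised[OF t _ sub] ear by auto
  have "nb (block_fan s) ?p = {}"
    using triangulated_nb_outside[OF triangulated_block_fan[of s], of ?p] by simp
  then have nbp: "nb ?E ?p = {0, ?p - 1}" by (auto simp: nb_insert nb_Un doubleton_eq_iff)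
  have "{i. i < ?k \<and> card (nb ?E i) = 2} = insert ?p ((\<lambda>j. 3 * j + 1) ` {..s})"
  proof (intro equalityI subsetI)
    fix i assume i: "i \<in> {i. i < ?k \<and> card (nb ?E i) = 2}"
    show "i \<in> insert ?p ((\<lambda>j. 3 * j + 1) ` {..s})"
    proof (cases "i = ?p")
      case False
      then have lt: "i < 3 * s + 3" using i by simp
      then have "i mod 3 = 1" using i block_fan_degree[OF sub finite_nb[OF t] assms lt] by fastforce
      then have "i = 3 * (i div 3) + 1" by presburger
      moreover have "i div 3 \<le> s" using lt by presburger
      ultimately show ?thesis by blast
    qed simp
  next
    fix i assume "i \<in> insert ?p ((\<lambda>j. 3 * j + 1) ` {..s})"
    then consider "i = ?p" | j where "j \<le> s" "i = 3 * j + 1" by auto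
    then show "i \<in> {i. i < ?k \<and> card (nb ?E i) = 2}"
    proof cases
      case 1
      have "card (nb ?E ?p) = 2" unfolding nbp by simp
      then show ?thesis using 1 by simp
    next
      case (2 j)
      have "nb ?E i = {3 * j, 3 * j + 2}"
        unfolding 2(2) using nb_block_ear[OF sub ear[OF _ 2(1)] 2(1)] .
      then show ?thesis using 2 by simp
    qed
  qed
  moreover have "?p \<notin> (\<lambda>j. 3 * j + 1) ` {..s}" by auto
  ultimately have n2: "num_deg2 G = s + 2" using G(3) card_block_ears[of s] by simp
  have "4 \<le> graph_order G" using G(2) by simp
  then have "2 * domination_number G + num_deg2 G \<le> graph_order G +
       (if odd (num_deg2 G) \<and> graph_order G = 2 * num_deg2 G then 1 else 0)"
    using mop_bounds[OF G(1)] by metis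
  then have "domination_number G \<le> s + 1" using G(2) n2 assms by (simp split: if_splits)
  then show ?thesis using G n2 by (intro exI[of _ G]) simp
qed

section \<open>Domination in mops\<close>

theorem theorem8:
  "(\<forall>G n n2. mop G \<and> graph_order G = n \<and> 4 \<le> n \<and> num_deg2 G = n2 \<longrightarrow>
      (real n2 < real n / 3 \<longrightarrow>
         real (domination_number G) \<le> (real n + real n2) / 4 \<and>
         (real n + real n2) / 4 < real n / 3) \<and>
      (real n2 = real n / 3 \<longrightarrow>
         real (domination_number G) \<le> (real n + real n2) / 4 \<and>
         (real n + real n2) / 4 = (real n - real n2 + ind n n2) / 2 \<and>
         (real n - real n2 + ind n n2) / 2 = real n / 3) \<and>
      ((n, n2) = (6, 3) \<longrightarrow>
         real (domination_number G) \<le> (real n - real n2 + ind n n2) / 2 \<and>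
         (real n - real n2 + ind n n2) / 2 = real n / 3) \<and>
      (real n2 > real n / 3 \<and> (n, n2) \<noteq> (6, 3) \<longrightarrow>
         real (domination_number G) \<le> (real n - real n2 + ind n n2) / 2 \<and>
         (real n - real n2 + ind n n2) / 2 < real n / 3) \<and>
      (real (domination_number G) = real n / 3 \<longrightarrow> special n2 G \<or> extreme 3 G) \<and>
      (extra_special n2 G \<longrightarrow> real (domination_number G) = real n / 3)) \<and>
   infinite {n. \<exists>G n2. mop G \<and> graph_order G = n \<and> num_deg2 G = n2 \<and>
      real n2 \<le> real n / 3 \<and>
      real (domination_number G) = (real n + real n2) / 4} \<and>
   infinite {n. \<exists>G n2. mop G \<and> graph_order G = n \<and> num_deg2 G = n2 \<and>
      real n2 > real n / 3 \<and>
      real (domination_number G) = (real n - real n2 + ind n n2) / 2}"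
proof (intro conjI allI impI)
  fix G n n2
  assume G: "mop G \<and> graph_order G = n \<and> 4 \<le> n \<and> num_deg2 G = n2"
  then obtain xs where xs: "mop_along G xs" "length xs = n" "n2 = card (ears G)"
    and A: "4 * domination_number G \<le> n + n2"
    and B: "2 * domination_number G + n2 \<le> n + (if odd n2 \<and> n = 2 * n2 then 1 else 0)"
    using mop_bounds[of G] by metis
  have A': "real (domination_number G) \<le> (real n + real n2) / 4"
    using A by (simp flip: of_nat_le_iff[where 'a = real])
  have B': "real (domination_number G) \<le> (real n - real n2 + ind n n2) / 2"
    using B by (auto simp: ind_def split: if_splits)
  \<comment> \<open>The numerical claims hold for any \<open>n\<close> and \<open>n2\<close> in the stated range; the graph only enters through \<open>A\<close> and \<open>B\<close>.\<close>
  have n: "4 \<le> n" using G by blast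
  {
    assume "real n2 < real n / 3"
    then show "(real n + real n2) / 4 < real n / 3" by simp
  }
  {
    assume n2: "real n2 = real n / 3"
    then have "n = 3 * n2" by linarith
    then show "(real n + real n2) / 4 = (real n - real n2 + ind n n2) / 2"
      "(real n - real n2 + ind n n2) / 2 = real n / 3"
      using n by (simp_all add: ind_def)
  }
  {
    assume "(n, n2) = (6, 3)"
    then show "(real n - real n2 + ind n n2) / 2 = real n / 3" by (simp add: ind_def)
  }
  {
    assume many: "real n2 > real n / 3 \<and> (n, n2) \<noteq> (6, 3)"
    show "(real n - real n2 + ind n n2) / 2 < real n / 3"
    proof (cases "odd n2 \<and> n = 2 * n2")
      case True
      then have "n2 \<noteq> 3" "n2 \<noteq> 2" "2 \<le> n2" using many n by auto
      then have "4 \<le> n2" by linarith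
      then show ?thesis using True by (simp add: ind_def)
    next
      case False
      then show ?thesis using many by (auto simp: ind_def)
    qed
  }
  {
    assume "real (domination_number G) = real n / 3"
    then have g: "3 * domination_number G = n" by linarith
    show "special n2 G \<or> extreme 3 G"
    proof (cases "n = 3 * n2")
      case True
      then show ?thesis using special_of_triple[OF xs(1)] xs(2,3) n by simp
    next
      case False
      \<comment> \<open>With \<open>\<gamma> = n / 3\<close>, the first bound says \<open>n \<le> 3 * n2\<close> and the second \<open>3 * n2 \<le> n\<close> unless the extra half is present.\<close>
      then have odd: "odd n2" "n = 2 * n2" using A B g by (auto split: if_splits)
      then have "n2 = 3" using A B g n by (auto elim!: oddE)
      then show ?thesis using extreme_of_six_three[OF xs(1)] xs(2,3) odd by simp
    qed
  }
  {
    assume "extra_special n2 G"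
    note E = extra_special_domination_number[OF this]
    then have "domination_number G = n2" "n = 3 * n2" using A G by auto
    then show "real (domination_number G) = real n / 3" by simp
  }
  show "real (domination_number G) \<le> (real n + real n2) / 4" by (rule A')
  show "real (domination_number G) \<le> (real n + real n2) / 4" by (rule A')
  show "real (domination_number G) \<le> (real n - real n2 + ind n n2) / 2" by (rule B')
  show "real (domination_number G) \<le> (real n - real n2 + ind n n2) / 2" by (rule B')
next
  have inf: "infinite (range (\<lambda>s :: nat. 3 * s + 6))" by (rule range_inj_infinite) (simp add: inj_def)
  show "infinite {n. \<exists>G n2. mop G \<and> graph_order G = n \<and> num_deg2 G = n2 \<and>
      real n2 \<le> real n / 3 \<and> real (domination_number G) = (real n + real n2) / 4}"
  proof (rule infinite_super[OF _ inf], rule image_subsetI)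
    fix s :: nat
    obtain G where "mop G" "graph_order G = 3 * s + 6" "num_deg2 G = s + 2" "domination_number G = s + 2"
      using sharp_few_ears[of "Suc s"] by auto
    then show "3 * s + 6 \<in> {n. \<exists>G n2. mop G \<and> graph_order G = n \<and> num_deg2 G = n2 \<and>
      real n2 \<le> real n / 3 \<and> real (domination_number G) = (real n + real n2) / 4}"
      by (intro CollectI exI[of _ G] exI[of _ "s + 2"]) simp
  qed
next
  have inf: "infinite (range (\<lambda>s :: nat. 3 * s + 7))" by (rule range_inj_infinite) (simp add: inj_def)
  show "infinite {n. \<exists>G n2. mop G \<and> graph_order G = n \<and> num_deg2 G = n2 \<and>
      real n2 > real n / 3 \<and> real (domination_number G) = (real n - real n2 + ind n n2) / 2}"
  proof (rule infinite_super[OF _ inf], rule image_subsetI)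
    fix s :: nat
    obtain G where "mop G" "graph_order G = 3 * s + 7" "num_deg2 G = s + 3" "domination_number G = s + 2"
      using sharp_many_ears[of "Suc s"] by auto
    then show "3 * s + 7 \<in> {n. \<exists>G n2. mop G \<and> graph_order G = n \<and> num_deg2 G = n2 \<and>
      real n2 > real n / 3 \<and> real (domination_number G) = (real n - real n2 + ind n n2) / 2}"
      by (intro CollectI exI[of _ G] exI[of _ "s + 3"]) (simp add: ind_def)
  qed
qed

end
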